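(* Let $G=(V,E)$ be a compact topological packing graph. For every integer $t\ge 1$ we have $\mathrm{las}_t(G)=\mathrm{las}_t(G)^*$, and if $\mathrm{las}_t(G)$ is finite, then the optimum in $\mathrm{las}_t(G)$ is attained (i.e. the supremum defining $\mathrm{las}_t(G)$ is a maximum).
   Context: Graphs $G=(V,E)$ are undirected and without loops. A clique is a set of vertices in which every two distinct vertices are adjacent; an independent set is a set of vertices containing no edge. A graph whose vertex set $V$ is a Hausdorff topological space is a topological packing graph if each finite clique is contained in an open clique (an open subset of $V$ in which every two distinct vertices are adjacent). It is called compact if $V$ is compact. For $t\ge 1$ let $\mathrm{sub}_t(V)$ be the set of subsets of $V$ of cardinality at most $t$. The nonempty ones carry the quotient topology from $V^t$ (product topology) under $(v_1,\dots,v_t)\mapsto\{v_1,\dots,v_t\}$, and $\mathrm{sub}_t(V)$ is the disjoint union of this space with $\{\emptyset\}$. Let $I_t\subseteq \mathrm{sub}_t(V)$ be the set of independent sets with at most $t$ elements, with the subspace topology (it is a compact Hausdorff space), and let $I_{=s}$ be the set of independent sets with exactly $s$ elements. For a compact Hausdorff space $X$: $\mathcal{C}(X)$ is the space of continuous real-valued functions on $X$; $\mathcal{M}(X)$ is the space of signed Radon measures on $X$ (the dual of $\mathcal{C}(X)$ with the supremum norm) and $\mathcal{M}(X)_{\ge 0}$ the cone of nonnegative ones; $\mathcal{C}(X\times X)_{\mathrm{sym}}$ is the space of continuous symmetric kernels $K:X\times X\to\mathbb{R}$; $\mathcal{C}(X\times X)_{\succeq 0}$ is the cone of $K\in\mathcal{C}(X\times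 X)_{\mathrm{sym}}$ such that $(K(x_i,x_j))_{i,j=1}^m$ is positive semidefinite for all $m$ and all $x_1,\dots,x_m\in X$; $\mathcal{M}(X\times X)_{\mathrm{sym}}$ is the space of signed Radon measures $\mu$ on $X\times X$ with $\mu(E\times E')=\mu(E'\times E)$ for all Borel sets $E,E'$; and $\mathcal{M}(X\times X)_{\succeq 0}$ is the cone of $\mu\in\mathcal{M}(X\times X)_{\mathrm{sym}}$ with $\int K\,d\mu\ge 0$ for all $K\in\mathcal{C}(X\times X)_{\succeq 0}$. The operator $A_t:\mathcal{C}(I_t\times I_t)_{\mathrm{sym}}\to\mathcal{C}(I_{2t})$ is $A_tK(S)=\sum_{J,J'\in I_t:\,J\cup J'=S}K(J,J')$. It is bounded, and $A_t^*:\mathcal{M}(I_{2t})\to\mathcal{M}(I_t\times I_t)_{\mathrm{sym}}$ is its adjoint: $\int K\,d(A_t^*\lambda)=\int A_tK\,d\lambda$ for all $K$. Define $$\mathrm{las}_t(G)=\sup\{\lambda(I_{=1}):\lambda\in\mathcal{M}(I_{2t})_{\ge 0},\ \lambda(\{\emptyset\})=1,\ A_t^*\lambda\in\mathcal{M}(I_t\times I_t)_{\succeq 0}\},$$ $$\mathrm{las}_t(G)^*=\inf\{K(\emptyset,\emptyset):K\in\mathcal{C}(I_t\times I_t)_{\succeq 0},\ A_tK(S)\le -1_{I_{=1}}(S)\text{ for all }S\in I_{2t}\setminus\{\emptyset\}\},$$ where $1_{I_{=1}}$ is the characteristic function of $I_{=1}$. *)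

theory Defs
  imports "HOL-Analysis.Analysis"
begin

section \<open>Topological packing graphs\<close>

text \<open>A graph is a pair of a vertex space \<open>V\<close> (an abstract topology, so that the vertex set is
  \<open>topspace V\<close>) and a set \<open>E\<close> of two-element sets of vertices.\<close>

definition graph_on :: "'a topology \<Rightarrow> 'a set set \<Rightarrow> bool" where
  "graph_on V E \<longleftrightarrow> (\<forall>e\<in>E. e \<subseteq> topspace V \<and> card e = 2)"

definition clique :: "'a topology \<Rightarrow> 'a set set \<Rightarrow> 'a set \<Rightarrow> bool" where
  "clique V E C \<longleftrightarrow> C \<subseteq> topspace V \<and> (\<forall>u\<in>C. \<forall>v\<in>C. u \<noteq> v \<longrightarrow> {u, v} \<in> E)"

definition independent_set :: "'a topology \<Rightarrow> 'a set set \<Rightarrow> 'a set \<Rightarrow> bool" where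
  "independent_set V E S \<longleftrightarrow> S \<subseteq> topspace V \<and> (\<forall>e\<in>E. \<not> e \<subseteq> S)"

definition topological_packing_graph :: "'a topology \<Rightarrow> 'a set set \<Rightarrow> bool" where
  "topological_packing_graph V E \<longleftrightarrow>
     graph_on V E \<and> Hausdorff_space V \<and>
     (\<forall>C. finite C \<and> clique V E C \<longrightarrow> (\<exists>U. openin V U \<and> clique V E U \<and> C \<subseteq> U))"

definition compact_topological_packing_graph :: "'a topology \<Rightarrow> 'a set set \<Rightarrow> bool" where
  "compact_topological_packing_graph V E \<longleftrightarrow> topological_packing_graph V E \<and> compact_space V"

section \<open>Spaces of subsets and of independent sets\<close>

definition subsets_upto :: "nat \<Rightarrow> 'a topology \<Rightarrow> 'a set set" where
  "subsets_upto t V = {S. S \<subseteq> topspace V \<and> finite S \<and> card S \<le> t}"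

abbreviation power_space :: "nat \<Rightarrow> 'a topology \<Rightarrow> (nat \<Rightarrow> 'a) topology" where
  "power_space t V \<equiv> product_topology (\<lambda>_. V) {..<t}"

text \<open>For \<open>t \<ge> 1\<close> the map \<open>v \<mapsto> {v\<^sub>0, \<dots>, v\<^bsub>t-1\<^esub>}\<close> never takes the value \<open>{}\<close>, so the
  final topology on all of \<open>subsets_upto t V\<close> is the disjoint union of the quotient topology on
  the nonempty sets with the point \<open>{}\<close>; see the lemmas below.\<close>

definition sub_space :: "nat \<Rightarrow> 'a topology \<Rightarrow> 'a set topology" where
  "sub_space t V = topology (\<lambda>U. U \<subseteq> subsets_upto t V \<and>
     openin (power_space t V) {v \<in> topspace (power_space t V). v ` {..<t} \<in> U})"

lemma openin_sub_space:
  "openin (sub_space t V) U \<longleftrightarrow> U \<subseteq> subsets_upto t V \<and>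
     openin (power_space t V) {v \<in> topspace (power_space t V). v ` {..<t} \<in> U}"
proof -
  let ?P = "power_space t V"
  let ?pre = "\<lambda>U. {v \<in> topspace ?P. v ` {..<t} \<in> U}"
  have "istopology (\<lambda>U. U \<subseteq> subsets_upto t V \<and> openin ?P (?pre U))"
    unfolding istopology_def
  proof (intro conjI allI impI)
    fix S T
    assume "S \<subseteq> subsets_upto t V \<and> openin ?P (?pre S)" "T \<subseteq> subsets_upto t V \<and> openin ?P (?pre T)"
    moreover have "?pre (S \<inter> T) = ?pre S \<inter> ?pre T" by auto
    ultimately show "S \<inter> T \<subseteq> subsets_upto t V" "openin ?P (?pre (S \<inter> T))"
      by (auto intro: openin_Int)
  next
    fix \<K> assume *: "\<forall>K\<in>\<K>. K \<subseteq> subsets_upto t V \<and> openin ?P (?pre K)"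
    then show "\<Union>\<K> \<subseteq> subsets_upto t V" by auto
    have "?pre (\<Union>\<K>) = \<Union>(?pre ` \<K>)" by auto
    with * show "openin ?P (?pre (\<Union>\<K>))" by (auto intro!: openin_Union)
  qed
  then show ?thesis by (simp add: sub_space_def topology_inverse')
qed

lemma image_power_space:
  assumes "v \<in> topspace (power_space t V)"
  shows "v ` {..<t} \<in> subsets_upto t V"
proof -
  have "v ` {..<t} \<subseteq> topspace V" using assms by (auto simp: PiE_def Pi_def)
  moreover have "card (v ` {..<t}) \<le> t" using card_image_le[of "{..<t}" v] by simp
  ultimately show ?thesis by (simp add: subsets_upto_def)
qed

lemma topspace_sub_space [simp]: "topspace (sub_space t V) = subsets_upto t V"
proof
  show "topspace (sub_space t V) \<subseteq> subsets_upto t V"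
    using openin_sub_space[of t V "topspace (sub_space t V)"] by simp
  have "{v \<in> topspace (power_space t V). v ` {..<t} \<in> subsets_upto t V} = topspace (power_space t V)"
    using image_power_space by blast
  then have "openin (sub_space t V) (subsets_upto t V)"
    unfolding openin_sub_space by (metis openin_topspace order_refl)
  then show "subsets_upto t V \<subseteq> topspace (sub_space t V)" by (rule openin_subset)
qed

lemma openin_sub_space_empty:
  assumes "t \<ge> 1"
  shows "openin (sub_space t V) {{}}"
proof -
  have "{v \<in> topspace (power_space t V). v ` {..<t} \<in> {{}}} = {}"
    using assms by (auto simp: lessThan_empty_iff)
  moreover have "{{}} \<subseteq> subsets_upto t V" by (simp add: subsets_upto_def)
  ultimately show ?thesis unfolding openin_sub_space by (metis openin_empty)
qed

lemma openin_sub_space_nonempty: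
  assumes "t \<ge> 1"
  shows "openin (sub_space t V) (subsets_upto t V - {{}})"
proof -
  have "{v \<in> topspace (power_space t V). v ` {..<t} \<in> subsets_upto t V - {{}}}
      = topspace (power_space t V)"
    using image_power_space[where t = t and V = V] assms by (auto simp: lessThan_empty_iff)
  then show ?thesis unfolding openin_sub_space by (metis Diff_subset openin_topspace)
qed

lemma quotient_map_sub_space:
  assumes "t \<ge> 1"
  shows "quotient_map (power_space t V)
           (subtopology (sub_space t V) (subsets_upto t V - {{}})) (\<lambda>v. v ` {..<t})"
proof -
  have surj: "\<exists>v\<in>topspace (power_space t V). v ` {..<t} = S"
    if "S \<in> subsets_upto t V" "S \<noteq> {}" for S
  proof -
    from that have S: "finite S" "card S \<le> t" "S \<subseteq> topspace V" by (auto simp: subsets_upto_def)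
    obtain f where f: "bij_betw f {..<card S} S"
      using bij_betw_from_nat_into_finite[OF S(1)] by blast
    from that obtain s where s: "s \<in> S" by blast
    define v where "v = (\<lambda>i. if i < t then (if i < card S then f i else s) else undefined)"
    have im: "v ` {..<t} = S"
    proof
      show "v ` {..<t} \<subseteq> S" using f s by (auto simp: v_def bij_betw_def)
      show "S \<subseteq> v ` {..<t}"
      proof
        fix x assume "x \<in> S"
        then obtain i where "i < card S" "f i = x" using f by (force simp: bij_betw_def)
        then show "x \<in> v ` {..<t}" using S(2) by (auto simp: v_def intro!: image_eqI[of _ _ i])
      qed
    qed
    moreover have "v i \<in> topspace V" if "i < t" for i using im S(3) that by blast
    then have "v \<in> topspace (power_space t V)"
      by (auto simp: PiE_def extensional_def v_def)
    ultimately show ?thesis by blast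
  qed
  have im: "(\<lambda>v. v ` {..<t}) ` topspace (power_space t V) = subsets_upto t V - {{}}"
  proof
    show "(\<lambda>v. v ` {..<t}) ` topspace (power_space t V) \<subseteq> subsets_upto t V - {{}}"
      using assms image_power_space[where t = t and V = V] by (auto simp: lessThan_empty_iff)
    show "subsets_upto t V - {{}} \<subseteq> (\<lambda>v. v ` {..<t}) ` topspace (power_space t V)"
      using surj by (smt (verit) DiffE image_iff insertI1 subsetI)
  qed
  show ?thesis
    unfolding quotient_map_def
  proof (intro conjI allI impI)
    show "(\<lambda>v. v ` {..<t}) ` topspace (power_space t V)
        = topspace (subtopology (sub_space t V) (subsets_upto t V - {{}}))"
      using im by (simp only: topspace_subtopology topspace_sub_space) blast
  next
    fix U assume "U \<subseteq> topspace (subtopology (sub_space t V) (subsets_upto t V - {{}}))"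
    then have U: "U \<subseteq> subsets_upto t V - {{}}" by auto
    then have "openin (subtopology (sub_space t V) (subsets_upto t V - {{}})) U
        \<longleftrightarrow> openin (sub_space t V) U"
      using openin_open_subtopology[OF openin_sub_space_nonempty[OF assms]] by blast
    with U show "openin (power_space t V) {v \<in> topspace (power_space t V). v ` {..<t} \<in> U} \<longleftrightarrow>
        openin (subtopology (sub_space t V) (subsets_upto t V - {{}})) U"
      unfolding openin_sub_space by blast
  qed
qed

definition indep_upto :: "'a topology \<Rightarrow> 'a set set \<Rightarrow> nat \<Rightarrow> 'a set set" where
  "indep_upto V E t = {S \<in> subsets_upto t V. independent_set V E S}"

definition indep_space :: "'a topology \<Rightarrow> 'a set set \<Rightarrow> nat \<Rightarrow> 'a set topology" where
  "indep_space V E t = subtopology (sub_space t V) (indep_upto V E t)"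

definition indep_eq :: "'a topology \<Rightarrow> 'a set set \<Rightarrow> nat \<Rightarrow> 'a set set" where
  "indep_eq V E s = {S. independent_set V E S \<and> finite S \<and> card S = s}"

section \<open>Signed Radon measures\<close>

definition borel_of :: "'a topology \<Rightarrow> 'a measure" where
  "borel_of X = sigma (topspace X) {U. openin X U}"

text \<open>Finite (nonnegative) Radon measures on a compact Hausdorff space.\<close>

definition finite_radon_measure :: "'a topology \<Rightarrow> 'a measure \<Rightarrow> bool" where
  "finite_radon_measure X M \<longleftrightarrow>
     finite_measure M \<and> sets M = sets (borel_of X) \<and>
     (\<forall>A\<in>sets M. emeasure M A = (SUP K\<in>{K. compactin X K \<and> K \<in> sets M \<and> K \<subseteq> A}. emeasure M K))"

text \<open>A signed measure is a real-valued set function; it is fixed to be 0 on non-measurable sets,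
  so that two signed measures are equal iff they agree on all measurable sets.\<close>

definition signed_measure :: "'a measure \<Rightarrow> ('a set \<Rightarrow> real) \<Rightarrow> bool" where
  "signed_measure M \<mu> \<longleftrightarrow>
     \<mu> {} = 0 \<and>
     (\<forall>A :: nat \<Rightarrow> 'a set. range A \<subseteq> sets M \<and> disjoint_family A \<longrightarrow>
        (\<lambda>i. \<mu> (A i)) sums \<mu> (\<Union>i. A i)) \<and>
     (\<forall>A. A \<notin> sets M \<longrightarrow> \<mu> A = 0)"

text \<open>The two parts of the Jordan decomposition, given by
  \<open>\<mu>\<^sup>+(A) = sup {\<mu>(B) | B \<subseteq> A measurable}\<close> and \<open>\<mu>\<^sup>- = (-\<mu>)\<^sup>+\<close>. The coercion \<open>ennreal\<close> truncates
  negative values to 0, which is harmless because \<open>B = {}\<close> contributes 0.\<close>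

definition pos_variation :: "'a measure \<Rightarrow> ('a set \<Rightarrow> real) \<Rightarrow> 'a measure" where
  "pos_variation M \<mu> =
     measure_of (space M) (sets M) (\<lambda>A. SUP B\<in>{B \<in> sets M. B \<subseteq> A}. ennreal (\<mu> B))"

definition neg_variation :: "'a measure \<Rightarrow> ('a set \<Rightarrow> real) \<Rightarrow> 'a measure" where
  "neg_variation M \<mu> = pos_variation M (\<lambda>A. - \<mu> A)"

definition signed_radon_measures :: "'a topology \<Rightarrow> ('a set \<Rightarrow> real) set" where
  "signed_radon_measures X =
     {\<mu>. signed_measure (borel_of X) \<mu> \<and>
         finite_radon_measure X (pos_variation (borel_of X) \<mu>) \<and>
         finite_radon_measure X (neg_variation (borel_of X) \<mu>)}"

definition nonneg_radon_measures :: "'a topology \<Rightarrow> ('a set \<Rightarrow> real) set" where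
  "nonneg_radon_measures X =
     {\<mu> \<in> signed_radon_measures X. \<forall>A\<in>sets (borel_of X). 0 \<le> \<mu> A}"

definition signed_integral :: "'a topology \<Rightarrow> ('a set \<Rightarrow> real) \<Rightarrow> ('a \<Rightarrow> real) \<Rightarrow> real" where
  "signed_integral X \<mu> f =
     (\<integral>x. f x \<partial>pos_variation (borel_of X) \<mu>) - (\<integral>x. f x \<partial>neg_variation (borel_of X) \<mu>)"

section \<open>Kernels and their dual cone\<close>

definition sym_kernels :: "'a topology \<Rightarrow> ('a \<times> 'a \<Rightarrow> real) set" where
  "sym_kernels X =
     {K. continuous_map (prod_topology X X) euclideanreal K \<and>
         (\<forall>x\<in>topspace X. \<forall>y\<in>topspace X. K (x, y) = K (y, x))}"

definition psd_kernels :: "'a topology \<Rightarrow> ('a \<times> 'a \<Rightarrow> real) set" where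
  "psd_kernels X =
     {K \<in> sym_kernels X.
        \<forall>(m :: nat) (x :: nat \<Rightarrow> 'a) (c :: nat \<Rightarrow> real). (\<forall>i<m. x i \<in> topspace X) \<longrightarrow>
          0 \<le> (\<Sum>i<m. \<Sum>j<m. c i * c j * K (x i, x j))}"

text \<open>Measures on \<open>X \<times> X\<close> live on the Borel sets of the product topology, which for
  non-second-countable \<open>X\<close> may be more than the product of the Borel sigma-algebras.\<close>

definition sym_measures :: "'a topology \<Rightarrow> (('a \<times> 'a) set \<Rightarrow> real) set" where
  "sym_measures X =
     {\<mu> \<in> signed_radon_measures (prod_topology X X).
        \<forall>A\<in>sets (borel_of X). \<forall>B\<in>sets (borel_of X). \<mu> (A \<times> B) = \<mu> (B \<times> A)}"

definition psd_measures :: "'a topology \<Rightarrow> (('a \<times> 'a) set \<Rightarrow> real) set" where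
  "psd_measures X =
     {\<mu> \<in> sym_measures X. \<forall>K\<in>psd_kernels X. 0 \<le> signed_integral (prod_topology X X) \<mu> K}"

section \<open>The Lasserre hierarchy and its dual\<close>

definition A_op :: "'a topology \<Rightarrow> 'a set set \<Rightarrow> nat \<Rightarrow> ('a set \<times> 'a set \<Rightarrow> real) \<Rightarrow> 'a set \<Rightarrow> real"
  where
  "A_op V E t K S =
     (\<Sum>(J, J')\<in>{(J, J'). J \<in> indep_upto V E t \<and> J' \<in> indep_upto V E t \<and> J \<union> J' = S}. K (J, J'))"

text \<open>The adjoint: a symmetric signed Radon measure is determined by its integrals against
  continuous symmetric kernels.\<close>

definition A_adj ::
  "'a topology \<Rightarrow> 'a set set \<Rightarrow> nat \<Rightarrow> ('a set set \<Rightarrow> real) \<Rightarrow> (('a set \<times> 'a set) set \<Rightarrow> real)"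
  where
  "A_adj V E t \<nu> =
     (THE \<mu>. \<mu> \<in> sym_measures (indep_space V E t) \<and>
        (\<forall>K\<in>sym_kernels (indep_space V E t).
           signed_integral (prod_topology (indep_space V E t) (indep_space V E t)) \<mu> K =
           signed_integral (indep_space V E (2 * t)) \<nu> (A_op V E t K)))"

definition las_feasible :: "'a topology \<Rightarrow> 'a set set \<Rightarrow> nat \<Rightarrow> ('a set set \<Rightarrow> real) set" where
  "las_feasible V E t =
     {\<nu> \<in> nonneg_radon_measures (indep_space V E (2 * t)).
        \<nu> {{}} = 1 \<and> A_adj V E t \<nu> \<in> psd_measures (indep_space V E t)}"

definition las :: "'a topology \<Rightarrow> 'a set set \<Rightarrow> nat \<Rightarrow> ereal" where
  "las V E t = (SUP \<nu>\<in>las_feasible V E t. ereal (\<nu> (indep_eq V E 1)))"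

definition las_dual_feasible ::
  "'a topology \<Rightarrow> 'a set set \<Rightarrow> nat \<Rightarrow> ('a set \<times> 'a set \<Rightarrow> real) set" where
  "las_dual_feasible V E t =
     {K \<in> psd_kernels (indep_space V E t).
        \<forall>S\<in>indep_upto V E (2 * t) - {{}}. A_op V E t K S \<le> - indicator (indep_eq V E 1) S}"

definition las_dual :: "'a topology \<Rightarrow> 'a set set \<Rightarrow> nat \<Rightarrow> ereal" where
  "las_dual V E t = (INF K\<in>las_dual_feasible V E t. ereal (K ({}, {})))"

end

theory Submission
  imports Defs
begin

text \<open>
  Put \<open>X = I\<^bsub>2t\<^esub>\<close>, let \<open>e\<close> and \<open>b\<close> be the indicator functions of \<open>{\<emptyset>}\<close> and \<open>I\<^bsub>=1\<^esub>\<close> on \<open>X\<close>, and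
  consider the convex cone \<open>Q\<close> of all functions \<open>h + A\<^sub>tK\<close> with \<open>h\<close> continuous and nonnegative and
  \<open>K\<close> positive semidefinite. The primal problem maximises \<open>L b\<close> over the linear functionals \<open>L\<close> on
  \<open>C(X)\<close> that are nonnegative on \<open>Q\<close> and satisfy \<open>L e = 1\<close>; the dual problem minimises \<open>s\<close>
  subject to \<open>s e - b \<in> Q\<close>. Consequently, with \<open>p(f) = inf {s. s e - f \<in> Q}\<close>, the dual value is
  \<open>p(b)\<close>. If \<open>p\<close> is finite, then it is sublinear, and the Hahn-Banach theorem
  (\<open>Hahn_Banach_touching\<close>) yields a linear \<open>L \<le> p\<close> with \<open>L b = p(b)\<close>. Domination by \<open>p\<close> alone
  already forces \<open>L \<ge> 0\<close> on \<open>Q\<close> and \<open>L e = 1\<close>, so \<open>L\<close> is a primal solution whose value is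
  the dual optimum. This gives strong duality and attainment at the same time.

  Finiteness of \<open>p\<close> from below comes from evaluating at \<open>\<emptyset>\<close>. Finiteness from above says that \<open>e\<close>
  is an order unit for \<open>Q\<close>, and it amounts to a positive semidefinite kernel with
  \<open>A\<^sub>tK \<le> -1\<close> off \<open>\<emptyset>\<close> (\<open>strictly_feasible_kernel\<close>). This is the point where the
  packing condition enters: if \<open>f\<close> is a bump function on \<open>I\<^sub>t\<close> supported near \<open>J\<close>, then any two
  different sets in its support contain two adjacent vertices, one from each set, so that their union
  is not independent and the products \<open>f(J) f(J')\<close> with \<open>J \<noteq> J'\<close> never contribute to
  \<open>A\<^sub>t(f \<otimes> f)\<close>. Rank-one kernels \<open>(2g - f) \<otimes> (2g - f)\<close> built from two such bumps
  therefore have a negative image near a prescribed set, and compactness of \<open>X\<close> allows finitely many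
  of them to be added up.

  Two bodies of theory support this argument. The Riesz representation theorem
  (\<open>Riesz_representation\<close>) turns positive functionals into Radon measures; it is used for \<open>L\<close>
  itself and, through \<open>unique_symmetric_representation\<close>, to see that the adjoint \<open>A\<^sub>t\<^sup>*\<lambda>\<close> exists and is
  unique among the symmetric measures. The topology of \<open>I\<^sub>t\<close> is controlled by boxes: if
  \<open>S = {x\<^sub>1, \<dots>, x\<^sub>s}\<close> and \<open>U\<^sub>1, \<dots>, U\<^sub>s\<close> are disjoint open cliques around its points, then
  the independent sets that meet every \<open>U\<^sub>i\<close> and stay inside their union meet each \<open>U\<^sub>i\<close> exactly
  once. These sets form a neighbourhood base (\<open>box_neighbourhood_base\<close>). It shows that the size of an
  independent set is locally constant and that \<open>A\<^sub>tK\<close> is continuous.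
\<close>

section \<open>Borel sets and continuous functions\<close>

lemma space_borel_of [simp]: "space (borel_of X) = topspace X"
  by (simp add: borel_of_def space_measure_of_conv)

lemma sets_borel_of: "sets (borel_of X) = sigma_sets (topspace X) {U. openin X U}"
  unfolding borel_of_def by (rule sets_measure_of) (auto dest: openin_subset)

lemma openin_in_borel_of: "openin X U \<Longrightarrow> U \<in> sets (borel_of X)"
  by (auto simp: sets_borel_of)

lemma closedin_in_borel_of: "closedin X C \<Longrightarrow> C \<in> sets (borel_of X)"
proof -
  assume C: "closedin X C"
  then have "topspace X - (topspace X - C) \<in> sets (borel_of X)"
    by (metis openin_in_borel_of closedin_def sets.compl_sets space_borel_of)
  with C show ?thesis by (metis closedin_subset double_diff order_refl)
qed

lemma continuous_map_borel_measurable: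
  assumes "continuous_map X euclideanreal f"
  shows "f \<in> borel_measurable (borel_of X)"
proof (rule borel_measurableI)
  fix S :: "real set" assume "open S"
  then have "openin X {x \<in> topspace X. f x \<in> S}"
    using assms openin_continuous_map_preimage by fastforce
  moreover have "f -` S \<inter> space (borel_of X) = {x \<in> topspace X. f x \<in> S}" by auto
  ultimately show "f -` S \<inter> space (borel_of X) \<in> sets (borel_of X)"
    by (simp add: openin_in_borel_of)
qed

lemma continuous_map_compact_bounded:
  assumes "compact_space X" "continuous_map X euclideanreal f"
  obtains B where "0 \<le> B" "\<And>x. x \<in> topspace X \<Longrightarrow> \<bar>f x\<bar> \<le> B"
proof -
  have "compactin euclideanreal (f ` topspace X)"
    using assms image_compactin compact_space_def by blast
  then have "bounded (f ` topspace X)" by (simp add: compact_imp_bounded)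
  then show ?thesis using that unfolding bounded_pos
    by (metis imageI less_imp_le real_norm_def)
qed

lemma integrable_continuous_map:
  assumes "compact_space X" "finite_measure M" "sets M = sets (borel_of X)"
    and "continuous_map X euclideanreal f"
  shows "integrable M f"
proof -
  obtain B where B: "\<And>x. x \<in> topspace X \<Longrightarrow> \<bar>f x\<bar> \<le> B"
    using continuous_map_compact_bounded assms(1,4) by metis
  have "space M = topspace X" using sets_eq_imp_space_eq[OF assms(3)] by simp
  then show ?thesis
    using B assms continuous_map_borel_measurable[OF assms(4)]
    by (intro finite_measure.integrable_const_bound[where B = B])
       (auto simp: measurable_cong_sets[OF assms(3) refl])
qed

lemma continuous_real_compose:
  assumes "continuous_map X euclideanreal f" "continuous_on UNIV (h :: real \<Rightarrow> real)"
  shows "continuous_map X euclideanreal (\<lambda>x. h (f x))"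
  using continuous_map_compose[OF assms(1), of euclideanreal h] assms(2)
  by (simp add: o_def)

lemma continuous_map_pos_part:
  assumes "continuous_map X euclideanreal f"
  shows "continuous_map X euclideanreal (\<lambda>x. max 0 (f x - d))"
  by (rule continuous_real_compose[OF assms, of "\<lambda>y. max 0 (y - d)"]) (intro continuous_intros)

section \<open>The Riesz representation theorem on a compact Hausdorff space\<close>

text \<open>The functional is defined on all functions, but only its values on continuous ones matter;
  by positivity they depend only on the restriction of the function to \<open>topspace X\<close>.\<close>

locale positive_functional =
  fixes X :: "'a topology" and L :: "('a \<Rightarrow> real) \<Rightarrow> real"
  assumes compact: "compact_space X" and Hausdorff: "Hausdorff_space X"
    and add: "\<And>f g. continuous_map X euclideanreal f \<Longrightarrow> continuous_map X euclideanreal g \<Longrightarrow>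
          L (\<lambda>x. f x + g x) = L f + L g"
    and scale: "\<And>c f. continuous_map X euclideanreal f \<Longrightarrow> L (\<lambda>x. c * f x) = c * L f"
    and nonneg: "\<And>f. continuous_map X euclideanreal f \<Longrightarrow> (\<And>x. x \<in> topspace X \<Longrightarrow> 0 \<le> f x) \<Longrightarrow> 0 \<le> L f"
begin

lemma diff:
  assumes "continuous_map X euclideanreal f" "continuous_map X euclideanreal g"
  shows "L (\<lambda>x. f x - g x) = L f - L g"
  using add[of f "\<lambda>x. (-1) * g x"] scale[of g "-1"] assms
  by (simp add: continuous_map_real_mult_left)

lemma mono:
  assumes "continuous_map X euclideanreal f" "continuous_map X euclideanreal g"
    and "\<And>x. x \<in> topspace X \<Longrightarrow> f x \<le> g x"
  shows "L f \<le> L g"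
  using nonneg[of "\<lambda>x. g x - f x"] diff[of g f] assms
  by (simp add: continuous_map_diff)

lemma normal: "normal_space X"
  using compact Hausdorff compact_Hausdorff_or_regular_imp_normal_space by blast

definition below :: "'a set \<Rightarrow> ('a \<Rightarrow> real) \<Rightarrow> bool" where
  "below U f \<longleftrightarrow> continuous_map X euclideanreal f \<and> (\<forall>x\<in>topspace X. 0 \<le> f x \<and> f x \<le> indicator U x)"

text \<open>This is the measure that an open set has to get. The competitors are bounded by the indicator
  function pointwise, without a condition on their supports; the support condition of the usual
  definition is replaced by the truncation \<open>(f - d)\<^sup>+\<close>, which lives on the compact set \<open>{f \<ge> d}\<close>.\<close>

definition content :: "'a set \<Rightarrow> ennreal" where
  "content U = (SUP f\<in>{f. below U f}. ennreal (L f))"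

definition outer :: "'a set \<Rightarrow> ennreal" where
  "outer A = (INF U\<in>{U. openin X U \<and> A \<subseteq> U}. content U)"

lemma below_le_content: "below U f \<Longrightarrow> ennreal (L f) \<le> content U"
  unfolding content_def by (rule SUP_upper) simp

lemma below_zero: "below U (\<lambda>x. 0)"
  by (simp add: below_def)

lemma below_indicator_Diff:
  assumes "below U f" "x \<in> topspace X" "x \<notin> U" shows "f x = 0"
  using assms unfolding below_def by force

lemma below_le_1:
  assumes "below U f" "x \<in> topspace X" shows "f x \<le> 1"
  using assms unfolding below_def by (meson indicator_le_1 order_trans)

text \<open>Since \<open>f \<le> (f - d)\<^sup>+ + d\<close>, replacing \<open>f\<close> by its truncation costs at most \<open>d L(1)\<close>, which
  tends to 0 with \<open>d\<close>. The summand \<open>b\<close> makes the lemma usable for bounds on sums.\<close>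

lemma le_via_truncation:
  assumes f: "continuous_map X euclideanreal f" "\<And>x. x \<in> topspace X \<Longrightarrow> 0 \<le> f x"
    and le: "\<And>d. 0 < d \<Longrightarrow> ennreal (L (\<lambda>x. max 0 (f x - d))) + b \<le> c"
  shows "ennreal (L f) + b \<le> c"
proof (rule ennreal_le_epsilon)
  fix e :: real assume e: "0 < e"
  \<comment> \<open>the summand 1 covers the case \<open>L 1 = 0\<close>\<close>
  define d where "d = e / (L (\<lambda>_. 1) + 1)"
  have L1: "0 \<le> L (\<lambda>_. 1)" by (rule nonneg) auto
  then have d: "0 < d" "d * L (\<lambda>_. 1) \<le> e"
    using e by (auto simp: d_def divide_simps)
  let ?g = "\<lambda>x. max 0 (f x - d)"
  have g: "continuous_map X euclideanreal ?g" using f continuous_map_pos_part by blast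
  have dc: "continuous_map X euclideanreal (\<lambda>_. d * 1)" by simp
  have g0: "0 \<le> L ?g" using g by (intro nonneg) auto
  have "L f \<le> L (\<lambda>x. ?g x + d * 1)"
    using f g by (intro mono continuous_map_add dc) auto
  also have "\<dots> = L ?g + d * L (\<lambda>_. 1)"
    by (subst add[OF g dc], subst scale) auto
  also have "\<dots> \<le> L ?g + e" using d by simp
  finally have "ennreal (L f) \<le> ennreal (L ?g) + ennreal e"
    using g0 e by (metis ennreal_leI ennreal_plus less_imp_le)
  then have "ennreal (L f) + b \<le> (ennreal (L ?g) + b) + ennreal e"
    by (metis add.commute add.left_commute add_left_mono)
  also have "\<dots> \<le> c + ennreal e" using le[OF d(1)] by (rule add_right_mono)
  finally show "ennreal (L f) + b \<le> c + ennreal e" .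
qed

lemma below_mono:
  assumes "below U f" "U \<subseteq> W" shows "below W f"
proof -
  have "indicator U x \<le> (indicator W x :: real)" for x
    using assms(2) by (auto simp: indicator_def)
  then show ?thesis using assms(1) unfolding below_def by (meson order_trans)
qed

lemma content_mono: "U \<subseteq> W \<Longrightarrow> content U \<le> content W"
  unfolding content_def by (intro SUP_subset_mono order_refl) (auto intro: below_mono)

lemma content_top: "content (topspace X) = ennreal (L (\<lambda>_. 1))"
proof (rule antisym)
  show "content (topspace X) \<le> ennreal (L (\<lambda>_. 1))"
    unfolding content_def
    by (rule SUP_least) (auto simp: below_def intro!: ennreal_leI mono)
  show "ennreal (L (\<lambda>_. 1)) \<le> content (topspace X)"
    by (rule below_le_content) (auto simp: below_def)
qed

lemma closedin_superlevel:
  assumes "continuous_map X euclideanreal f"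
  shows "closedin X {x \<in> topspace X. d \<le> f x}"
  using closedin_continuous_map_preimage[OF assms, of "{d..}"] by simp

text \<open>The superlevel set \<open>C = {f \<ge> d}\<close> of a competitor for \<open>U \<union> W\<close> is closed, so \<open>C - U\<close> and
  \<open>C - W\<close> are disjoint closed sets. A Urysohn function \<open>h\<close> separating them splits the truncation into
  \<open>(f - d)\<^sup>+ h\<close>, a competitor for \<open>U\<close>, and \<open>(f - d)\<^sup>+ (1 - h)\<close>, a competitor for \<open>W\<close>.\<close>

lemma content_Un:
  assumes U: "openin X U" and W: "openin X W"
  shows "content (U \<union> W) \<le> content U + content W"
  unfolding content_def[of "U \<union> W"]
proof (rule SUP_least, clarify)
  fix f assume f: "below (U \<union> W) f"
  then have fc: "continuous_map X euclideanreal f" by (simp add: below_def)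
  have "ennreal (L f) + 0 \<le> content U + content W"
  proof (rule le_via_truncation[OF fc])
    show "\<And>x. x \<in> topspace X \<Longrightarrow> 0 \<le> f x" using f by (auto simp: below_def)
    fix d :: real assume d: "0 < d"
    define C where "C = {x \<in> topspace X. d \<le> f x}"
    let ?g = "\<lambda>x. max 0 (f x - d)"
    have gc: "continuous_map X euclideanreal ?g" using fc continuous_map_pos_part by blast
    have C: "closedin X C" "C \<subseteq> U \<union> W"
      using closedin_superlevel[OF fc] below_indicator_Diff[OF f] d unfolding C_def by force+
    have dis: "disjnt (C - U) (C - W)" using C by (auto simp: disjnt_iff)
    obtain h where h: "continuous_map X (top_of_set {0..1::real}) h"
        "h ` (C - U) \<subseteq> {0}" "h ` (C - W) \<subseteq> {1}"
      using Urysohn_lemma[OF normal closedin_diff[OF C(1) U] closedin_diff[OF C(1) W] dis, of 0 1]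
      by auto
    have hc: "continuous_map X euclideanreal h" and h01: "\<And>x. x \<in> topspace X \<Longrightarrow> 0 \<le> h x \<and> h x \<le> 1"
      using h(1) by (auto simp: continuous_map_in_subtopology)
    have g1: "?g x \<le> 1" if "x \<in> topspace X" for x
      using below_le_1[OF f that] d by simp
    have gC: "?g x = 0" if "x \<in> topspace X" "x \<notin> C" for x
      using that by (auto simp: C_def)
    let ?u = "\<lambda>x. ?g x * h x" and ?v = "\<lambda>x. ?g x * (1 - h x)"
    have uc: "continuous_map X euclideanreal ?u"
      by (intro continuous_map_real_mult gc hc)
    have vc: "continuous_map X euclideanreal ?v"
      by (intro continuous_map_real_mult gc continuous_map_diff hc) auto
    have u: "below U ?u"
      unfolding below_def
    proof (intro conjI ballI uc)
      fix x assume x: "x \<in> topspace X"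
      show "0 \<le> ?u x" using h01[OF x] by simp
      show "?u x \<le> indicator U x"
      proof (cases "x \<in> U")
        case True
        then show ?thesis using mult_mono[of "?g x" 1 "h x" 1] h01[OF x] g1[OF x] by simp
      next
        case False
        then have "x \<notin> C \<or> h x = 0" using h(2) by blast
        then show ?thesis using gC[OF x] False by auto
      qed
    qed
    have v: "below W ?v"
      unfolding below_def
    proof (intro conjI ballI vc)
      fix x assume x: "x \<in> topspace X"
      show "0 \<le> ?v x" using h01[OF x] by simp
      show "?v x \<le> indicator W x"
      proof (cases "x \<in> W")
        case True
        then show ?thesis using mult_mono[of "?g x" 1 "1 - h x" 1] h01[OF x] g1[OF x] by simp
      next
        case False
        then have "x \<notin> C \<or> h x = 1" using h(3) by blast
        then show ?thesis using gC[OF x] False by auto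
      qed
    qed
    have "L ?g = L (\<lambda>x. ?u x + ?v x)" by (simp add: algebra_simps)
    also have "\<dots> = L ?u + L ?v" by (rule add[OF uc vc])
    finally have "ennreal (L ?g) \<le> ennreal (L ?u) + ennreal (L ?v)"
      using nonneg[OF uc] nonneg[OF vc] u v by (simp add: below_def)
    also have "\<dots> \<le> content U + content W"
      using u v by (intro add_mono below_le_content)
    finally show "ennreal (L ?g) + 0 \<le> content U + content W" by simp
  qed
  then show "ennreal (L f) \<le> content U + content W" by simp
qed

lemma content_empty: "content {} = 0"
proof -
  have "ennreal (L f) \<le> 0" if "below {} f" for f
  proof -
    have "L f \<le> L (\<lambda>x. 0 * 1)" using that by (intro mono) (auto simp: below_def)
    also have "\<dots> = 0" by (subst scale) auto
    finally show ?thesis by (simp add: ennreal_eq_0_iff)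
  qed
  then have "content {} \<le> 0" unfolding content_def by (intro SUP_least) auto
  then show ?thesis by simp
qed

lemma content_finite_Union:
  "(\<And>i. openin X (U i)) \<Longrightarrow> content (\<Union>i<n. U i) \<le> (\<Sum>i<n. content (U i))" for n :: nat
proof (induction n)
  case (Suc n)
  have "content (\<Union>i<Suc n. U i) = content ((\<Union>i<n. U i) \<union> U n)"
    by (simp add: lessThan_Suc Un_commute)
  also have "\<dots> \<le> content (\<Union>i<n. U i) + content (U n)"
    using Suc.prems by (intro content_Un) auto
  also have "\<dots> \<le> (\<Sum>i<n. content (U i)) + content (U n)"
    using Suc by (intro add_right_mono) auto
  finally show ?case by simp
qed (simp add: content_empty)

text \<open>By compactness, finitely many of the sets already cover the superlevel set \<open>{f \<ge> d}\<close>, so the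
  finite case bounds the truncation.\<close>

lemma content_countable_Union:
  assumes U: "\<And>i::nat. openin X (U i)"
  shows "content (\<Union>i. U i) \<le> (\<Sum>i. content (U i))"
  unfolding content_def[of "\<Union>i. U i"]
proof (rule SUP_least, clarify)
  fix f assume f: "below (\<Union>i. U i) f"
  then have fc: "continuous_map X euclideanreal f" by (simp add: below_def)
  have "ennreal (L f) + 0 \<le> (\<Sum>i. content (U i))"
  proof (rule le_via_truncation[OF fc])
    show "\<And>x. x \<in> topspace X \<Longrightarrow> 0 \<le> f x" using f by (auto simp: below_def)
    fix d :: real assume d: "0 < d"
    define C where "C = {x \<in> topspace X. d \<le> f x}"
    let ?g = "\<lambda>x. max 0 (f x - d)"
    have "C \<subseteq> (\<Union>i. U i)"
      using below_indicator_Diff[OF f] d unfolding C_def by force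
    moreover have "compactin X C"
      using closedin_superlevel[OF fc] closedin_compact_space[OF compact] unfolding C_def by blast
    ultimately obtain \<F> where "finite \<F>" "\<F> \<subseteq> range U" "C \<subseteq> \<Union>\<F>"
      using U unfolding compactin_def by (metis (no_types, lifting) rangeE)
    then obtain I where I: "finite I" "C \<subseteq> (\<Union>i\<in>I. U i)"
      by (metis finite_subset_image)
    then obtain n where n: "I \<subseteq> {..<n}"
      by (meson finite_nat_bounded)
    with I have Cn: "C \<subseteq> (\<Union>i<n. U i)" by blast
    have "below (\<Union>i<n. U i) ?g"
      unfolding below_def
    proof (intro conjI ballI continuous_map_pos_part fc)
      fix x assume x: "x \<in> topspace X"
      show "?g x \<le> indicator (\<Union>i<n. U i) x"
      proof (cases "x \<in> C")
        case True
        then have "indicator (\<Union>i<n. U i) x = (1::real)" using Cn by (simp add: subset_iff)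
        moreover have "f x \<le> 1" using below_le_1[OF f x] .
        ultimately show ?thesis using d by simp
      next
        case False then show ?thesis using x by (auto simp: C_def)
      qed
    qed auto
    then have "ennreal (L ?g) \<le> content (\<Union>i<n. U i)" by (rule below_le_content)
    also have "\<dots> \<le> (\<Sum>i<n. content (U i))" using U by (rule content_finite_Union)
    also have "\<dots> \<le> (\<Sum>i. content (U i))" by (rule sum_le_suminf) auto
    finally show "ennreal (L ?g) + 0 \<le> (\<Sum>i. content (U i))" by simp
  qed
  then show "ennreal (L f) \<le> (\<Sum>i. content (U i))" by simp
qed

lemma outer_open: "openin X U \<Longrightarrow> outer U = content U"
  unfolding outer_def by (rule antisym) (auto intro!: INF_lower INF_greatest content_mono)

lemma outer_mono: "A \<subseteq> B \<Longrightarrow> outer A \<le> outer B"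
  unfolding outer_def by (rule INF_superset_mono) auto

lemma outer_le_content: "openin X U \<Longrightarrow> A \<subseteq> U \<Longrightarrow> outer A \<le> content U"
  unfolding outer_def by (rule INF_lower) simp

lemma outer_approx:
  assumes "A \<subseteq> topspace X" "0 < (e::ennreal)"
  obtains U where "openin X U" "A \<subseteq> U" "content U \<le> outer A + e"
proof -
  have "outer A \<le> content (topspace X)" using assms by (intro outer_le_content) auto
  then have "outer A < top" unfolding content_top using ennreal_less_top le_less_trans by blast
  then have "outer A < outer A + e"
    using assms(2) ennreal_add_left_cancel_less[of "outer A" 0 e] by auto
  then show ?thesis using that unfolding outer_def INF_less_iff
    by (metis (mono_tags, lifting) less_imp_le mem_Collect_eq)
qed

lemma outer_measure_space_outer: "outer_measure_space (Pow (topspace X)) outer"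
  unfolding outer_measure_space_def
proof (intro conjI)
  show "positive (Pow (topspace X)) outer"
    by (simp add: positive_def outer_open content_empty)
  show "increasing (Pow (topspace X)) outer"
    by (simp add: increasing_def outer_mono)
  show "countably_subadditive (Pow (topspace X)) outer"
    unfolding countably_subadditive_def
  proof (intro allI impI)
    fix A :: "nat \<Rightarrow> 'a set"
    assume A: "range A \<subseteq> Pow (topspace X)"
    show "outer (\<Union>i. A i) \<le> (\<Sum>i. outer (A i))"
    proof (rule ennreal_le_epsilon)
      fix e :: real assume e: "0 < e"
      define d where "d i = ennreal e * ennreal ((1/2) ^ Suc i)" for i
      have d: "0 < d i" for i using e by (simp add: d_def ennreal_zero_less_mult_iff)
      have "\<exists>U. openin X U \<and> A i \<subseteq> U \<and> content U \<le> outer (A i) + d i" for i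
        using outer_approx[of "A i" "d i"] A d[of i] by (metis PowD range_subsetD)
      then obtain U where U: "\<And>i. openin X (U i)" "\<And>i. A i \<subseteq> U i"
          "\<And>i. content (U i) \<le> outer (A i) + d i"
        by metis
      have "outer (\<Union>i. A i) \<le> content (\<Union>i. U i)"
        using U by (intro outer_le_content) auto
      also have "\<dots> \<le> (\<Sum>i. content (U i))" using U(1) by (rule content_countable_Union)
      also have "\<dots> \<le> (\<Sum>i. outer (A i) + d i)"
        using U(3) by (intro suminf_le) auto
      also have "\<dots> = (\<Sum>i. outer (A i)) + (\<Sum>i. d i)"
        by (rule suminf_add[symmetric]) auto
      also have "(\<Sum>i. d i) = ennreal e"
        unfolding d_def ennreal_suminf_cmult
        by (subst suminf_ennreal_eq[OF zero_le_power power_half_series]) auto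
      finally show "outer (\<Union>i. A i) \<le> (\<Sum>i. outer (A i)) + ennreal e" .
    qed
  qed
qed

text \<open>A competitor \<open>f\<close> for \<open>U \<inter> W\<close> leaves room for any competitor \<open>h\<close> of the open set
  \<open>W - {f \<ge> d} \<supseteq> W - U\<close>: the truncation of \<open>f\<close> vanishes wherever \<open>h\<close> does not, so their sum is still
  a competitor for \<open>W\<close>.\<close>

lemma content_split:
  assumes U: "openin X U" and W: "openin X W"
  shows "outer (U \<inter> W) + outer (W - U) \<le> content W"
proof -
  have *: "ennreal (L f) + outer (W - U) \<le> content W" if f: "below (U \<inter> W) f" for f
  proof (rule le_via_truncation)
    show fc: "continuous_map X euclideanreal f" and "\<And>x. x \<in> topspace X \<Longrightarrow> 0 \<le> f x"
      using f by (auto simp: below_def)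
    fix d :: real assume d: "0 < d"
    define C where "C = {x \<in> topspace X. d \<le> f x}"
    let ?g = "\<lambda>x. max 0 (f x - d)"
    have gc: "continuous_map X euclideanreal ?g" using fc continuous_map_pos_part by blast
    have WC: "openin X (W - C)"
      using W closedin_superlevel[OF fc] unfolding C_def by (intro openin_diff)
    have sub: "W - U \<subseteq> W - C"
      using below_indicator_Diff[OF f] d unfolding C_def by force
    have "ennreal (L ?g) + ennreal (L h) \<le> content W" if h: "below (W - C) h" for h
    proof -
      have hc: "continuous_map X euclideanreal h" using h by (simp add: below_def)
      have "below W (\<lambda>x. ?g x + h x)"
        unfolding below_def
      proof (intro conjI ballI continuous_map_add gc hc)
        fix x assume x: "x \<in> topspace X"
        show "0 \<le> ?g x + h x" using h x by (simp add: below_def)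
        show "?g x + h x \<le> indicator W x"
        proof (cases "x \<in> C")
          case True
          then have "h x = 0" using below_indicator_Diff[OF h x] by simp
          moreover have "f x \<le> indicator W x"
            using below_mono[OF f, of W] x by (auto simp: below_def)
          ultimately show ?thesis using d True by (auto simp: C_def)
        next
          case False
          then have "?g x = 0" using x by (auto simp: C_def)
          moreover have "h x \<le> indicator W x"
            using below_mono[OF h, of W] x by (auto simp: below_def)
          ultimately show ?thesis by simp
        qed
      qed
      then have "ennreal (L (\<lambda>x. ?g x + h x)) \<le> content W" by (rule below_le_content)
      then show ?thesis
        using add[OF gc hc] nonneg[OF gc] nonneg[OF hc] h by (simp add: below_def)
    qed
    then have "(SUP h\<in>{h. below (W - C) h}. ennreal (L ?g) + ennreal (L h)) \<le> content W"
      by (intro SUP_least) auto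
    then have "ennreal (L ?g) + content (W - C) \<le> content W"
      unfolding content_def[of "W - C"]
      by (subst ennreal_SUP_add_right) (use below_zero in auto)
    then show "ennreal (L ?g) + outer (W - U) \<le> content W"
      using outer_le_content[OF WC sub] by (meson add_left_mono order_trans)
  qed
  have "outer (U \<inter> W) + outer (W - U) = outer (W - U) + content (U \<inter> W)"
    using U W by (simp add: outer_open openin_Int add.commute)
  also have "\<dots> = (SUP f\<in>{f. below (U \<inter> W) f}. outer (W - U) + ennreal (L f))"
    unfolding content_def by (subst ennreal_SUP_add_right) (use below_zero in auto)
  also have "\<dots> \<le> content W" using * by (intro SUP_least) (auto simp: add.commute)
  finally show ?thesis .
qed

lemma openin_Caratheodory_measurable:
  assumes U: "openin X U"
  shows "U \<in> lambda_system (topspace X) (Pow (topspace X)) outer"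
  unfolding lambda_system_def
proof (rule CollectI, intro conjI ballI)
  show "U \<in> Pow (topspace X)" using openin_subset[OF U] by simp
  fix A assume "A \<in> Pow (topspace X)"
  then have A: "A \<subseteq> topspace X" by simp
  have "outer (U \<inter> A) + outer ((topspace X - U) \<inter> A) \<le> content W"
    if W: "openin X W" "A \<subseteq> W" for W
  proof -
    have "outer (U \<inter> A) \<le> outer (U \<inter> W)" "outer ((topspace X - U) \<inter> A) \<le> outer (W - U)"
      using W by (auto intro!: outer_mono)
    then show ?thesis using content_split[OF U W(1)] by (meson add_mono order_trans)
  qed
  then have le: "outer (U \<inter> A) + outer ((topspace X - U) \<inter> A) \<le> outer A"
    unfolding outer_def[of A] by (intro INF_greatest) auto
  have sa: "subadditive (Pow (topspace X)) outer"
    using outer_measure_space_outer unfolding outer_measure_space_def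
    by (intro ring_of_sets.countably_subadditive_subadditive[OF ring_of_sets_Pow]) auto
  have "outer ((U \<inter> A) \<union> ((topspace X - U) \<inter> A)) \<le> outer (U \<inter> A) + outer ((topspace X - U) \<inter> A)"
    using A by (intro subadditiveD[OF sa]) auto
  moreover have "(U \<inter> A) \<union> ((topspace X - U) \<inter> A) = A" using A by blast
  ultimately show "outer (U \<inter> A) + outer ((topspace X - U) \<inter> A) = outer A"
    using le by simp
qed

definition representing_measure :: "'a measure" where
  "representing_measure = measure_of (topspace X) {U. openin X U} outer"

lemma sets_representing_measure: "sets representing_measure = sets (borel_of X)"
  unfolding representing_measure_def sets_borel_of
  by (rule sets_measure_of) (auto dest: openin_subset)

lemma space_representing_measure: "space representing_measure = topspace X"
  by (simp add: representing_measure_def space_measure_of_conv)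

lemma emeasure_representing_measure:
  assumes "A \<in> sets (borel_of X)"
  shows "emeasure representing_measure A = outer A"
proof -
  have ms: "measure_space (topspace X) (lambda_system (topspace X) (Pow (topspace X)) outer) outer"
    by (rule sigma_algebra.caratheodory_lemma[OF sigma_algebra_Pow outer_measure_space_outer])
  then have sa: "sigma_algebra (topspace X) (lambda_system (topspace X) (Pow (topspace X)) outer)"
    by (simp add: measure_space_def)
  have "measure_space (topspace X) (sigma_sets (topspace X) {U. openin X U}) outer"
    using openin_Caratheodory_measurable
    by (intro measure_down[OF ms] sigma_algebra.sigma_sets_subset[OF sa] sigma_algebra_sigma_sets)
       (auto dest: openin_subset)
  then show ?thesis
    using assms
    by (intro emeasure_measure_of[OF representing_measure_def])
       (auto simp: measure_space_def sets_borel_of sets_representing_measure dest: openin_subset)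
qed

lemma finite_representing_measure: "finite_measure representing_measure"
  by (rule finite_measureI)
     (simp add: space_representing_measure emeasure_representing_measure openin_in_borel_of
        outer_open content_top)

text \<open>Outer regularity holds by construction of the outer measure; applied to the complement of \<open>A\<close>
  it gives inner regularity, since complements of open sets are compact.\<close>

lemma representing_measure_Radon: "finite_radon_measure X representing_measure"
  unfolding finite_radon_measure_def
proof (intro conjI finite_representing_measure sets_representing_measure ballI antisym)
  let ?M = representing_measure
  interpret finite_measure ?M by (rule finite_representing_measure)
  fix A assume A: "A \<in> sets ?M"
  then have AX: "A \<subseteq> topspace X" using sets.sets_into_space space_representing_measure by blast
  show "(SUP K\<in>{K. compactin X K \<and> K \<in> sets ?M \<and> K \<subseteq> A}. emeasure ?M K) \<le> emeasure ?M A"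
    using A by (intro SUP_least) (auto intro: emeasure_mono)
  show "emeasure ?M A \<le> (SUP K\<in>{K. compactin X K \<and> K \<in> sets ?M \<and> K \<subseteq> A}. emeasure ?M K)"
    (is "_ \<le> ?S")
  proof (rule ennreal_le_epsilon)
    fix e :: real assume e: "0 < e"
    obtain U where U: "openin X U" "topspace X - A \<subseteq> U" "content U \<le> outer (topspace X - A) + ennreal e"
      using outer_approx[of "topspace X - A" "ennreal e"] e by auto
    have Us: "U \<in> sets ?M" using U by (simp add: sets_representing_measure openin_in_borel_of)
    have As: "topspace X - A \<in> sets ?M" using A space_representing_measure
      by (metis sets.compl_sets)
    have "emeasure ?M U \<le> emeasure ?M (topspace X - A) + ennreal e"
      using U Us As by (simp add: emeasure_representing_measure sets_representing_measure outer_open)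
    then have mU: "measure ?M U \<le> measure ?M (topspace X - A) + e"
      using e by (simp add: emeasure_eq_measure flip: ennreal_plus)
    define K where "K = topspace X - U"
    have K: "closedin X K" "K \<subseteq> A" using U by (auto simp: K_def)
    then have Kc: "compactin X K" using closedin_compact_space[OF compact] by blast
    have Ks: "K \<in> sets ?M" using K closedin_in_borel_of sets_representing_measure by blast
    have "measure ?M U = measure ?M (space ?M) - measure ?M K"
      using finite_measure_compl[OF Ks] openin_subset[OF U(1)]
      by (simp add: K_def space_representing_measure double_diff)
    moreover have "measure ?M (topspace X - A) = measure ?M (space ?M) - measure ?M A"
      using finite_measure_compl[OF A] by (simp add: space_representing_measure)
    ultimately have "measure ?M A \<le> measure ?M K + e" using mU by simp
    then have "emeasure ?M A \<le> emeasure ?M K + ennreal e"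
      using e by (simp add: emeasure_eq_measure flip: ennreal_plus)
    also have "emeasure ?M K \<le> ?S" using K Kc Ks by (intro SUP_upper) auto
    finally show "emeasure ?M A \<le> ?S + ennreal e" by simp
  qed
qed

lemma sum:
  "finite I \<Longrightarrow> (\<And>i. i \<in> I \<Longrightarrow> continuous_map X euclideanreal (f i)) \<Longrightarrow>
   L (\<lambda>x. \<Sum>i\<in>I. f i x) = (\<Sum>i\<in>I. L (f i))"
proof (induction I rule: finite_induct)
  case empty
  show ?case using scale[of "\<lambda>_. 0" 0] by simp
next
  case (insert i I)
  then show ?case using add[of "f i" "\<lambda>x. \<Sum>i\<in>I. f i x"]
    by (simp add: continuous_map_sum)
qed

text \<open>Cutting the interval \<open>[0, y]\<close> at the integers.\<close>

lemma sum_clip: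
  fixes y :: real
  assumes "0 \<le> y" "y \<le> real n"
  shows "(\<Sum>k<n. max 0 (min 1 (y - real k))) = y"
  using assms
proof (induction n)
  case (Suc n)
  show ?case
  proof (cases "y \<le> real n")
    case True
    then show ?thesis using Suc by simp
  next
    case False
    then have "(\<Sum>k<n. max 0 (min 1 (y - real k))) = (\<Sum>k<n. 1)"
      by (intro sum.cong) auto
    then show ?thesis using False Suc by simp
  qed
qed simp

text \<open>A layer-cake estimate. Cut \<open>n f\<close> into the slices \<open>h\<^sub>k = min 1 (n f - k)\<^sup>+\<close> and let
  \<open>T\<^sub>k = {n f > k}\<close>. Each \<open>h\<^sub>k\<close> lies between the indicator functions of \<open>T\<^bsub>k+1\<^esub>\<close> and \<open>T\<^sub>k\<close>.
  Hence \<open>L h\<^sub>k\<close> is at most the measure of \<open>T\<^sub>k\<close>, which for \<open>k \<ge> 1\<close> is at most the integral of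
  \<open>h\<^bsub>k-1\<^esub>\<close>. The shift by one slice costs a single total mass, which is negligible against \<open>n\<close>.\<close>

lemma functional_le_integral_unit:
  assumes f: "continuous_map X euclideanreal f" and f01: "\<And>x. x \<in> topspace X \<Longrightarrow> 0 \<le> f x \<and> f x \<le> 1"
  shows "L f \<le> (\<integral>x. f x \<partial>representing_measure)"
proof -
  let ?M = representing_measure
  interpret finite_measure ?M by (rule finite_representing_measure)
  note int = integrable_continuous_map[OF compact finite_representing_measure sets_representing_measure]
  have *: "real n * L f \<le> measure ?M (topspace X) + real n * (\<integral>x. f x \<partial>?M)" for n
  proof -
    define h where "h k x = max 0 (min 1 (real n * f x - real k))" for k x
    define T where "T k = {x \<in> topspace X. real k < real n * f x}" for k
    have hc: "continuous_map X euclideanreal (h k)" for k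
      unfolding h_def
      by (rule continuous_real_compose[OF f, of "\<lambda>y. max 0 (min 1 (real n * y - real k))"])
         (intro continuous_intros)
    have T: "openin X (T k)" for k
      unfolding T_def
      using openin_continuous_map_preimage[OF continuous_map_real_mult_left[OF f, of "real n"], of "{real k<..}"]
      by simp
    then have Ts: "T k \<in> sets ?M" for k by (simp add: sets_representing_measure openin_in_borel_of)
    have sumh: "(\<Sum>k<n. h k x) = real n * f x" if "x \<in> topspace X" for x
      unfolding h_def using f01[OF that] mult_left_mono[of "f x" 1 "real n"] by (intro sum_clip) auto
    have Lh: "L (h k) \<le> measure ?M (T k)" for k
    proof -
      have "below (T k) (h k)"
        unfolding below_def by (intro conjI ballI hc) (auto simp: h_def T_def indicator_def)
      then have "ennreal (L (h k)) \<le> emeasure ?M (T k)"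
        using below_le_content T by (simp add: emeasure_representing_measure openin_in_borel_of outer_open)
      then show ?thesis by (simp add: emeasure_eq_measure)
    qed
    have Th: "measure ?M (T (Suc k)) \<le> (\<integral>x. h k x \<partial>?M)" for k
    proof -
      have "measure ?M (T (Suc k)) = (\<integral>x. indicator (T (Suc k)) x \<partial>?M)"
        using Ts by simp
      also have "\<dots> \<le> (\<integral>x. h k x \<partial>?M)"
      proof (rule integral_mono[OF _ int[OF hc]])
        show "integrable ?M (indicator (T (Suc k)) :: 'a \<Rightarrow> real)"
          using Ts by (intro integrable_real_indicator) (auto simp: emeasure_eq_measure)
      qed (auto simp: indicator_def h_def T_def)
      finally show ?thesis .
    qed
    have "real n * L f = L (\<lambda>x. real n * f x)" using scale[OF f] by simp
    also have "\<dots> \<le> L (\<lambda>x. \<Sum>k<n. h k x)"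
      using sumh by (intro mono continuous_map_real_mult_left f continuous_map_sum hc) auto
    also have "\<dots> = (\<Sum>k<n. L (h k))" using hc by (intro sum) auto
    also have "\<dots> \<le> (\<Sum>k<n. measure ?M (T k))" by (intro sum_mono Lh)
    also have "\<dots> \<le> measure ?M (T 0) + (\<Sum>k<n. measure ?M (T (Suc k)))"
      using sum.lessThan_Suc_shift[of "\<lambda>k. measure ?M (T k)" n] measure_nonneg[of ?M "T n"]
      unfolding sum.lessThan_Suc by linarith
    also have "\<dots> \<le> measure ?M (topspace X) + (\<Sum>k<n. \<integral>x. h k x \<partial>?M)"
      using Th openin_subset[OF T]
      by (intro add_mono sum_mono finite_measure_mono)
         (auto simp: sets_representing_measure openin_in_borel_of)
    also have "(\<Sum>k<n. \<integral>x. h k x \<partial>?M) = (\<integral>x. (\<Sum>k<n. h k x) \<partial>?M)"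
      using hc int by (intro Bochner_Integration.integral_sum[symmetric]) auto
    also have "\<dots> = (\<integral>x. real n * f x \<partial>?M)"
      using sumh by (intro Bochner_Integration.integral_cong) (auto simp: space_representing_measure)
    finally show ?thesis by simp
  qed
  show ?thesis
  proof (rule ccontr)
    assume "\<not> ?thesis"
    then have "0 < L f - (\<integral>x. f x \<partial>?M)" by simp
    then obtain n where "measure ?M (topspace X) < real n * (L f - (\<integral>x. f x \<partial>?M))"
      using ex_less_of_nat_mult by blast
    with *[of n] show False by (simp add: algebra_simps)
  qed
qed

lemma functional_le_integral:
  assumes f: "continuous_map X euclideanreal f"
  shows "L f \<le> (\<integral>x. f x \<partial>representing_measure)"
proof -
  let ?M = representing_measure
  interpret finite_measure ?M by (rule finite_representing_measure)
  note int = integrable_continuous_map[OF compact finite_representing_measure sets_representing_measure]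
  obtain B where B: "0 \<le> B" "\<And>x. x \<in> topspace X \<Longrightarrow> \<bar>f x\<bar> \<le> B"
    using continuous_map_compact_bounded[OF compact f] by blast
  define c where "c = 2 * B + 1"
  have c: "c > 0" using B by (simp add: c_def)
  define g where "g x = (1 / c) * (f x + B * 1)" for x
  have fB: "continuous_map X euclideanreal (\<lambda>x. f x + B * 1)"
    by (intro continuous_map_add f) auto
  have g: "continuous_map X euclideanreal g"
    unfolding g_def by (intro continuous_map_real_mult_left fB)
  have "L g \<le> (\<integral>x. g x \<partial>?M)"
  proof (rule functional_le_integral_unit[OF g])
    fix x assume "x \<in> topspace X"
    then show "0 \<le> g x \<and> g x \<le> 1" using B(2)[of x] c by (auto simp: g_def c_def divide_simps)
  qed
  moreover have "L g = (1 / c) * (L f + B * L (\<lambda>_. 1))"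
    unfolding g_def by (subst scale[OF fB], subst add[OF f], simp, subst scale) auto
  moreover have "(\<integral>x. g x \<partial>?M) = (1 / c) * ((\<integral>x. f x \<partial>?M) + B * measure ?M (topspace X))"
    unfolding g_def using int[OF f] by (simp add: space_representing_measure)
  moreover have "measure ?M (topspace X) = L (\<lambda>_. 1)"
    using nonneg[of "\<lambda>_. 1"]
    by (simp add: measure_def emeasure_representing_measure openin_in_borel_of outer_open content_top)
  ultimately show ?thesis using c by (simp add: divide_simps)
qed

text \<open>The inequality for \<open>f\<close> and for \<open>-f\<close> together give equality.\<close>

theorem Riesz_representation:
  "finite_radon_measure X representing_measure"
  "continuous_map X euclideanreal f \<Longrightarrow> (\<integral>x. f x \<partial>representing_measure) = L f"
proof -
  show "finite_radon_measure X representing_measure" by (rule representing_measure_Radon)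
  assume f: "continuous_map X euclideanreal f"
  have "L (\<lambda>x. (-1) * f x) \<le> (\<integral>x. (-1) * f x \<partial>representing_measure)"
    using f by (intro functional_le_integral continuous_map_real_mult_left)
  then show "(\<integral>x. f x \<partial>representing_measure) = L f"
    using functional_le_integral[OF f] scale[OF f, of "-1"] by simp
qed

end

section \<open>Signed measures and their Jordan decomposition\<close>

lemma sets_pos_variation [simp]: "sets (pos_variation M \<mu>) = sets M"
  by (simp add: pos_variation_def)

lemma space_pos_variation [simp]: "space (pos_variation M \<mu>) = space M"
  by (simp add: pos_variation_def)

lemma signed_measure_Un:
  assumes "signed_measure M \<mu>" "A \<in> sets M" "B \<in> sets M" "A \<inter> B = {}"
  shows "\<mu> (A \<union> B) = \<mu> A + \<mu> B"
proof -
  have "disjoint_family (binaryset A B)" "range (binaryset A B) \<subseteq> sets M"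
    using assms by (auto simp: disjoint_family_on_def binaryset_def)
  then have "(\<lambda>i. \<mu> (binaryset A B i)) sums \<mu> (\<Union>i. binaryset A B i)"
    using assms(1) unfolding signed_measure_def by metis
  moreover have "(\<lambda>i. \<mu> (binaryset A B i)) sums (\<mu> A + \<mu> B)"
    using assms(1) by (intro binaryset_sums) (simp add: signed_measure_def)
  ultimately show ?thesis by (metis UN_binaryset_eq sums_unique2)
qed

lemma signed_measure_uminus: "signed_measure M \<mu> \<Longrightarrow> signed_measure M (\<lambda>A. - \<mu> A)"
  unfolding signed_measure_def by (auto intro: sums_minus)

lemma ennreal_add_le: "ennreal (a + b) \<le> ennreal a + ennreal b"
  by (cases "0 \<le> a"; cases "0 \<le> b")
     (auto simp: ennreal_neg ennreal_plus intro!: ennreal_leI)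

lemma ennreal_sum_le: "ennreal (\<Sum>i<n. f i) \<le> (\<Sum>i<n. ennreal (f i))" for n :: nat
proof (induction n)
  case (Suc n)
  then show ?case using ennreal_add_le[of "\<Sum>i<n. f i" "f n"]
    by (simp) (meson add_right_mono order_trans)
qed simp

text \<open>The supremum defining the positive variation is superadditive over disjoint sets because
  near-optimal subsets with nonnegative measure can be united, and countably subadditive because a
  subset of the union is cut into its traces. Hence it is a measure, and the \<open>measure_of\<close> in the
  definition does not degenerate to zero.\<close>

lemma emeasure_pos_variation:
  assumes sm: "signed_measure M \<mu>" and A: "A \<in> sets M"
  shows "emeasure (pos_variation M \<mu>) A = (SUP B\<in>{B \<in> sets M. B \<subseteq> A}. ennreal (\<mu> B))"
proof -
  define pv where "pv A = (SUP B\<in>{B \<in> sets M. B \<subseteq> A}. ennreal (\<mu> B))" for A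
  have \<mu>0: "\<mu> {} = 0" using sm by (simp add: signed_measure_def)
  have sums: "(\<lambda>i. \<mu> (A i)) sums \<mu> (\<Union>i. A i)"
    if "range A \<subseteq> sets M" "disjoint_family A" for A :: "nat \<Rightarrow> 'a set"
    using sm that by (simp add: signed_measure_def)
  have super: "pv A + pv B \<le> pv (A \<union> B)"
    if "A \<in> sets M" "B \<in> sets M" "A \<inter> B = {}" for A B
  proof -
    have *: "ennreal (\<mu> C) + ennreal (\<mu> D) \<le> pv (A \<union> B)"
      if C: "C \<in> sets M" "C \<subseteq> A" and D: "D \<in> sets M" "D \<subseteq> B" for C D
    proof -
      define C' where "C' = (if 0 \<le> \<mu> C then C else {})"
      define D' where "D' = (if 0 \<le> \<mu> D then D else {})"
      have "ennreal (\<mu> C) + ennreal (\<mu> D) = ennreal (\<mu> C') + ennreal (\<mu> D')"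
        by (auto simp: C'_def D'_def \<mu>0 ennreal_neg)
      also have "\<dots> = ennreal (\<mu> C' + \<mu> D')"
        by (subst ennreal_plus) (auto simp: C'_def D'_def \<mu>0)
      also have "\<mu> C' + \<mu> D' = \<mu> (C' \<union> D')"
        using C D \<open>A \<inter> B = {}\<close>
        by (intro signed_measure_Un[OF sm, symmetric]) (auto simp: C'_def D'_def)
      also have "ennreal (\<mu> (C' \<union> D')) \<le> pv (A \<union> B)"
        unfolding pv_def using C D by (intro SUP_upper) (auto simp: C'_def D'_def)
      finally show ?thesis .
    qed
    have "pv A + pv B = (SUP C\<in>{C \<in> sets M. C \<subseteq> A}. ennreal (\<mu> C) + pv B)"
      unfolding pv_def[of A] by (subst ennreal_SUP_add_left) auto
    also have "\<dots> = (SUP C\<in>{C \<in> sets M. C \<subseteq> A}. SUP D\<in>{D \<in> sets M. D \<subseteq> B}. ennreal (\<mu> C) + ennreal (\<mu> D))"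
      unfolding pv_def[of B] by (subst ennreal_SUP_add_right) auto
    also have "\<dots> \<le> pv (A \<union> B)" using * by (intro SUP_least) auto
    finally show ?thesis .
  qed
  have "countably_additive (sets M) pv"
    unfolding countably_additive_def
  proof (intro allI impI antisym)
    fix F :: "nat \<Rightarrow> 'a set"
    assume F: "range F \<subseteq> sets M" "disjoint_family F" "(\<Union>i. F i) \<in> sets M"
    have fin: "(\<Sum>i<n. pv (F i)) \<le> pv (\<Union>i<n. F i)" for n
    proof (induction n)
      case (Suc n)
      have dis: "(\<Union>i<n. F i) \<inter> F n = {}"
      proof -
        have "F i \<inter> F n = {}" if "i < n" for i
          using F(2) that by (simp add: disjoint_family_on_def)
        then show ?thesis by blast
      qed
      have "(\<Sum>i<Suc n. pv (F i)) \<le> pv (\<Union>i<n. F i) + pv (F n)"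
        using Suc by (simp add: add_right_mono)
      also have "\<dots> \<le> pv ((\<Union>i<n. F i) \<union> F n)"
        using F(1) dis by (intro super sets.finite_UN) auto
      also have "(\<Union>i<n. F i) \<union> F n = (\<Union>i<Suc n. F i)" by (auto simp: less_Suc_eq)
      finally show ?case .
    qed simp
    show "(\<Sum>i. pv (F i)) \<le> pv (\<Union>i. F i)"
    proof (rule suminf_le_const[OF summableI])
      fix n
      have "pv (\<Union>i<n. F i) \<le> pv (\<Union>i. F i)"
        unfolding pv_def by (rule SUP_subset_mono) auto
      with fin show "(\<Sum>i<n. pv (F i)) \<le> pv (\<Union>i. F i)" by (meson order_trans)
    qed
    show "pv (\<Union>i. F i) \<le> (\<Sum>i. pv (F i))"
      unfolding pv_def[of "\<Union>i. F i"]
    proof (rule SUP_least, clarify)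
      fix B assume B: "B \<in> sets M" "B \<subseteq> (\<Union>i. F i)"
      have "(\<lambda>i. \<mu> (B \<inter> F i)) sums \<mu> (\<Union>i. B \<inter> F i)"
        using B(1) F(1) disjoint_family_on_bisimulation[OF F(2), of "\<lambda>i. B \<inter> F i"]
        by (intro sums) auto
      moreover have "(\<Union>i. B \<inter> F i) = B" using B by auto
      ultimately have "(\<lambda>n. ennreal (\<Sum>i<n. \<mu> (B \<inter> F i))) \<longlonglongrightarrow> ennreal (\<mu> B)"
        unfolding sums_def by (intro tendsto_ennrealI) simp
      moreover have "ennreal (\<Sum>i<n. \<mu> (B \<inter> F i)) \<le> (\<Sum>i. pv (F i))" for n
      proof -
        have "ennreal (\<Sum>i<n. \<mu> (B \<inter> F i)) \<le> (\<Sum>i<n. ennreal (\<mu> (B \<inter> F i)))"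
          by (rule ennreal_sum_le)
        also have "\<dots> \<le> (\<Sum>i<n. pv (F i))"
          unfolding pv_def using B F(1) by (intro sum_mono SUP_upper) auto
        also have "\<dots> \<le> (\<Sum>i. pv (F i))" by (rule sum_le_suminf) auto
        finally show ?thesis .
      qed
      ultimately show "ennreal (\<mu> B) \<le> (\<Sum>i. pv (F i))" by (intro LIMSEQ_le_const2) auto
    qed
  qed
  moreover have "positive (sets M) pv"
  proof -
    have "{B \<in> sets M. B \<subseteq> {}} = {{}}" by auto
    then show ?thesis by (simp add: positive_def pv_def \<mu>0)
  qed
  ultimately have "emeasure (pos_variation M \<mu>) A = pv A"
    using A unfolding pos_variation_def pv_def[symmetric]
    by (intro emeasure_measure_of_sigma sets.sigma_algebra_axioms) auto
  then show ?thesis by (simp add: pv_def)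
qed

text \<open>For \<open>B \<subseteq> A\<close> one has \<open>\<mu>(B) = \<mu>(A) - \<mu>(A - B)\<close>, and \<open>-\<mu>(A - B)\<close> is a candidate for the negative
  variation of \<open>A\<close>.\<close>

lemma le_neg_variation:
  assumes sm: "signed_measure M \<mu>"
    and P: "finite_measure (pos_variation M \<mu>)" and N: "finite_measure (neg_variation M \<mu>)"
    and A: "A \<in> sets M"
  shows "measure (pos_variation M \<mu>) A \<le> \<mu> A + measure (neg_variation M \<mu>) A"
proof -
  interpret P: finite_measure "pos_variation M \<mu>" by (rule P)
  interpret N: finite_measure "neg_variation M \<mu>" by (rule N)
  have le: "\<mu> B \<le> \<mu> A + measure (neg_variation M \<mu>) A" if B: "B \<in> sets M" "B \<subseteq> A" for B
  proof -
    have "ennreal (- \<mu> (A - B)) \<le> emeasure (neg_variation M \<mu>) A"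
      unfolding neg_variation_def emeasure_pos_variation[OF signed_measure_uminus[OF sm] A]
      using A B by (intro SUP_upper) auto
    then have "- \<mu> (A - B) \<le> measure (neg_variation M \<mu>) A" by (simp add: N.emeasure_eq_measure)
    moreover have "\<mu> A = \<mu> B + \<mu> (A - B)"
      using signed_measure_Un[OF sm B(1), of "A - B"] A B by (simp add: Un_absorb1)
    ultimately show ?thesis by simp
  qed
  have "emeasure (pos_variation M \<mu>) A \<le> ennreal (\<mu> A + measure (neg_variation M \<mu>) A)"
    unfolding emeasure_pos_variation[OF sm A] by (intro SUP_least ennreal_leI) (use le in auto)
  moreover have "0 \<le> \<mu> A + measure (neg_variation M \<mu>) A" using le[of "{}"] sm by (simp add: signed_measure_def)
  ultimately show ?thesis by (simp add: P.emeasure_eq_measure)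
qed

text \<open>The previous lemma for \<open>\<mu>\<close> and for \<open>-\<mu>\<close>, whose positive variation is the negative one of \<open>\<mu>\<close>.\<close>

lemma Jordan_decomposition:
  assumes "\<mu> \<in> signed_radon_measures X" "A \<in> sets (borel_of X)"
  shows "\<mu> A = measure (pos_variation (borel_of X) \<mu>) A - measure (neg_variation (borel_of X) \<mu>) A"
proof -
  have sm: "signed_measure (borel_of X) \<mu>"
    and P: "finite_measure (pos_variation (borel_of X) \<mu>)"
    and N: "finite_measure (neg_variation (borel_of X) \<mu>)"
    using assms(1) by (auto simp: signed_radon_measures_def finite_radon_measure_def)
  have "neg_variation (borel_of X) (\<lambda>A. - \<mu> A) = pos_variation (borel_of X) \<mu>"
    by (simp add: neg_variation_def)
  then show ?thesis
    using le_neg_variation[OF sm P N assms(2)] P N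
      le_neg_variation[OF signed_measure_uminus[OF sm] _ _ assms(2)]
    by (simp add: neg_variation_def)
qed

lemma sets_borel_of_subset: "A \<in> sets (borel_of X) \<Longrightarrow> A \<subseteq> topspace X"
  by (metis sets.sets_into_space space_borel_of)

section \<open>Nonnegative Radon measures\<close>

lemma finite_radon_measureD:
  assumes "finite_radon_measure X M"
  shows "finite_measure M" "sets M = sets (borel_of X)" "space M = topspace X"
  using assms sets_eq_imp_space_eq[of M "borel_of X"] by (auto simp: finite_radon_measure_def)

lemma finite_radon_measure_null: "finite_radon_measure X (null_measure (borel_of X))"
  unfolding finite_radon_measure_def
proof (intro conjI ballI)
  show "finite_measure (null_measure (borel_of X))" by (rule finite_measureI) simp
  fix A assume "A \<in> sets (null_measure (borel_of X))"
  have "{} \<in> {K. compactin X K \<and> K \<in> sets (null_measure (borel_of X)) \<and> K \<subseteq> A}" by simp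
  then show "emeasure (null_measure (borel_of X)) A =
      (SUP K\<in>{K. compactin X K \<and> K \<in> sets (null_measure (borel_of X)) \<and> K \<subseteq> A}.
         emeasure (null_measure (borel_of X)) K)"
    by (subst SUP_cong[OF refl, of _ _ "\<lambda>_. 0"]) (auto simp: SUP_constant)
qed simp

lemma signed_measure_measure:
  assumes "finite_measure M" "sets M = sets N"
  shows "signed_measure N (measure M)"
  unfolding signed_measure_def assms(2)[symmetric]
  using finite_measure.finite_measure_UNION[OF assms(1)]
  by (auto simp: measure_notin_sets)

lemma variation_measure:
  assumes M: "finite_radon_measure X M"
  shows "pos_variation (borel_of X) (measure M) = M"
    and "neg_variation (borel_of X) (measure M) = null_measure (borel_of X)"
proof -
  note D = finite_radon_measureD[OF M]
  interpret finite_measure M by (rule D)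
  have sm: "signed_measure (borel_of X) (measure M)"
    by (rule signed_measure_measure[OF D(1,2)])
  show "pos_variation (borel_of X) (measure M) = M"
  proof (rule measure_eqI)
    fix A assume "A \<in> sets (pos_variation (borel_of X) (measure M))"
    then have A: "A \<in> sets (borel_of X)" by simp
    show "emeasure (pos_variation (borel_of X) (measure M)) A = emeasure M A"
      unfolding emeasure_pos_variation[OF sm A]
    proof (rule antisym)
      show "(SUP B\<in>{B \<in> sets (borel_of X). B \<subseteq> A}. ennreal (measure M B)) \<le> emeasure M A"
        using A D(2) by (intro SUP_least) (auto simp: emeasure_eq_measure intro!: ennreal_leI finite_measure_mono)
      show "emeasure M A \<le> (SUP B\<in>{B \<in> sets (borel_of X). B \<subseteq> A}. ennreal (measure M B))"
        unfolding emeasure_eq_measure using A by (intro SUP_upper) auto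
    qed
  qed (simp add: D)
  show "neg_variation (borel_of X) (measure M) = null_measure (borel_of X)"
  proof (rule measure_eqI)
    fix A assume "A \<in> sets (neg_variation (borel_of X) (measure M))"
    then have A: "A \<in> sets (borel_of X)" by (simp add: neg_variation_def)
    have "emeasure (neg_variation (borel_of X) (measure M)) A \<le> 0"
      unfolding neg_variation_def emeasure_pos_variation[OF signed_measure_uminus[OF sm] A]
      by (intro SUP_least) (simp add: ennreal_neg)
    then show "emeasure (neg_variation (borel_of X) (measure M)) A = emeasure (null_measure (borel_of X)) A"
      by simp
  qed (simp add: neg_variation_def)
qed

lemma measure_in_nonneg_radon_measures:
  assumes M: "finite_radon_measure X M"
  shows "measure M \<in> nonneg_radon_measures X"
proof -
  have "signed_measure (borel_of X) (measure M)"
    by (rule signed_measure_measure[OF finite_radon_measureD(1,2)[OF M]])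
  then show ?thesis
    using M by (simp add: nonneg_radon_measures_def signed_radon_measures_def variation_measure
        finite_radon_measure_null)
qed

lemma signed_integral_measure:
  assumes M: "finite_radon_measure X M"
  shows "signed_integral X (measure M) f = (\<integral>x. f x \<partial>M)"
  by (simp add: signed_integral_def variation_measure[OF M])

lemma nonneg_radon_measuresE:
  assumes "\<nu> \<in> nonneg_radon_measures X"
  obtains M where "finite_radon_measure X M" "\<nu> = measure M"
proof
  let ?P = "pos_variation (borel_of X) \<nu>" and ?N = "neg_variation (borel_of X) \<nu>"
  have s: "\<nu> \<in> signed_radon_measures X" and nn: "\<And>A. A \<in> sets (borel_of X) \<Longrightarrow> 0 \<le> \<nu> A"
    using assms by (auto simp: nonneg_radon_measures_def)
  then have sm: "signed_measure (borel_of X) \<nu>" by (simp add: signed_radon_measures_def)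
  show "finite_radon_measure X ?P" using s by (simp add: signed_radon_measures_def)
  show "\<nu> = measure ?P"
  proof
    fix A
    show "\<nu> A = measure ?P A"
    proof (cases "A \<in> sets (borel_of X)")
      case True
      have "emeasure ?N A \<le> 0"
        unfolding neg_variation_def emeasure_pos_variation[OF signed_measure_uminus[OF sm] True]
        by (intro SUP_least) (simp add: ennreal_neg nn)
      then show ?thesis using Jordan_decomposition[OF s True] by (simp add: measure_def)
    next
      case False
      then show ?thesis using sm by (simp add: signed_measure_def measure_notin_sets)
    qed
  qed
qed

section \<open>Radon measures are determined by the integrals of continuous functions\<close>

lemma Radon_inner:
  assumes M: "finite_radon_measure X M" and A: "A \<in> sets (borel_of X)" and e: "0 < (e::real)"
  shows "\<exists>K. compactin X K \<and> K \<in> sets (borel_of X) \<and> K \<subseteq> A \<and> measure M A \<le> measure M K + e"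
proof (rule ccontr)
  note D = finite_radon_measureD[OF M]
  interpret finite_measure M by (rule D)
  assume "\<not> ?thesis"
  then have "\<not> measure M A \<le> measure M K + e" if "compactin X K" "K \<in> sets M" "K \<subseteq> A" for K
    using that D(2) by blast
  then have le: "measure M K \<le> measure M A - e" if "compactin X K" "K \<in> sets M" "K \<subseteq> A" for K
    using that by (meson less_eq_real_def linorder_not_le add_le_cancel_right le_diff_eq)
  have "emeasure M A = (SUP K\<in>{K. compactin X K \<and> K \<in> sets M \<and> K \<subseteq> A}. emeasure M K)"
    using M A D(2) by (simp add: finite_radon_measure_def)
  also have "\<dots> \<le> ennreal (measure M A - e)"
    using le by (intro SUP_least) (auto simp: emeasure_eq_measure intro!: ennreal_leI)
  finally have "ennreal (measure M A) \<le> ennreal (measure M A - e)" by (simp add: emeasure_eq_measure)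
  moreover have "0 \<le> measure M A - e" using le[of "{}"] by simp
  ultimately show False using e by simp
qed

lemma Radon_outer:
  assumes X: "Hausdorff_space X" and M: "finite_radon_measure X M"
    and A: "A \<in> sets (borel_of X)" and e: "0 < (e::real)"
  shows "\<exists>U. openin X U \<and> A \<subseteq> U \<and> measure M U \<le> measure M A + e"
proof -
  note D = finite_radon_measureD[OF M]
  interpret finite_measure M by (rule D)
  have AX: "A \<subseteq> topspace X" using A by (rule sets_borel_of_subset)
  have "topspace X - A \<in> sets (borel_of X)" using A by (metis sets.compl_sets space_borel_of)
  then obtain K where K: "compactin X K" "K \<in> sets (borel_of X)" "K \<subseteq> topspace X - A"
      "measure M (topspace X - A) \<le> measure M K + e"
    using Radon_inner[OF M _ e] by blast
  have "closedin X K" using X K(1) compactin_imp_closedin by blast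
  moreover have "measure M (topspace X - K) \<le> measure M A + e"
    using K(2,4) A finite_measure_compl[of K] finite_measure_compl[of A] by (simp add: D)
  moreover have "A \<subseteq> topspace X - K" using AX K(3) by blast
  ultimately show ?thesis by blast
qed

text \<open>Regularity gives a compact \<open>K \<subseteq> A\<close> and an open \<open>U \<supseteq> A\<close> for each of the measures. The union of
  the compact sets and the intersection of the open ones serve all measures simultaneously, and a
  Urysohn function between the two has the required integrals.\<close>

lemma Radon_continuous_approximation:
  assumes X: "compact_space X" "Hausdorff_space X"
    and \<M>: "finite \<M>" "\<And>M. M \<in> \<M> \<Longrightarrow> finite_radon_measure X M"
    and A: "A \<in> sets (borel_of X)" and e: "0 < e"
  obtains f where "continuous_map X euclideanreal f"
    "\<And>M. M \<in> \<M> \<Longrightarrow> \<bar>(\<integral>x. f x \<partial>M) - measure M A\<bar> \<le> e"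
proof -
  have AX: "A \<subseteq> topspace X" using A by (rule sets_borel_of_subset)
  obtain K where K: "\<And>M. M \<in> \<M> \<Longrightarrow> compactin X (K M) \<and> K M \<subseteq> A \<and> measure M A \<le> measure M (K M) + e"
    using Radon_inner[OF \<M>(2) A e] by metis
  obtain U where U: "\<And>M. M \<in> \<M> \<Longrightarrow> openin X (U M) \<and> A \<subseteq> U M \<and> measure M (U M) \<le> measure M A + e"
    using Radon_outer[OF X(2) \<M>(2) A e] by metis
  define C where "C = (\<Union>M\<in>\<M>. K M)"
  define W where "W = topspace X \<inter> (\<Inter>M\<in>\<M>. U M)"
  have C: "closedin X C" "C \<subseteq> A"
    unfolding C_def using \<M>(1) K compactin_imp_closedin[OF X(2)] by (auto intro!: closedin_Union)
  have W: "openin X W" "A \<subseteq> W"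
    unfolding W_def using \<M>(1) U AX by (auto intro!: openin_Int_Inter)
  have "disjnt (topspace X - W) C" using C W by (auto simp: disjnt_iff)
  then obtain f where f: "continuous_map X (top_of_set {0..1::real}) f"
      "f ` (topspace X - W) \<subseteq> {0}" "f ` C \<subseteq> {1}"
    using Urysohn_lemma[OF _ closedin_diff[OF closedin_topspace W(1)] C(1), of 0 1]
      compact_Hausdorff_or_regular_imp_normal_space X by force
  have fc: "continuous_map X euclideanreal f" and f01: "\<And>x. x \<in> topspace X \<Longrightarrow> 0 \<le> f x \<and> f x \<le> 1"
    using f(1) by (auto simp: continuous_map_in_subtopology)
  have "\<bar>(\<integral>x. f x \<partial>M) - measure M A\<bar> \<le> e" if M: "M \<in> \<M>" for M
  proof -
    note D = finite_radon_measureD[OF \<M>(2)[OF M]]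
    interpret finite_measure M by (rule D)
    have int: "integrable M f" by (rule integrable_continuous_map[OF X(1) D(1,2) fc])
    have ind: "integrable M (indicator B :: 'a \<Rightarrow> real)" if "B \<in> sets (borel_of X)" for B
      using that D(2) by (intro integrable_real_indicator) (auto simp: emeasure_eq_measure)
    have Cs: "C \<in> sets (borel_of X)" and Ws: "W \<in> sets (borel_of X)"
      using C W closedin_in_borel_of openin_in_borel_of by auto
    have CX: "C \<subseteq> topspace X" and WX: "W \<subseteq> topspace X"
      using closedin_subset[OF C(1)] openin_subset[OF W(1)] by auto
    have Ks: "K M \<in> sets M" and Us: "U M \<in> sets M"
      using K[OF M] U[OF M] compactin_imp_closedin[OF X(2), of "K M"]
        closedin_in_borel_of[of X "K M"] openin_in_borel_of[of X "U M"] by (auto simp: D(2))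
    have "measure M A \<le> measure M (K M) + e" using K[OF M] by simp
    also have "measure M (K M) \<le> measure M C"
      using M Cs D(2) by (intro finite_measure_mono) (auto simp: C_def)
    also have "measure M C = (\<integral>x. indicator C x \<partial>M)" using Cs CX D by (simp add: Int_absorb2)
    also have "\<dots> \<le> (\<integral>x. f x \<partial>M)"
      by (intro integral_mono ind Cs int) (use f01 f(3) CX D(3) in \<open>auto simp: indicator_def\<close>)
    finally have 1: "measure M A \<le> (\<integral>x. f x \<partial>M) + e" by simp
    have "(\<integral>x. f x \<partial>M) \<le> (\<integral>x. indicator W x \<partial>M)"
      by (intro integral_mono ind Ws int) (use f01 f(2) D(3) in \<open>auto simp: indicator_def\<close>)
    also have "\<dots> = measure M W" using Ws WX D by (simp add: Int_absorb2)
    also have "\<dots> \<le> measure M (U M)" 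
      using M Us by (intro finite_measure_mono) (auto simp: W_def)
    also have "\<dots> \<le> measure M A + e" using U[OF M] by simp
    finally show ?thesis using 1 by linarith
  qed
  then show ?thesis using that fc by blast
qed

text \<open>Two measures on the right-hand side make the lemma applicable to the parts of a Jordan
  decomposition: an identity of signed measures \<open>\<mu>\<^sup>+ - \<mu>\<^sup>- = \<nu>\<close> is an identity \<open>\<mu>\<^sup>+ = \<mu>\<^sup>- + \<nu>\<close> of
  nonnegative ones.\<close>

lemma Radon_measure_sum_eqI:
  assumes X: "compact_space X" "Hausdorff_space X"
    and R: "finite_radon_measure X M" "finite_radon_measure X N" "finite_radon_measure X P"
    and eq: "\<And>f. continuous_map X euclideanreal f \<Longrightarrow> (\<integral>x. f x \<partial>M) = (\<integral>x. f x \<partial>N) + (\<integral>x. f x \<partial>P)"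
    and A: "A \<in> sets (borel_of X)"
  shows "measure M A = measure N A + measure P A"
proof (rule ccontr)
  assume ne: "\<not> ?thesis"
  define e where "e = \<bar>measure M A - measure N A - measure P A\<bar> / 4"
  have e: "0 < e" using ne by (auto simp: e_def)
  have "finite {M, N, P}" by simp
  then obtain f where f: "continuous_map X euclideanreal f"
    "\<And>Q. Q \<in> {M, N, P} \<Longrightarrow> \<bar>(\<integral>x. f x \<partial>Q) - measure Q A\<bar> \<le> e"
    using Radon_continuous_approximation[OF X _ _ A e, of "{M, N, P}"] R by blast
  have "\<bar>measure M A - measure N A - measure P A\<bar> \<le> 3 * e"
    using f(2)[of M] f(2)[of N] f(2)[of P] eq[OF f(1)] unfolding abs_le_iff by auto
  then show False using e unfolding e_def by simp
qed

section \<open>Symmetric measures on a product\<close>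

lemma continuous_map_measurable:
  assumes "continuous_map X Y f"
  shows "f \<in> measurable (borel_of X) (borel_of Y)"
  unfolding borel_of_def[of Y]
proof (rule measurable_measure_of)
  show "f \<in> space (borel_of X) \<rightarrow> topspace Y" using assms by (auto simp: continuous_map_def)
  fix U assume "U \<in> {U. openin Y U}"
  then have "openin X {x \<in> topspace X. f x \<in> U}"
    using assms openin_continuous_map_preimage by fastforce
  moreover have "f -` U \<inter> space (borel_of X) = {x \<in> topspace X. f x \<in> U}" by auto
  ultimately show "f -` U \<inter> space (borel_of X) \<in> sets (borel_of X)" by (simp add: openin_in_borel_of)
qed (auto dest: openin_subset)

lemma rectangle_in_borel_of:
  assumes "A \<in> sets (borel_of X)" "B \<in> sets (borel_of Y)"
  shows "A \<times> B \<in> sets (borel_of (prod_topology X Y))"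
proof -
  have sub: "A \<subseteq> topspace X" "B \<subseteq> topspace Y"
    using assms by (auto dest: sets_borel_of_subset)
  have "fst -` A \<inter> space (borel_of (prod_topology X Y)) \<in> sets (borel_of (prod_topology X Y))"
    "snd -` B \<inter> space (borel_of (prod_topology X Y)) \<in> sets (borel_of (prod_topology X Y))"
    using measurable_sets[OF continuous_map_measurable[OF continuous_map_fst] assms(1)]
      measurable_sets[OF continuous_map_measurable[OF continuous_map_snd] assms(2)] by blast+
  moreover have "A \<times> B = (fst -` A \<inter> space (borel_of (prod_topology X Y))) \<inter>
      (snd -` B \<inter> space (borel_of (prod_topology X Y)))"
    using sub by auto
  ultimately show ?thesis by (metis sets.Int)
qed

lemma continuous_map_swapped:
  assumes "continuous_map (prod_topology X X) euclideanreal K"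
  shows "continuous_map (prod_topology X X) euclideanreal (\<lambda>p. K (prod.swap p))"
proof -
  have "continuous_map (prod_topology X X) (prod_topology X X) (\<lambda>p. (snd p, fst p))"
    by (intro continuous_map_pairedI continuous_map_fst continuous_map_snd)
  from continuous_map_compose[OF this assms] show ?thesis
    by (simp add: o_def prod.swap_def)
qed

text \<open>Cover \<open>X \<times> X\<close> by finitely many open rectangles on which \<open>K\<close> oscillates by less than \<open>e\<close>, and
  call two points of \<open>X\<close> equivalent if they lie in the same sides of these rectangles. The classes are
  Borel, and on a product of two classes \<open>K\<close> is nearly constant.\<close>

lemma finite_Borel_partition_for_kernel:
  assumes X: "compact_space X" and K: "continuous_map (prod_topology X X) euclideanreal K"
    and e: "0 < (e::real)"
  obtains P :: "'a set set" and c where "finite P" "disjoint P" "\<Union>P = topspace X"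
    "P \<subseteq> sets (borel_of X)"
    "\<And>A B x y. A \<in> P \<Longrightarrow> B \<in> P \<Longrightarrow> x \<in> A \<Longrightarrow> y \<in> B \<Longrightarrow> \<bar>K (x, y) - c A B\<bar> \<le> e"
proof -
  have "\<exists>U W. openin X U \<and> openin X W \<and> p \<in> U \<times> W \<and> (\<forall>q\<in>U \<times> W. \<bar>K q - K p\<bar> < e / 2)"
    if p: "p \<in> topspace (prod_topology X X)" for p
  proof -
    let ?S = "{q \<in> topspace (prod_topology X X). K q \<in> ball (K p) (e / 2)}"
    have "openin (prod_topology X X) ?S"
      by (rule openin_continuous_map_preimage[OF K]) simp
    moreover have "(fst p, snd p) \<in> ?S" using p e by simp
    ultimately have "\<exists>U W. openin X U \<and> openin X W \<and> fst p \<in> U \<and> snd p \<in> W \<and> U \<times> W \<subseteq> ?S"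
      by (rule iffD1[OF openin_prod_topology_alt, rule_format])
    then obtain U W where UW: "openin X U" "openin X W" "fst p \<in> U" "snd p \<in> W" "U \<times> W \<subseteq> ?S"
      by (elim exE conjE)
    then have "\<forall>q\<in>U \<times> W. \<bar>K q - K p\<bar> < e / 2"
      by (auto simp: dist_real_def abs_minus_commute)
    moreover have "p \<in> U \<times> W" using UW(3,4) by (simp add: mem_Times_iff)
    ultimately show ?thesis using UW(1,2) by blast
  qed
  then obtain U W where UW: "\<And>p. p \<in> topspace (prod_topology X X) \<Longrightarrow>
      openin X (U p) \<and> openin X (W p) \<and> p \<in> U p \<times> W p \<and> (\<forall>q\<in>U p \<times> W p. \<bar>K q - K p\<bar> < e / 2)"
    by metis
  have "compactin (prod_topology X X) (topspace (prod_topology X X))"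
    using X compact_space_prod_topology compact_space_def by metis
  moreover have "\<forall>R\<in>(\<lambda>p. U p \<times> W p) ` topspace (prod_topology X X). openin (prod_topology X X) R"
    using UW by (simp add: openin_prod_Times_iff)
  moreover have "topspace (prod_topology X X) \<subseteq> \<Union>((\<lambda>p. U p \<times> W p) ` topspace (prod_topology X X))"
    using UW by blast
  ultimately obtain \<F> where "finite \<F>" "\<F> \<subseteq> (\<lambda>p. U p \<times> W p) ` topspace (prod_topology X X)"
      "topspace (prod_topology X X) \<subseteq> \<Union>\<F>"
    unfolding compactin_def by blast
  then obtain D where D: "finite D" "D \<subseteq> topspace (prod_topology X X)"
      "topspace (prod_topology X X) \<subseteq> (\<Union>p\<in>D. U p \<times> W p)"
    by (metis (no_types, lifting) finite_subset_image)
  define \<sigma> where "\<sigma> x = ({p \<in> D. x \<in> U p}, {p \<in> D. x \<in> W p})" for x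
  define cell where "cell x = {y \<in> topspace X. \<sigma> y = \<sigma> x}" for x
  define P where "P = cell ` topspace X"
  \<comment> \<open>the value at an arbitrary representative of the cell\<close>
  define c where "c A B = K (SOME x. x \<in> A, SOME y. y \<in> B)" for A B
  have "\<sigma> ` topspace X \<subseteq> Pow D \<times> Pow D" by (auto simp: \<sigma>_def)
  then have "finite (\<sigma> ` topspace X)" using D(1) by (meson finite_Pow_iff finite_SigmaI finite_subset)
  moreover have "P = (\<lambda>\<tau>. {y \<in> topspace X. \<sigma> y = \<tau>}) ` \<sigma> ` topspace X"
    unfolding P_def cell_def by auto
  ultimately have 1: "finite P" by simp
  have 2: "disjoint P" unfolding P_def cell_def disjoint_def by auto
  have 3: "\<Union>P = topspace X" unfolding P_def cell_def by auto
  have 4: "P \<subseteq> sets (borel_of X)"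
  proof (clarsimp simp: P_def)
    fix x
    have "cell x = {y \<in> space (borel_of X). \<forall>p\<in>D. (y \<in> U p \<longleftrightarrow> x \<in> U p) \<and> (y \<in> W p \<longleftrightarrow> x \<in> W p)}"
      unfolding cell_def \<sigma>_def by auto
    also have "\<dots> \<in> sets (borel_of X)"
    proof (intro sets.sets_Collect_finite_All D(1) sets.sets_Collect_conj)
      have *: "{y \<in> space (borel_of X). y \<in> A \<longleftrightarrow> b} \<in> sets (borel_of X)" if "openin X A" for A b
      proof (cases b)
        case True
        then have "{y \<in> space (borel_of X). y \<in> A \<longleftrightarrow> b} = A" using openin_subset[OF that] by auto
        then show ?thesis using that openin_in_borel_of by simp
      next
        case False
        then have "{y \<in> space (borel_of X). y \<in> A \<longleftrightarrow> b} = space (borel_of X) - A" by auto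
        then show ?thesis using openin_in_borel_of[OF that] by (metis sets.compl_sets)
      qed
      fix p assume "p \<in> D"
      with D(2) UW have "openin X (U p)" "openin X (W p)" by auto
      then show "{y \<in> space (borel_of X). (y \<in> U p) = (x \<in> U p)} \<in> sets (borel_of X)"
        "{y \<in> space (borel_of X). (y \<in> W p) = (x \<in> W p)} \<in> sets (borel_of X)"
        by (simp_all only: *)
    qed
    finally show "cell x \<in> sets (borel_of X)" .
  qed
  have 5: "\<bar>K (x, y) - c A B\<bar> \<le> e" if "A \<in> P" "B \<in> P" "x \<in> A" "y \<in> B" for A B x y
  proof -
    define x' y' where "x' = (SOME x. x \<in> A)" and "y' = (SOME y. y \<in> B)"
    have "x' \<in> A" "y' \<in> B" unfolding x'_def y'_def using that by (meson someI)+
    then have \<sigma>: "\<sigma> x' = \<sigma> x" "\<sigma> y' = \<sigma> y" "x \<in> topspace X" "y \<in> topspace X"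
      using that unfolding P_def cell_def by auto
    then obtain p where p: "p \<in> D" "x \<in> U p" "y \<in> W p" using D(3) by fastforce
    then have "x' \<in> U p" "y' \<in> W p" using \<sigma>(1,2) unfolding \<sigma>_def by auto
    then have "\<bar>K (x', y') - K p\<bar> < e / 2" "\<bar>K (x, y) - K p\<bar> < e / 2"
      using UW[of p] p D(2) by auto
    then have "\<bar>K (x, y) - K (x', y')\<bar> \<le> e" by linarith
    then show ?thesis by (simp add: c_def x'_def y'_def)
  qed
  show ?thesis by (rule that[OF 1 2 3 4 5])
qed

lemma integral_near_step:
  assumes M: "finite_measure M" and f: "integrable M f" and J: "finite J"
    and R: "\<And>j. j \<in> J \<Longrightarrow> R j \<in> sets M"
    and near: "\<And>x. x \<in> space M \<Longrightarrow> \<bar>f x - (\<Sum>j\<in>J. a j * indicator (R j) x)\<bar> \<le> e"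
  shows "\<bar>(\<integral>x. f x \<partial>M) - (\<Sum>j\<in>J. a j * measure M (R j))\<bar> \<le> e * measure M (space M)"
proof -
  interpret finite_measure M by (rule M)
  let ?s = "\<lambda>x. \<Sum>j\<in>J. a j * indicator (R j) x"
  have s: "integrable M ?s"
    using R by (intro Bochner_Integration.integrable_sum integrable_mult_right integrable_real_indicator)
      (auto simp: emeasure_eq_measure)
  have "(\<integral>x. ?s x \<partial>M) = (\<Sum>j\<in>J. \<integral>x. a j * indicator (R j) x \<partial>M)"
    using R by (intro Bochner_Integration.integral_sum integrable_mult_right integrable_real_indicator)
      (auto simp: emeasure_eq_measure)
  also have "\<dots> = (\<Sum>j\<in>J. a j * measure M (R j))"
    using R sets.sets_into_space by (intro sum.cong) (auto simp: Int_absorb2)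
  finally have "\<bar>(\<integral>x. f x \<partial>M) - (\<Sum>j\<in>J. a j * measure M (R j))\<bar> = \<bar>\<integral>x. f x - ?s x \<partial>M\<bar>"
    using f s by simp
  also have "\<dots> \<le> (\<integral>x. \<bar>f x - ?s x\<bar> \<partial>M)" by (rule integral_abs_bound)
  also have "\<dots> \<le> (\<integral>x. e \<partial>M)"
    using f s near by (intro integral_mono Bochner_Integration.integrable_abs Bochner_Integration.integrable_diff) auto
  finally show ?thesis by (simp add: mult.commute)
qed

text \<open>Symmetry of \<open>\<mu>\<close> is only known on rectangles, and the Borel sets of \<open>X \<times> X\<close> need not be generated
  by rectangles. Continuous kernels are nevertheless uniform limits of step functions on rectangles, and
  for those the exchange of the variables is harmless.\<close>

lemma signed_integral_swap:
  assumes X: "compact_space X" and \<mu>: "\<mu> \<in> sym_measures X"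
    and K: "continuous_map (prod_topology X X) euclideanreal K"
  shows "signed_integral (prod_topology X X) \<mu> (\<lambda>p. K (prod.swap p)) = signed_integral (prod_topology X X) \<mu> K"
proof -
  let ?X2 = "prod_topology X X"
  let ?I = "signed_integral ?X2 \<mu>"
  define M where "M = pos_variation (borel_of ?X2) \<mu>"
  define N where "N = neg_variation (borel_of ?X2) \<mu>"
  have sr: "\<mu> \<in> signed_radon_measures ?X2" using \<mu> by (simp add: sym_measures_def)
  have MN: "finite_radon_measure ?X2 M" "finite_radon_measure ?X2 N"
    using sr by (auto simp: M_def N_def signed_radon_measures_def)
  note D = finite_radon_measureD[OF MN(1)] finite_radon_measureD[OF MN(2)]
  have X2: "compact_space ?X2" using X compact_space_prod_topology by metis
  note int = integrable_continuous_map[OF X2 D(1,2)] integrable_continuous_map[OF X2 D(4,5)]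
  note K' = continuous_map_swapped[OF K]
  define B where "B = measure M (space M) + measure N (space N)"
  have "\<bar>?I (\<lambda>p. K (prod.swap p)) - ?I K\<bar> \<le> 2 * e * B" if e: "0 < e" for e
  proof -
    obtain P :: "'a set set" and c where P: "finite P" "disjoint P" "\<Union>P = topspace X"
      "P \<subseteq> sets (borel_of X)"
      "\<And>A B x y. A \<in> P \<Longrightarrow> B \<in> P \<Longrightarrow> x \<in> A \<Longrightarrow> y \<in> B \<Longrightarrow> \<bar>K (x, y) - c A B\<bar> \<le> e"
      using finite_Borel_partition_for_kernel[OF X K e] by metis
    let ?c = "\<lambda>(A, B). c A B" and ?R = "\<lambda>(A, B). A \<times> B" and ?R' = "\<lambda>(A, B). B \<times> A"
    have R: "?R j \<in> sets (borel_of ?X2)" "?R' j \<in> sets (borel_of ?X2)" "\<mu> (?R' j) = \<mu> (?R j)"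
      if j: "j \<in> P \<times> P" for j
    proof -
      obtain A B where "j = (A, B)" by (cases j)
      then have AB: "j = (A, B)" "A \<in> sets (borel_of X)" "B \<in> sets (borel_of X)" using j P(4) by auto
      show "?R j \<in> sets (borel_of ?X2)" "?R' j \<in> sets (borel_of ?X2)"
        using AB by (auto intro: rectangle_in_borel_of)
      show "\<mu> (?R' j) = \<mu> (?R j)" using AB \<mu> by (simp add: sym_measures_def)
    qed
    have cell: "(\<Sum>j\<in>P \<times> P. ?c j * indicator (?R j) (x, y)) = c A B"
      if "A \<in> P" "B \<in> P" "x \<in> A" "y \<in> B" for A B x y
    proof -
      have "?c j * indicator (?R j) (x, y) = (if j = (A, B) then c A B else 0)" if "j \<in> P \<times> P" for j
        using that \<open>A \<in> P\<close> \<open>B \<in> P\<close> \<open>x \<in> A\<close> \<open>y \<in> B\<close> P(2)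
        by (auto simp: indicator_def disjoint_def split: if_splits)
      then show ?thesis using that P(1) by simp
    qed
    have near: "\<bar>K p - (\<Sum>j\<in>P \<times> P. ?c j * indicator (?R j) p)\<bar> \<le> e" if "p \<in> topspace ?X2" for p
    proof -
      obtain x y where p: "p = (x, y)" by (cases p)
      then have "x \<in> \<Union>P" "y \<in> \<Union>P" using that P(3) by auto
      then obtain A B where "A \<in> P" "B \<in> P" "x \<in> A" "y \<in> B" by blast
      then show ?thesis using cell P(5) p by simp
    qed
    have near': "\<bar>K (prod.swap p) - (\<Sum>j\<in>P \<times> P. ?c j * indicator (?R' j) p)\<bar> \<le> e"
      if "p \<in> topspace ?X2" for p
    proof -
      have "indicator (?R' j) p = (indicator (?R j) (prod.swap p) :: real)" for j
        by (cases p) (auto simp: indicator_def)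
      then show ?thesis using near[of "prod.swap p"] that by (cases p) simp
    qed
    note step = integral_near_step[OF D(1) _ finite_cartesian_product[OF P(1) P(1)]]
      integral_near_step[OF D(4) _ finite_cartesian_product[OF P(1) P(1)]]
    have 1: "\<bar>(\<integral>p. K p \<partial>M) - (\<Sum>j\<in>P \<times> P. ?c j * measure M (?R j))\<bar> \<le> e * measure M (space M)"
      by (rule step(1)[OF int(1)[OF K]]) (use R(1) near D in auto)
    have 2: "\<bar>(\<integral>p. K p \<partial>N) - (\<Sum>j\<in>P \<times> P. ?c j * measure N (?R j))\<bar> \<le> e * measure N (space N)"
      by (rule step(2)[OF int(2)[OF K]]) (use R(1) near D in auto)
    have 3: "\<bar>(\<integral>p. K (prod.swap p) \<partial>M) - (\<Sum>j\<in>P \<times> P. ?c j * measure M (?R' j))\<bar> \<le> e * measure M (space M)"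
      by (rule step(1)[OF int(1)[OF K']]) (use R(2) near' D in auto)
    have 4: "\<bar>(\<integral>p. K (prod.swap p) \<partial>N) - (\<Sum>j\<in>P \<times> P. ?c j * measure N (?R' j))\<bar> \<le> e * measure N (space N)"
      by (rule step(2)[OF int(2)[OF K']]) (use R(2) near' D in auto)
    have "(\<Sum>j\<in>P \<times> P. ?c j * measure M (?R' j)) - (\<Sum>j\<in>P \<times> P. ?c j * measure N (?R' j))
        = (\<Sum>j\<in>P \<times> P. ?c j * \<mu> (?R' j))"
      unfolding sum_subtractf[symmetric] M_def N_def
      by (intro sum.cong refl) (simp only: Jordan_decomposition[OF sr R(2)] right_diff_distrib)
    also have "\<dots> = (\<Sum>j\<in>P \<times> P. ?c j * \<mu> (?R j))"
      by (intro sum.cong refl) (simp only: R(3))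
    also have "\<dots> = (\<Sum>j\<in>P \<times> P. ?c j * measure M (?R j)) - (\<Sum>j\<in>P \<times> P. ?c j * measure N (?R j))"
      unfolding sum_subtractf[symmetric] M_def N_def
      by (intro sum.cong refl) (simp only: Jordan_decomposition[OF sr R(1)] right_diff_distrib)
    finally show ?thesis
      using 1 2 3 4 unfolding signed_integral_def M_def[symmetric] N_def[symmetric] B_def
      by (simp add: algebra_simps abs_le_iff)
  qed
  note bound = this
  show ?thesis
  proof (rule ccontr)
    assume "\<not> ?thesis"
    then have d: "0 < \<bar>?I (\<lambda>p. K (prod.swap p)) - ?I K\<bar>" (is "0 < ?d") by simp
    have B: "0 \<le> B" by (simp add: B_def)
    \<comment> \<open>an \<open>e\<close> so small that the bound drops below \<open>?d / 2\<close>\<close>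
    have "?d \<le> 2 * (?d / (4 * (B + 1))) * B" using d B by (intro bound) simp
    also have "\<dots> = (?d / 2) * (B / (B + 1))" using B by (simp add: field_simps)
    also have "\<dots> \<le> (?d / 2) * 1" using B d by (intro mult_left_mono) auto
    finally show False using d by simp
  qed
qed

lemma signed_integral_add:
  assumes X: "compact_space X" and \<mu>: "\<mu> \<in> signed_radon_measures X"
    and f: "continuous_map X euclideanreal f" and g: "continuous_map X euclideanreal g"
  shows "signed_integral X \<mu> (\<lambda>x. f x + g x) = signed_integral X \<mu> f + signed_integral X \<mu> g"
proof -
  have MN: "finite_radon_measure X (pos_variation (borel_of X) \<mu>)"
      "finite_radon_measure X (neg_variation (borel_of X) \<mu>)"
    using \<mu> by (auto simp: signed_radon_measures_def)
  note int = integrable_continuous_map[OF X finite_radon_measureD(1,2)[OF MN(1)]]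
    integrable_continuous_map[OF X finite_radon_measureD(1,2)[OF MN(2)]]
  show ?thesis using int[OF f] int[OF g] by (simp add: signed_integral_def)
qed

text \<open>Existence is the Riesz theorem; the representing measure is symmetric because its outer measure is
  computed from \<open>L\<close>, which is invariant under exchanging the variables. For uniqueness, the integral of
  any continuous \<open>K\<close> against a symmetric measure is half that of the symmetric kernel
  \<open>K(x, y) + K(y, x)\<close>, so a symmetric measure is determined on all of \<open>C(X \<times> X)\<close>.\<close>

lemma unique_symmetric_representation:
  assumes X: "compact_space X" "Hausdorff_space X"
    and L: "positive_functional (prod_topology X X) L"
    and sym: "\<And>K. continuous_map (prod_topology X X) euclideanreal K \<Longrightarrow> L (\<lambda>p. K (prod.swap p)) = L K"
  shows "\<exists>!\<mu>. \<mu> \<in> sym_measures X \<and> (\<forall>K\<in>sym_kernels X. signed_integral (prod_topology X X) \<mu> K = L K)"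
proof -
  let ?X2 = "prod_topology X X"
  interpret L: positive_functional ?X2 L by (rule L)
  note X2 = L.compact L.Hausdorff
  note Riesz = L.Riesz_representation
  define M where "M = L.representing_measure"
  have M: "finite_radon_measure ?X2 M" and M_int: "\<And>K. continuous_map ?X2 euclideanreal K \<Longrightarrow> (\<integral>p. K p \<partial>M) = L K"
    using Riesz by (auto simp: M_def)
  have unique: "\<mu> A = measure M A"
    if sr: "\<mu> \<in> signed_radon_measures ?X2" and A: "A \<in> sets (borel_of ?X2)"
      and eq: "\<And>K. continuous_map ?X2 euclideanreal K \<Longrightarrow> signed_integral ?X2 \<mu> K = L K" for \<mu> A
  proof -
    let ?P = "pos_variation (borel_of ?X2) \<mu>" and ?N = "neg_variation (borel_of ?X2) \<mu>"
    have "measure ?P A = measure ?N A + measure M A"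
    proof (rule Radon_measure_sum_eqI[OF X2 _ _ M _ A])
      show "finite_radon_measure ?X2 ?P" "finite_radon_measure ?X2 ?N"
        using sr by (auto simp: signed_radon_measures_def)
      fix K assume "continuous_map ?X2 euclideanreal K"
      then show "(\<integral>p. K p \<partial>?P) = (\<integral>p. K p \<partial>?N) + (\<integral>p. K p \<partial>M)"
        using eq[of K] M_int[of K] by (simp add: signed_integral_def)
    qed
    then show ?thesis using Jordan_decomposition[OF sr A] by simp
  qed
  have openin_swap: "openin ?X2 (prod.swap ` U)" if "openin ?X2 U" for U
  proof -
    have "continuous_map ?X2 ?X2 (\<lambda>p. (snd p, fst p))"
      by (intro continuous_map_pairedI continuous_map_fst continuous_map_snd)
    then have "openin ?X2 {p \<in> topspace ?X2. prod.swap p \<in> U}"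
      using that unfolding prod.swap_def by (rule openin_continuous_map_preimage)
    also have "{p \<in> topspace ?X2. prod.swap p \<in> U} = prod.swap ` U"
      using openin_subset[OF that] by (force simp: image_iff)
    finally show ?thesis .
  qed
  have content_swap: "L.content U \<le> L.content (prod.swap ` U)" for U
    unfolding L.content_def[of U]
  proof (rule SUP_least, clarify)
    fix f assume f: "L.below U f"
    then have fc: "continuous_map ?X2 euclideanreal f" by (simp add: L.below_def)
    have "indicator (prod.swap ` U) p = (indicator U (prod.swap p) :: real)" for p
      by (cases p) (force simp: indicator_def image_iff)
    then have "L.below (prod.swap ` U) (\<lambda>p. f (prod.swap p))"
      using f continuous_map_swapped[OF fc] by (auto simp: L.below_def)
    then show "ennreal (L f) \<le> L.content (prod.swap ` U)"
      using L.below_le_content sym[OF fc] by metis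
  qed
  have outer_swap: "L.outer (prod.swap ` A) \<le> L.outer A" for A
    unfolding L.outer_def[of A]
  proof (rule INF_greatest, clarify)
    fix U assume U: "openin ?X2 U" "A \<subseteq> U"
    then have "L.outer (prod.swap ` A) \<le> L.content (prod.swap ` U)"
      by (intro L.outer_le_content openin_swap) auto
    also have "\<dots> \<le> L.content (prod.swap ` prod.swap ` U)" by (rule content_swap)
    finally show "L.outer (prod.swap ` A) \<le> L.content U" by (simp add: image_image)
  qed
  show ?thesis
  proof (rule ex1I[of _ "measure M"], intro conjI ballI)
    show "measure M \<in> sym_measures X"
      unfolding sym_measures_def
    proof (intro CollectI conjI ballI)
      show "measure M \<in> signed_radon_measures ?X2"
        using measure_in_nonneg_radon_measures[OF M] by (simp add: nonneg_radon_measures_def)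
      fix A B assume AB: "A \<in> sets (borel_of X)" "B \<in> sets (borel_of X)"
      have "prod.swap ` (A \<times> B) = B \<times> A" "prod.swap ` (B \<times> A) = A \<times> B" by auto
      then have "L.outer (A \<times> B) = L.outer (B \<times> A)" using outer_swap by (metis antisym)
      then show "measure M (A \<times> B) = measure M (B \<times> A)"
        using AB by (simp add: M_def measure_def L.emeasure_representing_measure rectangle_in_borel_of)
    qed
    fix K assume "K \<in> sym_kernels X"
    then show "signed_integral ?X2 (measure M) K = L K"
      using M_int by (simp add: signed_integral_measure[OF M] sym_kernels_def)
  next
    fix \<mu> assume \<mu>: "\<mu> \<in> sym_measures X \<and> (\<forall>K\<in>sym_kernels X. signed_integral ?X2 \<mu> K = L K)"
    then have sr: "\<mu> \<in> signed_radon_measures ?X2" by (simp add: sym_measures_def)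
    have "signed_integral ?X2 \<mu> K = L K" if K: "continuous_map ?X2 euclideanreal K" for K
    proof -
      note K' = continuous_map_swapped[OF K]
      have "(\<lambda>p. K p + K (prod.swap p)) \<in> sym_kernels X"
        using continuous_map_add[OF K K'] by (simp add: sym_kernels_def add.commute)
      then have "signed_integral ?X2 \<mu> (\<lambda>p. K p + K (prod.swap p)) = L (\<lambda>p. K p + K (prod.swap p))"
        using \<mu> by blast
      moreover have "signed_integral ?X2 \<mu> (\<lambda>p. K p + K (prod.swap p)) = 2 * signed_integral ?X2 \<mu> K"
        using signed_integral_add[OF X2(1) sr K K'] signed_integral_swap[OF X(1) _ K] \<mu> by simp
      moreover have "L (\<lambda>p. K p + K (prod.swap p)) = 2 * L K"
        using L.add[OF K K'] sym[OF K] by simp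
      ultimately show ?thesis by simp
    qed
    then have "\<mu> A = measure M A" for A
    proof (cases "A \<in> sets (borel_of ?X2)")
      case False
      then show ?thesis
        using sr finite_radon_measureD(2)[OF M]
        by (simp add: signed_radon_measures_def signed_measure_def measure_notin_sets)
    qed (use unique[OF sr] in blast)
    then show "\<mu> = measure M" by blast
  qed
qed

section \<open>The topology of the space of independent sets\<close>

lemma openin_sub_space_subset:
  assumes "openin V U"
  shows "openin (sub_space t V) {S \<in> subsets_upto t V. S \<subseteq> U}"
proof -
  have "{v \<in> topspace (power_space t V). v ` {..<t} \<in> {S \<in> subsets_upto t V. S \<subseteq> U}}
      = (\<Pi>\<^sub>E i\<in>{..<t}. U)"
  proof (intro set_eqI iffI)
    fix v assume "v \<in> {v \<in> topspace (power_space t V). v ` {..<t} \<in> {S \<in> subsets_upto t V. S \<subseteq> U}}"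
    then show "v \<in> (\<Pi>\<^sub>E i\<in>{..<t}. U)" by (simp add: PiE_iff image_subset_iff)
  next
    fix v assume v: "v \<in> (\<Pi>\<^sub>E i\<in>{..<t}. U)"
    then have vP: "v \<in> topspace (power_space t V)"
      using openin_subset[OF assms] by (simp add: PiE_iff subset_iff)
    show "v \<in> {v \<in> topspace (power_space t V). v ` {..<t} \<in> {S \<in> subsets_upto t V. S \<subseteq> U}}"
      using vP image_power_space[OF vP] v by (simp add: PiE_iff image_subset_iff)
  qed
  then show ?thesis
    unfolding openin_sub_space using assms by (auto simp: openin_PiE)
qed

lemma openin_sub_space_meets:
  assumes "openin V U"
  shows "openin (sub_space t V) {S \<in> subsets_upto t V. S \<inter> U \<noteq> {}}"
proof -
  have "{v \<in> topspace (power_space t V). v ` {..<t} \<in> {S \<in> subsets_upto t V. S \<inter> U \<noteq> {}}}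
      = (\<Union>i<t. {v \<in> topspace (power_space t V). v i \<in> U})"
    using image_power_space[where V = V and t = t] by auto
  moreover have "openin (power_space t V) {v \<in> topspace (power_space t V). v i \<in> U}" if "i < t" for i
  proof -
    have "continuous_map (power_space t V) V (\<lambda>v. v i)"
      using continuous_map_product_projection[of i "{..<t}" "\<lambda>_. V"] that by simp
    then show ?thesis by (rule openin_continuous_map_preimage[OF _ assms])
  qed
  ultimately show ?thesis
    unfolding openin_sub_space by (auto intro!: openin_Union)
qed

text \<open>Intersect the pairwise separations of the points.\<close>

lemma finite_disjoint_open_neighbourhoods:
  assumes V: "Hausdorff_space V" and S: "finite S" "S \<subseteq> topspace V"
  obtains D where "\<And>x. x \<in> S \<Longrightarrow> openin V (D x) \<and> x \<in> D x"
    "\<And>x y. x \<in> S \<Longrightarrow> y \<in> S \<Longrightarrow> x \<noteq> y \<Longrightarrow> D x \<inter> D y = {}"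
proof -
  have "\<exists>A B. openin V A \<and> openin V B \<and> x \<in> A \<and> y \<in> B \<and> disjnt A B"
    if "x \<in> S" "y \<in> S" "x \<noteq> y" for x y
    using V S(2) that unfolding Hausdorff_space_def by blast
  then obtain A B where AB: "\<And>x y. x \<in> S \<Longrightarrow> y \<in> S \<Longrightarrow> x \<noteq> y \<Longrightarrow>
      openin V (A x y) \<and> openin V (B x y) \<and> x \<in> A x y \<and> y \<in> B x y \<and> disjnt (A x y) (B x y)"
    by metis
  define D where "D x = topspace V \<inter> (\<Inter>y\<in>S - {x}. A x y \<inter> B y x)" for x
  show ?thesis
  proof
    fix x assume x: "x \<in> S"
    show "openin V (D x) \<and> x \<in> D x"
      unfolding D_def using S x AB by (auto intro!: openin_Int_Inter)
    fix y assume y: "y \<in> S" "x \<noteq> y"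
    then have "D x \<subseteq> A x y" "D y \<subseteq> B x y" using x by (auto simp: D_def)
    then show "D x \<inter> D y = {}" using AB[OF x y] by (auto simp: disjnt_iff)
  qed
qed

text \<open>If \<open>x \<in> S - T\<close>, separate \<open>x\<close> from the finite set \<open>T\<close> by open sets \<open>U\<close> and \<open>W\<close>: the sets that meet \<open>U\<close>
  and the sets contained in \<open>W\<close> are disjoint neighbourhoods of \<open>S\<close> and \<open>T\<close>.\<close>

lemma Hausdorff_sub_space:
  assumes V: "Hausdorff_space V"
  shows "Hausdorff_space (sub_space t V)"
proof -
  have sep: "\<exists>\<U> \<W>. openin (sub_space t V) \<U> \<and> openin (sub_space t V) \<W> \<and> S \<in> \<U> \<and> T \<in> \<W> \<and> disjnt \<U> \<W>"
    if S: "S \<in> subsets_upto t V" and T: "T \<in> subsets_upto t V" and x: "x \<in> S" "x \<notin> T" for S T x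
  proof -
    have "compactin V T" "compactin V {x}"
      using S T x by (auto simp: subsets_upto_def intro!: finite_imp_compactin)
    moreover have "disjnt {x} T" using x by (simp add: disjnt_iff)
    ultimately obtain U W where UW: "openin V U" "openin V W" "{x} \<subseteq> U" "T \<subseteq> W" "disjnt U W"
      using V by (metis Hausdorff_space_compact_sets)
    have "disjnt {S \<in> subsets_upto t V. S \<inter> U \<noteq> {}} {S \<in> subsets_upto t V. S \<subseteq> W}"
      using UW(5) by (auto simp: disjnt_iff)
    then show ?thesis
      using openin_sub_space_meets[OF UW(1), of t] openin_sub_space_subset[OF UW(2), of t] S T x UW(3,4)
      by blast
  qed
  show ?thesis
    unfolding Hausdorff_space_def
  proof (intro allI impI)
    fix S T assume "S \<in> topspace (sub_space t V) \<and> T \<in> topspace (sub_space t V) \<and> S \<noteq> T"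
    then have ST: "S \<in> subsets_upto t V" "T \<in> subsets_upto t V" "S \<noteq> T" by auto
    then consider x where "x \<in> S" "x \<notin> T" | x where "x \<in> T" "x \<notin> S" by blast
    then show "\<exists>\<U> \<W>. openin (sub_space t V) \<U> \<and> openin (sub_space t V) \<W> \<and> S \<in> \<U> \<and> T \<in> \<W> \<and> disjnt \<U> \<W>"
    proof cases
      case 1 then show ?thesis using sep[OF ST(1,2)] by blast
    next
      case 2 then show ?thesis using sep[OF ST(2,1)] by (metis disjnt_sym)
    qed
  qed
qed

lemma compact_sub_space:
  assumes V: "compact_space V" and t: "t \<ge> 1"
  shows "compact_space (sub_space t V)"
proof -
  let ?f = "\<lambda>v. v ` {..<t}"
  have q: "quotient_map (power_space t V) (subtopology (sub_space t V) (subsets_upto t V - {{}})) ?f"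
    by (rule quotient_map_sub_space[OF t])
  have "compactin (power_space t V) (topspace (power_space t V))"
    using V by (metis compact_space_def compact_space_product_topology)
  then have "compactin (sub_space t V) (?f ` topspace (power_space t V))"
    using quotient_imp_continuous_map[OF q] continuous_map_into_fulltopology image_compactin by blast
  moreover have "?f ` topspace (power_space t V) = subsets_upto t V - {{}}"
    using quotient_imp_surjective_map[OF q] by (simp add: Int_absorb1)
  moreover have "compactin (sub_space t V) {{}}"
    by (rule finite_imp_compactin) (auto simp: subsets_upto_def)
  ultimately have "compactin (sub_space t V) ({{}} \<union> (subsets_upto t V - {{}}))"
    using compactin_Un by metis
  moreover have "{{}} \<union> (subsets_upto t V - {{}}) = topspace (sub_space t V)"
    by (auto simp: subsets_upto_def)
  ultimately show ?thesis by (simp add: compact_space_def)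
qed

locale compact_packing_graph =
  fixes V :: "'a topology" and E :: "'a set set"
  assumes packing: "topological_packing_graph V E" and compact_V: "compact_space V"
begin

lemma Hausdorff_V: "Hausdorff_space V"
  using packing by (simp add: topological_packing_graph_def)

lemma open_clique:
  assumes "finite C" "clique V E C"
  obtains U where "openin V U" "clique V E U" "C \<subseteq> U"
  using packing assms unfolding topological_packing_graph_def by blast

lemma topspace_indep_space [simp]: "topspace (indep_space V E t) = indep_upto V E t"
  by (auto simp: indep_space_def indep_upto_def)

lemma indep_upto_iff:
  "S \<in> indep_upto V E t \<longleftrightarrow> finite S \<and> card S \<le> t \<and> independent_set V E S"
  by (auto simp: indep_upto_def subsets_upto_def independent_set_def)

lemma independent_subset: "independent_set V E S \<Longrightarrow> T \<subseteq> S \<Longrightarrow> independent_set V E T"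
  unfolding independent_set_def by blast

lemma clique_independent_eq:
  assumes "clique V E C" "independent_set V E S" "u \<in> S \<inter> C" "v \<in> S \<inter> C"
  shows "u = v"
proof (rule ccontr)
  assume "u \<noteq> v"
  then have "{u, v} \<in> E" using assms by (auto simp: clique_def)
  moreover have "{u, v} \<subseteq> S" using assms by blast
  ultimately show False using assms(2) unfolding independent_set_def by blast
qed

lemma empty_in_indep_upto [simp]: "{} \<in> indep_upto V E t"
  using packing
  by (auto simp: indep_upto_iff independent_set_def topological_packing_graph_def graph_on_def)

lemma openin_indep_space_subset:
  assumes "openin V U" shows "openin (indep_space V E t) {S \<in> indep_upto V E t. S \<subseteq> U}"
proof -
  have "{S \<in> indep_upto V E t. S \<subseteq> U} = {S \<in> subsets_upto t V. S \<subseteq> U} \<inter> indep_upto V E t"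
    by (auto simp: indep_upto_def)
  then show ?thesis
    by (simp only: indep_space_def) (rule openin_subtopology_Int[OF openin_sub_space_subset[OF assms]])
qed

lemma openin_indep_space_meets:
  assumes "openin V U" shows "openin (indep_space V E t) {S \<in> indep_upto V E t. S \<inter> U \<noteq> {}}"
proof -
  have "{S \<in> indep_upto V E t. S \<inter> U \<noteq> {}} = {S \<in> subsets_upto t V. S \<inter> U \<noteq> {}} \<inter> indep_upto V E t"
    by (auto simp: indep_upto_def)
  then show ?thesis
    by (simp only: indep_space_def) (rule openin_subtopology_Int[OF openin_sub_space_meets[OF assms]])
qed

text \<open>An edge \<open>{u, v} \<subseteq> S\<close> lies in an open clique \<open>C\<close>. Every set close to \<open>S\<close> has one point near \<open>u\<close>
  and another near \<open>v\<close>, both in \<open>C\<close>, and thus contains an edge as well.\<close>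

lemma closedin_indep_upto: "closedin (sub_space t V) (indep_upto V E t)"
  unfolding closedin_def topspace_sub_space
proof (intro conjI)
  show "indep_upto V E t \<subseteq> subsets_upto t V" by (auto simp: indep_upto_def)
  show "openin (sub_space t V) (subsets_upto t V - indep_upto V E t)"
  proof (subst openin_subopen, intro ballI)
    fix S assume "S \<in> subsets_upto t V - indep_upto V E t"
    then have S: "S \<in> subsets_upto t V" "\<not> independent_set V E S" by (auto simp: indep_upto_def)
    then obtain e where e: "e \<in> E" "e \<subseteq> S" by (auto simp: independent_set_def subsets_upto_def)
    then obtain u v where uv: "e = {u, v}" "u \<noteq> v" "u \<in> topspace V" "v \<in> topspace V"
      using packing by (auto simp: topological_packing_graph_def graph_on_def card_2_iff)
    have "clique V E {u, v}" using uv e by (auto simp: clique_def insert_commute)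
    then obtain C where C: "openin V C" "clique V E C" "{u, v} \<subseteq> C"
      using open_clique[of "{u, v}"] by blast
    obtain A B where AB: "openin V A" "openin V B" "u \<in> A" "v \<in> B" "disjnt A B"
      using Hausdorff_V uv unfolding Hausdorff_space_def by blast
    let ?\<U> = "{S \<in> subsets_upto t V. S \<inter> (A \<inter> C) \<noteq> {}} \<inter> {S \<in> subsets_upto t V. S \<inter> (B \<inter> C) \<noteq> {}}"
    have "openin (sub_space t V) ?\<U>"
      using AB C by (intro openin_Int openin_sub_space_meets)
    moreover have "S \<in> ?\<U>" using S e uv AB C by auto
    moreover have "?\<U> \<subseteq> subsets_upto t V - indep_upto V E t"
    proof
      fix T assume T: "T \<in> ?\<U>"
      then obtain a b where ab: "a \<in> T \<inter> C" "a \<in> A" "b \<in> T \<inter> C" "b \<in> B" by blast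
      have "\<not> independent_set V E T"
      proof
        assume "independent_set V E T"
        then have "a = b" using clique_independent_eq[OF C(2)] ab by blast
        then show False using ab AB(5) by (auto simp: disjnt_iff)
      qed
      then show "T \<in> subsets_upto t V - indep_upto V E t" using T by (simp add: indep_upto_def)
    qed
    ultimately show "\<exists>\<U>. openin (sub_space t V) \<U> \<and> S \<in> \<U> \<and> \<U> \<subseteq> subsets_upto t V - indep_upto V E t"
      by blast
  qed
qed

lemma compact_indep_space: "t \<ge> 1 \<Longrightarrow> compact_space (indep_space V E t)"
  unfolding indep_space_def
  by (meson closedin_compact_space closedin_indep_upto compact_V compact_space_subtopology compact_sub_space)

lemma Hausdorff_indep_space: "Hausdorff_space (indep_space V E t)"
  unfolding indep_space_def
  by (intro Hausdorff_space_subtopology Hausdorff_sub_space Hausdorff_V)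

text \<open>Boxes are the basic neighbourhoods of an independent set \<open>S\<close>: each point \<open>x \<in> S\<close> may move within an
  open clique \<open>U x\<close>, and these cliques are disjoint. An independent set has at most one point in a
  clique, so a member of the box is a transversal of the cliques.\<close>

definition clique_box :: "'a set \<Rightarrow> ('a \<Rightarrow> 'a set) \<Rightarrow> bool" where
  "clique_box S U \<longleftrightarrow> (\<forall>x\<in>S. openin V (U x) \<and> x \<in> U x \<and> clique V E (U x)) \<and>
     (\<forall>x\<in>S. \<forall>y\<in>S. x \<noteq> y \<longrightarrow> U x \<inter> U y = {})"

definition box :: "nat \<Rightarrow> 'a set \<Rightarrow> ('a \<Rightarrow> 'a set) \<Rightarrow> 'a set set" where
  "box t S U = {T \<in> indep_upto V E t. T \<subseteq> \<Union>(U ` S) \<and> (\<forall>x\<in>S. T \<inter> U x \<noteq> {})}"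

lemma clique_box_exists:
  assumes S: "S \<in> indep_upto V E t"
  obtains U where "clique_box S U"
proof -
  have S': "finite S" "S \<subseteq> topspace V" using S by (auto simp: indep_upto_iff independent_set_def)
  obtain D where D: "\<And>x. x \<in> S \<Longrightarrow> openin V (D x) \<and> x \<in> D x"
    "\<And>x y. x \<in> S \<Longrightarrow> y \<in> S \<Longrightarrow> x \<noteq> y \<Longrightarrow> D x \<inter> D y = {}"
    using finite_disjoint_open_neighbourhoods[OF Hausdorff_V S'] by blast
  have "\<exists>C. openin V C \<and> clique V E C \<and> x \<in> C" if "x \<in> S" for x
  proof -
    have "clique V E {x}" using that S' by (auto simp: clique_def)
    then show ?thesis using open_clique[of "{x}"] by blast
  qed
  then obtain C where C: "\<And>x. x \<in> S \<Longrightarrow> openin V (C x) \<and> clique V E (C x) \<and> x \<in> C x" by metis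
  have "clique_box S (\<lambda>x. C x \<inter> D x)"
    unfolding clique_box_def using C D by (fastforce simp: clique_def)
  then show ?thesis using that by blast
qed

lemma clique_box_subset: "clique_box S U \<Longrightarrow> J \<subseteq> S \<Longrightarrow> clique_box J U"
  by (simp add: clique_box_def subset_iff)

lemma box_subset_indep_upto: "box t S U \<subseteq> indep_upto V E t"
  by (auto simp: box_def)

lemma centre_in_box: "clique_box S U \<Longrightarrow> S \<in> indep_upto V E t \<Longrightarrow> S \<in> box t S U"
  unfolding box_def clique_box_def by blast

lemma openin_box:
  assumes S: "finite S" and U: "clique_box S U"
  shows "openin (indep_space V E t) (box t S U)"
proof -
  have eq: "box t S U = {T \<in> indep_upto V E t. T \<subseteq> \<Union>(U ` S)} \<inter> (\<Inter>x\<in>S. {T \<in> indep_upto V E t. T \<inter> U x \<noteq> {}})"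
    by (auto simp: box_def)
  show ?thesis
    unfolding eq using S U
    by (intro openin_Int_Inter openin_indep_space_subset openin_Union)
       (auto simp: clique_box_def intro: openin_indep_space_meets)
qed

lemma box_transversal:
  assumes U: "clique_box S U" and T: "T \<in> box t S U"
  obtains h where "bij_betw h S T" "\<forall>x\<in>S. T \<inter> U x = {h x}"
proof -
  have "\<exists>y. T \<inter> U x = {y}" if x: "x \<in> S" for x
  proof -
    obtain y where y: "y \<in> T \<inter> U x" using T x by (auto simp: box_def)
    moreover have "z = y" if "z \<in> T \<inter> U x" for z
      using clique_independent_eq[OF _ _ that y] U T x
      by (auto simp: clique_box_def box_def indep_upto_iff)
    ultimately show ?thesis by blast
  qed
  then obtain h where h: "\<forall>x\<in>S. T \<inter> U x = {h x}" by metis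
  have "bij_betw h S T"
    unfolding bij_betw_def
  proof
    show "inj_on h S"
    proof (rule inj_onI)
      fix x y assume xy: "x \<in> S" "y \<in> S" "h x = h y"
      then have "h x \<in> U x \<inter> U y" using h by blast
      then show "x = y" using U xy unfolding clique_box_def by blast
    qed
    show "h ` S = T" using h T unfolding box_def by blast
  qed
  with h show ?thesis using that by blast
qed

lemma card_box:
  assumes "clique_box S U" "T \<in> box t S U" shows "card T = card S"
  using box_transversal[OF assms] by (metis bij_betw_same_card)

text \<open>In each clique \<open>U x\<close> the union has at most one point, so the two transversals choose the same one.
  This is what makes bump functions on a box behave like orthogonal ones under the operator \<open>A_op\<close>.\<close>

lemma box_eqI:
  assumes U: "clique_box S U" and T: "T \<in> box t S U" "T' \<in> box t S U"
    and ind: "independent_set V E (T \<union> T')"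
  shows "T = T'"
proof -
  have "T1 \<subseteq> T2" if "T1 \<in> box t S U" "T2 \<in> box t S U" "independent_set V E (T1 \<union> T2)" for T1 T2
  proof
    fix y assume y: "y \<in> T1"
    then obtain x where x: "x \<in> S" "y \<in> U x" using \<open>T1 \<in> box t S U\<close> by (auto simp: box_def)
    then obtain z where z: "z \<in> T2" "z \<in> U x" using \<open>T2 \<in> box t S U\<close> by (auto simp: box_def)
    have "y = z"
      using clique_independent_eq[OF _ that(3), of "U x" y z] U x y z by (auto simp: clique_box_def)
    then show "y \<in> T2" using z by simp
  qed
  from this[OF T ind] this[OF T(2,1)] ind show ?thesis by (simp add: Un_commute)
qed

lemma openin_indep_space_card:
  "openin (indep_space V E t) {S \<in> indep_upto V E t. P (card S)}"
proof (subst openin_subopen, intro ballI)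
  fix S assume S: "S \<in> {S \<in> indep_upto V E t. P (card S)}"
  then obtain U where U: "clique_box S U" using clique_box_exists by blast
  have "finite S" using S by (auto simp: indep_upto_iff)
  moreover have "box t S U \<subseteq> {S \<in> indep_upto V E t. P (card S)}"
    using card_box[OF U] S box_subset_indep_upto by fastforce
  ultimately show "\<exists>W. openin (indep_space V E t) W \<and> S \<in> W \<and> W \<subseteq> {S \<in> indep_upto V E t. P (card S)}"
    using openin_box[OF _ U] centre_in_box[OF U] S by blast
qed

text \<open>An open set around \<open>S\<close> in the quotient topology pulls back to an open set around one chosen
  enumeration \<open>v\<close> of \<open>S\<close>, with repetitions. That set contains a product of open sets \<open>X i\<close>, and
  shrinking the clique at \<open>x\<close> by all \<open>X i\<close> with \<open>v i = x\<close> gives the box: a member is enumerated by moving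
  \<open>v\<close> along its transversal. One enumeration suffices because members of a box have exactly one
  point per clique.\<close>

lemma box_neighbourhood_base:
  assumes t: "t \<ge> 1" and W: "openin (indep_space V E t) W" and S: "S \<in> W"
  obtains U where "clique_box S U" "box t S U \<subseteq> W"
proof -
  have SI: "S \<in> indep_upto V E t" using openin_subset[OF W] S by auto
  obtain C where C: "clique_box S C" using clique_box_exists[OF SI] by blast
  obtain Q where Q: "openin (sub_space t V) Q" "W = Q \<inter> indep_upto V E t"
    using W by (auto simp: indep_space_def openin_subtopology)
  show ?thesis
  proof (cases "S = {}")
    case True
    then have "box t S C \<subseteq> W" using S by (auto simp: box_def)
    then show ?thesis using that C by blast
  next
    case False
    let ?f = "\<lambda>v. v ` {..<t}"
    have "?f ` topspace (power_space t V) = subsets_upto t V \<inter> (subsets_upto t V - {{}})"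
      using quotient_imp_surjective_map[OF quotient_map_sub_space[OF t]]
      by (simp only: topspace_subtopology topspace_sub_space)
    moreover have "S \<in> subsets_upto t V" using SI by (simp add: indep_upto_def)
    ultimately have "S \<in> ?f ` topspace (power_space t V)" using False by simp
    then obtain v where v: "v \<in> topspace (power_space t V)" "v ` {..<t} = S"
      by (elim imageE) simp
    have "openin (power_space t V) {v \<in> topspace (power_space t V). v ` {..<t} \<in> Q}"
      using Q(1) openin_sub_space by blast
    moreover have "v \<in> {v \<in> topspace (power_space t V). v ` {..<t} \<in> Q}" using v S Q by auto
    ultimately have "\<exists>X. v \<in> (\<Pi>\<^sub>E i\<in>{..<t}. X i) \<and> (\<forall>i. openin V (X i)) \<and> finite {i. X i \<noteq> topspace V} \<and>
        (\<Pi>\<^sub>E i\<in>{..<t}. X i) \<subseteq> {v \<in> topspace (power_space t V). v ` {..<t} \<in> Q}"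
      by (rule product_topology_open_contains_basis)
    then obtain X where X: "v \<in> (\<Pi>\<^sub>E i\<in>{..<t}. X i)" "\<forall>i. openin V (X i)"
        "(\<Pi>\<^sub>E i\<in>{..<t}. X i) \<subseteq> {v \<in> topspace (power_space t V). v ` {..<t} \<in> Q}"
      by (elim exE conjE)
    define U where "U x = C x \<inter> (\<Inter>i\<in>{i. i < t \<and> v i = x}. X i)" for x
    have U: "clique_box S U"
      unfolding clique_box_def
    proof (intro conjI ballI impI)
      fix x assume x: "x \<in> S"
      show "openin V (U x)"
        unfolding U_def using C X(2) x by (intro openin_Int_Inter) (auto simp: clique_box_def)
      show "x \<in> U x" unfolding U_def using C X(1) x by (auto simp: clique_box_def)
      show "clique V E (U x)" using C x unfolding clique_box_def clique_def U_def by blast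
      fix y assume "y \<in> S" "x \<noteq> y"
      then show "U x \<inter> U y = {}" using C x unfolding clique_box_def U_def by blast
    qed
    have "box t S U \<subseteq> W"
    proof
      fix T assume T: "T \<in> box t S U"
      obtain h where h: "bij_betw h S T" "\<forall>x\<in>S. T \<inter> U x = {h x}"
        using box_transversal[OF U T] by blast
      define w where "w = (\<lambda>i. if i < t then h (v i) else undefined)"
      have "h (v i) \<in> X i" if "i < t" for i
        using h(2) v(2) that unfolding U_def by blast
      then have "w \<in> (\<Pi>\<^sub>E i\<in>{..<t}. X i)" by (auto simp: w_def PiE_iff extensional_def)
      then have "w ` {..<t} \<in> Q" using X(3) by blast
      moreover have "w ` {..<t} = h ` (v ` {..<t})" by (auto simp: w_def image_iff)
      ultimately show "T \<in> W"
        using T Q(2) v(2) h(1) by (auto simp: bij_betw_def box_def)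
    qed
    with U show ?thesis using that by blast
  qed
qed

text \<open>By the neighbourhood base, the topology is generated by the sets \<open>{S. S \<subseteq> U}\<close> and
  \<open>{S. S \<inter> U \<noteq> {}}\<close>, as for the Vietoris topology.\<close>

lemma continuous_map_into_indep_space:
  assumes t: "t \<ge> 1" and f: "\<And>y. y \<in> topspace Y \<Longrightarrow> f y \<in> indep_upto V E t"
    and sub: "\<And>U. openin V U \<Longrightarrow> openin Y {y \<in> topspace Y. f y \<subseteq> U}"
    and meets: "\<And>U. openin V U \<Longrightarrow> openin Y {y \<in> topspace Y. f y \<inter> U \<noteq> {}}"
  shows "continuous_map Y (indep_space V E t) f"
  unfolding continuous_map_def
proof (intro conjI allI impI)
  show "f \<in> topspace Y \<rightarrow> topspace (indep_space V E t)" using f by auto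
  fix W assume W: "openin (indep_space V E t) W"
  show "openin Y {y \<in> topspace Y. f y \<in> W}"
  proof (subst openin_subopen, intro ballI)
    fix y assume y: "y \<in> {y \<in> topspace Y. f y \<in> W}"
    then obtain U where U: "clique_box (f y) U" "box t (f y) U \<subseteq> W"
      using box_neighbourhood_base[OF t W] by blast
    have fin: "finite (f y)" and yI: "f y \<in> box t (f y) U"
      using y f centre_in_box[OF U(1)] by (auto simp: indep_upto_iff)
    let ?T = "{z \<in> topspace Y. f z \<subseteq> \<Union>(U ` f y)} \<inter> (\<Inter>x\<in>f y. {z \<in> topspace Y. f z \<inter> U x \<noteq> {}})"
    have "openin Y ?T"
      using fin U(1) by (intro openin_Int_Inter sub openin_Union) (auto simp: clique_box_def intro: meets)
    moreover have "y \<in> ?T" using y yI by (auto simp: box_def)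
    moreover have "?T \<subseteq> {y \<in> topspace Y. f y \<in> W}"
      using U(2) f by (auto simp: box_def)
    ultimately show "\<exists>T. openin Y T \<and> y \<in> T \<and> T \<subseteq> {y \<in> topspace Y. f y \<in> W}" by blast
  qed
qed

section \<open>Continuity of the images of kernels under the operator\<close>

text \<open>The index set of the sum in \<open>A_op\<close>, freed from the graph: subsets of an independent set are
  independent.\<close>

definition covers :: "nat \<Rightarrow> 'a set \<Rightarrow> ('a set \<times> 'a set) set" where
  "covers t S = {(J, J'). J \<subseteq> S \<and> J' \<subseteq> S \<and> card J \<le> t \<and> card J' \<le> t \<and> J \<union> J' = S}"

lemma finite_covers: "finite S \<Longrightarrow> finite (covers t S)"
  by (rule finite_subset[of _ "Pow S \<times> Pow S"]) (auto simp: covers_def)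

lemma A_op_covers:
  assumes "S \<in> indep_upto V E n"
  shows "A_op V E t K S = (\<Sum>p\<in>covers t S. K p)"
proof -
  have "{(J, J'). J \<in> indep_upto V E t \<and> J' \<in> indep_upto V E t \<and> J \<union> J' = S} = covers t S"
    using assms
    by (auto simp: covers_def indep_upto_iff intro: finite_subset independent_subset)
  then show ?thesis by (simp add: A_op_def case_prod_eta)
qed

lemma box_Int_Union:
  assumes "\<forall>x\<in>S. T \<inter> U x = {h x}" "J \<subseteq> S"
  shows "T \<inter> \<Union>(U ` J) = h ` J"
  using assms by blast

text \<open>The transversal identifies all members \<open>T\<close> of a box with its centre \<open>S\<close>, hence the covers of \<open>T\<close> with
  those of \<open>S\<close>. The index set of the sum no longer depends on \<open>T\<close>, which reduces continuity of
  \<open>A_op\<close> to that of the restriction maps \<open>T \<mapsto> T \<inter> \<Union>(U ` J)\<close>.\<close>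

lemma A_op_box:
  assumes U: "clique_box S U" and T: "T \<in> box n S U"
  shows "A_op V E t K T = (\<Sum>(J, J')\<in>covers t S. K (T \<inter> \<Union>(U ` J), T \<inter> \<Union>(U ` J')))"
proof -
  obtain h where h: "bij_betw h S T" "\<forall>x\<in>S. T \<inter> U x = {h x}"
    using box_transversal[OF U T] by blast
  note r = box_Int_Union[OF h(2)]
  have inj: "inj_on h S" and im: "h ` S = T" using h(1) by (auto simp: bij_betw_def)
  have cardh: "card (h ` J) = card J" if "J \<subseteq> S" for J
    using inj that by (meson card_image inj_on_subset)
  define g where "g = inv_into S h"
  have g: "bij_betw g T S" "\<And>y. y \<in> T \<Longrightarrow> h (g y) = y" "\<And>x. x \<in> S \<Longrightarrow> g (h x) = x"
    using h(1) im unfolding g_def by (auto simp: bij_betw_inv_into f_inv_into_f inv_into_f_f[OF inj])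
  have hg: "h ` g ` J = J" if "J \<subseteq> T" for J using g(2) that by (force simp: image_image)
  have gh: "g ` h ` J = J" if "J \<subseteq> S" for J using g(3) that by (force simp: image_image)
  have cardg: "card (g ` J) = card J" if "J \<subseteq> T" for J
    using g(1) that by (meson bij_betw_def card_image inj_on_subset)
  have "A_op V E t K T = (\<Sum>p\<in>covers t T. K p)"
    using T box_subset_indep_upto by (intro A_op_covers[of _ n]) blast
  also have "\<dots> = (\<Sum>(J, J')\<in>covers t S. K (T \<inter> \<Union>(U ` J), T \<inter> \<Union>(U ` J')))"
  proof (rule sum.reindex_bij_witness[where i = "map_prod (image h) (image h)" and j = "map_prod (image g) (image g)"])
    fix p assume p: "p \<in> covers t T"
    then obtain J J' where J: "p = (J, J')" "J \<subseteq> T" "J' \<subseteq> T" "card J \<le> t" "card J' \<le> t" "J \<union> J' = T"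
      by (auto simp: covers_def)
    show "map_prod (image h) (image h) (map_prod (image g) (image g) p) = p"
      using J by (simp add: hg)
    have gJ: "g ` J \<subseteq> S" "g ` J' \<subseteq> S" "g ` J \<union> g ` J' = S"
      using g(1) J by (auto simp: bij_betw_def)
    then show "map_prod (image g) (image g) p \<in> covers t S"
      using J by (simp add: covers_def cardg)
    show "(case map_prod (image g) (image g) p of (J, J') \<Rightarrow> K (T \<inter> \<Union>(U ` J), T \<inter> \<Union>(U ` J'))) = K p"
      by (simp only: J(1) map_prod_simp prod.case r[OF gJ(1)] r[OF gJ(2)] hg[OF J(2)] hg[OF J(3)])
  next
    fix p assume "p \<in> covers t S"
    then obtain J J' where J: "p = (J, J')" "J \<subseteq> S" "J' \<subseteq> S" "card J \<le> t" "card J' \<le> t" "J \<union> J' = S"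
      by (auto simp: covers_def)
    show "map_prod (image g) (image g) (map_prod (image h) (image h) p) = p"
      using J by (simp add: gh)
    have "h ` J \<subseteq> T" "h ` J' \<subseteq> T" "h ` J \<union> h ` J' = T" using J im by auto
    then show "map_prod (image h) (image h) p \<in> covers t T"
      using J by (simp add: covers_def cardh)
  qed
  finally show ?thesis .
qed

text \<open>Within the box, \<open>T\<close> is the disjoint union of its parts in the open sets \<open>A = \<Union>(U ` J)\<close> and
  \<open>B = \<Union>(U ` (S - J))\<close>, so conditions on \<open>T \<inter> A\<close> are open conditions on \<open>T\<close>.\<close>

lemma continuous_map_restrict_box:
  assumes t: "t \<ge> 1" and S: "finite S" and U: "clique_box S U" and J: "J \<subseteq> S" "card J \<le> t"
  shows "continuous_map (subtopology (indep_space V E n) (box n S U)) (indep_space V E t) (\<lambda>T. T \<inter> \<Union>(U ` J))"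
proof (rule continuous_map_into_indep_space[OF t])
  let ?Y = "subtopology (indep_space V E n) (box n S U)"
  have top: "topspace ?Y = box n S U" using box_subset_indep_upto[of n S U] by auto
  fix T assume "T \<in> topspace ?Y"
  then have T: "T \<in> box n S U" using top by simp
  obtain h where h: "bij_betw h S T" "\<forall>x\<in>S. T \<inter> U x = {h x}"
    using box_transversal[OF U T] by blast
  have "card (T \<inter> \<Union>(U ` J)) \<le> t"
    unfolding box_Int_Union[OF h(2) J(1)] using J card_image_le[of J h] finite_subset[OF J(1) S] by simp
  moreover have "finite T" "independent_set V E T" using T by (auto simp: box_def indep_upto_iff)
  ultimately show "T \<inter> \<Union>(U ` J) \<in> indep_upto V E t"
    by (auto simp: indep_upto_iff intro: independent_subset)
next
  let ?Y = "subtopology (indep_space V E n) (box n S U)"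
  define A where "A = \<Union>(U ` J)"
  define B where "B = \<Union>(U ` (S - J))"
  have top: "topspace ?Y = box n S U" using box_subset_indep_upto[of n S U] by auto
  have A: "openin V A" and B: "openin V B"
    using U J unfolding A_def B_def clique_box_def by (auto intro!: openin_Union)
  have dis: "A \<inter> B = {}" using U J unfolding A_def B_def clique_box_def by fastforce
  have cov: "T \<subseteq> A \<union> B" if "T \<in> box n S U" for T
    using that J unfolding box_def A_def B_def by blast
  fix W assume W: "openin V W"
  have "{T \<in> topspace ?Y. T \<inter> A \<subseteq> W} = {T \<in> indep_upto V E n. T \<subseteq> (W \<inter> A) \<union> B} \<inter> box n S U"
    unfolding top using cov dis box_subset_indep_upto[of n S U] by blast
  then show "openin ?Y {T \<in> topspace ?Y. T \<inter> \<Union>(U ` J) \<subseteq> W}"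
    unfolding A_def[symmetric] openin_subtopology
    using openin_indep_space_subset[of "(W \<inter> A) \<union> B" n] A B W by blast
  have "{T \<in> topspace ?Y. T \<inter> A \<inter> W \<noteq> {}} = {T \<in> indep_upto V E n. T \<inter> (A \<inter> W) \<noteq> {}} \<inter> box n S U"
    unfolding top using box_subset_indep_upto[of n S U] by blast
  then show "openin ?Y {T \<in> topspace ?Y. T \<inter> \<Union>(U ` J) \<inter> W \<noteq> {}}"
    unfolding A_def[symmetric] openin_subtopology
    using openin_indep_space_meets[of "A \<inter> W" n] A W by blast
qed

lemma continuous_map_A_op:
  assumes t: "t \<ge> 1"
    and K: "continuous_map (prod_topology (indep_space V E t) (indep_space V E t)) euclideanreal K"
  shows "continuous_map (indep_space V E n) euclideanreal (A_op V E t K)"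
proof -
  let ?X = "indep_space V E n"
  have local: "continuous_map (subtopology ?X (box n S U)) euclideanreal (A_op V E t K)"
    if S: "finite S" and U: "clique_box S U" for S U
  proof -
    have "continuous_map (subtopology ?X (box n S U)) euclideanreal
        (\<lambda>T. \<Sum>(J, J')\<in>covers t S. K (T \<inter> \<Union>(U ` J), T \<inter> \<Union>(U ` J')))"
    proof (intro continuous_map_sum finite_covers S, clarify)
      fix J J' assume "(J, J') \<in> covers t S"
      then have J: "J \<subseteq> S" "card J \<le> t" "J' \<subseteq> S" "card J' \<le> t" by (auto simp: covers_def)
      have "continuous_map (subtopology ?X (box n S U)) (prod_topology (indep_space V E t) (indep_space V E t))
          (\<lambda>T. (T \<inter> \<Union>(U ` J), T \<inter> \<Union>(U ` J')))"
        by (intro continuous_map_pairedI continuous_map_restrict_box[OF t S U] J)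
      from continuous_map_compose[OF this K]
      show "continuous_map (subtopology ?X (box n S U)) euclideanreal (\<lambda>T. K (T \<inter> \<Union>(U ` J), T \<inter> \<Union>(U ` J')))"
        by (simp add: o_def)
    qed
    then show ?thesis
      by (rule continuous_map_eq) (simp add: A_op_box[OF U, where n = n])
  qed
  show ?thesis
    unfolding continuous_map_def
  proof (intro conjI allI impI)
    fix W :: "real set" assume W: "openin euclideanreal W"
    show "openin ?X {S \<in> topspace ?X. A_op V E t K S \<in> W}"
    proof (subst openin_subopen, intro ballI)
      fix S assume S: "S \<in> {S \<in> topspace ?X. A_op V E t K S \<in> W}"
      then obtain U where U: "clique_box S U" using clique_box_exists by auto
      have fin: "finite S" using S by (auto simp: indep_upto_iff)
      let ?B = "box n S U"
      have "openin (subtopology ?X ?B) {T \<in> topspace (subtopology ?X ?B). A_op V E t K T \<in> W}"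
        by (rule openin_continuous_map_preimage[OF local[OF fin U] W])
      then have "openin ?X {T \<in> topspace (subtopology ?X ?B). A_op V E t K T \<in> W}"
        using openin_open_subtopology[OF openin_box[OF fin U]] by blast
      moreover have "S \<in> {T \<in> topspace (subtopology ?X ?B). A_op V E t K T \<in> W}"
        using S centre_in_box[OF U] by auto
      ultimately show "\<exists>T. openin ?X T \<and> S \<in> T \<and> T \<subseteq> {S \<in> topspace ?X. A_op V E t K S \<in> W}"
        by (intro exI[of _ "{T \<in> topspace (subtopology ?X ?B). A_op V E t K T \<in> W}"]) auto
    qed
  qed auto
qed

end

section \<open>A Hahn-Banach theorem for spaces of functions\<close>

definition function_space :: "('a \<Rightarrow> real) set \<Rightarrow> bool" where
  "function_space C \<longleftrightarrow> (\<forall>f\<in>C. \<forall>g\<in>C. (\<lambda>x. f x + g x) \<in> C) \<and> (\<forall>f\<in>C. \<forall>c. (\<lambda>x. c * f x) \<in> C)"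

text \<open>Only one inequality of positive homogeneity is demanded; the other one follows by scaling back.\<close>

definition sublinear_on :: "('a \<Rightarrow> real) set \<Rightarrow> (('a \<Rightarrow> real) \<Rightarrow> real) \<Rightarrow> bool" where
  "sublinear_on C q \<longleftrightarrow>
     (\<forall>f\<in>C. \<forall>g\<in>C. q (\<lambda>x. f x + g x) \<le> q f + q g) \<and>
     (\<forall>f\<in>C. \<forall>c>0. q (\<lambda>x. c * f x) \<le> c * q f)"

lemma function_space_closed:
  assumes "function_space C" "f \<in> C"
  shows "(\<lambda>x. c * f x) \<in> C" "(\<lambda>x. - f x) \<in> C" "(\<lambda>x. 0) \<in> C"
    "g \<in> C \<Longrightarrow> (\<lambda>x. f x + c * g x) \<in> C" "g \<in> C \<Longrightarrow> (\<lambda>x. f x + g x) \<in> C"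
proof -
  have *: "(\<lambda>x. c * f x) \<in> C" if "f \<in> C" for c f using assms(1) that by (simp add: function_space_def)
  show "(\<lambda>x. c * f x) \<in> C" by (rule *[OF assms(2)])
  show "(\<lambda>x. - f x) \<in> C" using *[OF assms(2), of "-1"] by simp
  show "(\<lambda>x. 0) \<in> C" using *[OF assms(2), of 0] by simp
  show "g \<in> C \<Longrightarrow> (\<lambda>x. f x + c * g x) \<in> C"  "g \<in> C \<Longrightarrow> (\<lambda>x. f x + g x) \<in> C"
    using * assms by (auto simp: function_space_def)
qed

lemma sublinear_on_properties:
  assumes C: "function_space C" and q: "sublinear_on C q"
  shows "\<And>f c. f \<in> C \<Longrightarrow> 0 \<le> c \<Longrightarrow> q (\<lambda>x. c * f x) = c * q f"
    and "\<And>f. f \<in> C \<Longrightarrow> - q (\<lambda>x. - f x) \<le> q f"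
proof -
  have add: "q (\<lambda>x. f x + g x) \<le> q f + q g" if "f \<in> C" "g \<in> C" for f g
    using q that by (simp add: sublinear_on_def)
  have sc: "q (\<lambda>x. c * f x) \<le> c * q f" if "f \<in> C" "0 < c" for f c
    using q that by (simp add: sublinear_on_def)
  have zero: "q (\<lambda>x. 0) = 0" if f: "f \<in> C" for f
    using add[OF function_space_closed(3)[OF C f] function_space_closed(3)[OF C f]]
      sc[OF function_space_closed(3)[OF C f], of "1/2"] by simp
  show "q (\<lambda>x. c * f x) = c * q f" if f: "f \<in> C" and c: "0 \<le> c" for f c
  proof (cases "c = 0")
    case False
    then have "q f \<le> (1 / c) * q (\<lambda>x. c * f x)"
      using sc[OF function_space_closed(1)[OF C f, of c], of "1 / c"] c by simp
    then have "c * q f \<le> q (\<lambda>x. c * f x)" using False c by (simp add: field_simps)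
    then show ?thesis using sc[OF f, of c] False c by simp
  qed (use zero[OF f] in simp)
  show "- q (\<lambda>x. - f x) \<le> q f" if f: "f \<in> C" for f
    using add[OF f function_space_closed(2)[OF C f]] zero[OF f] by simp
qed

text \<open>The function \<open>q'(f) = inf {q(f + r g) - r q(g) | r \<ge> 0}\<close> is a sublinear function below
  \<open>q\<close> whose value at \<open>-g\<close> is at most \<open>-q(g)\<close>, as \<open>r = 1\<close> shows. It serves twice: to show that minimal sublinear functions are
  linear, and to prescribe the value of the functional at one point.\<close>

lemma sublinear_lower_along:
  assumes C: "function_space C" and q: "sublinear_on C q" and g: "g \<in> C"
  obtains q' where "sublinear_on C q'" "\<And>f. f \<in> C \<Longrightarrow> q' f \<le> q f" "q' (\<lambda>x. - g x) \<le> - q g"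
proof -
  note sub = sublinear_on_properties[OF C q] and clo = function_space_closed[OF C]
  have add: "q (\<lambda>x. f x + h x) \<le> q f + q h" if "f \<in> C" "h \<in> C" for f h
    using q that by (simp add: sublinear_on_def)
  define F where "F f r = q (\<lambda>x. f x + r * g x) - r * q g" for f r
  define q' where "q' f = (INF r\<in>{0..}. F f r)" for f
  have bdd: "bdd_below (F f ` {0..})" if f: "f \<in> C" for f
  proof (rule bdd_belowI2)
    fix r :: real assume r: "r \<in> {0..}"
    have "r * q g = q (\<lambda>x. (f x + r * g x) + - f x)" using sub(1)[OF g, of r] r by simp
    also have "\<dots> \<le> q (\<lambda>x. f x + r * g x) + q (\<lambda>x. - f x)"
      using f g by (intro add clo)
    finally show "- q (\<lambda>x. - f x) \<le> F f r" by (simp add: F_def)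
  qed
  have le: "q' f \<le> F f r" if "f \<in> C" "0 \<le> r" for f r
    unfolding q'_def using that bdd by (intro cINF_lower) auto
  have ge: "z \<le> q' f" if "\<And>r. 0 \<le> r \<Longrightarrow> z \<le> F f r" for z f
    unfolding q'_def using that by (intro cINF_greatest) auto
  have "sublinear_on C q'"
    unfolding sublinear_on_def
  proof (intro conjI ballI allI impI)
    fix f h assume f: "f \<in> C" and h: "h \<in> C"
    have *: "q' (\<lambda>x. f x + h x) \<le> F f r + F h s" if "0 \<le> r" "0 \<le> s" for r s
    proof -
      have "q' (\<lambda>x. f x + h x) \<le> F (\<lambda>x. f x + h x) (r + s)"
        using f h that by (intro le clo) auto
      also have "\<dots> = q (\<lambda>x. (f x + r * g x) + (h x + s * g x)) - (r + s) * q g"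
        by (simp add: F_def algebra_simps)
      also have "\<dots> \<le> q (\<lambda>x. f x + r * g x) + q (\<lambda>x. h x + s * g x) - (r + s) * q g"
        using add[of "\<lambda>x. f x + r * g x" "\<lambda>x. h x + s * g x"] clo(4)[OF f g] clo(4)[OF h g] by simp
      finally show ?thesis by (simp add: F_def algebra_simps)
    qed
    have "q' (\<lambda>x. f x + h x) - F h s \<le> q' f" if "0 \<le> s" for s
    proof (rule ge)
      fix r :: real assume "0 \<le> r"
      from *[OF this that] show "q' (\<lambda>x. f x + h x) - F h s \<le> F f r" by simp
    qed
    then have **: "q' (\<lambda>x. f x + h x) - q' f \<le> F h s" if "0 \<le> s" for s
      using that by (simp add: algebra_simps)
    have "q' (\<lambda>x. f x + h x) - q' f \<le> q' h" by (rule ge[OF **])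
    then show "q' (\<lambda>x. f x + h x) \<le> q' f + q' h" by simp
  next
    fix f and c :: real assume f: "f \<in> C" and c: "0 < c"
    have "(1 / c) * q' (\<lambda>x. c * f x) \<le> q' f"
    proof (rule ge)
      fix r :: real assume r: "0 \<le> r"
      have "q' (\<lambda>x. c * f x) \<le> F (\<lambda>x. c * f x) (c * r)"
        using f c r by (intro le clo) auto
      also have "\<dots> = q (\<lambda>x. c * (f x + r * g x)) - c * r * q g"
        by (simp add: F_def algebra_simps)
      also have "\<dots> = c * F f r"
        using sub(1)[OF clo(4)[OF f g], of c r] c by (simp add: F_def algebra_simps)
      finally show "(1 / c) * q' (\<lambda>x. c * f x) \<le> F f r" using c by (simp add: field_simps)
    qed
    then show "q' (\<lambda>x. c * f x) \<le> c * q' f" using c by (simp add: field_simps)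
  qed
  moreover have "q' f \<le> q f" if "f \<in> C" for f using le[OF that, of 0] by (simp add: F_def)
  moreover have "q' (\<lambda>x. - g x) \<le> - q g"
    using le[OF clo(2)[OF g], of 1] sub(1)[OF g, of 0] by (simp add: F_def)
  ultimately show ?thesis using that by blast
qed

text \<open>Zorn's lemma. The pointwise infimum of a chain is again sublinear, and \<open>q(f) \<ge> -q(-f) \<ge> -p(-f)\<close>
  keeps it finite.\<close>

lemma minimal_sublinear_exists:
  assumes C: "function_space C" and p: "sublinear_on C p"
  obtains m where "sublinear_on C m" "\<And>f. f \<in> C \<Longrightarrow> m f \<le> p f"
    "\<And>q f. sublinear_on C q \<Longrightarrow> (\<And>f. f \<in> C \<Longrightarrow> q f \<le> m f) \<Longrightarrow> f \<in> C \<Longrightarrow> q f = m f"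
proof -
  \<comment> \<open>setting the functions to 0 outside \<open>C\<close> makes the pointwise order on \<open>C\<close> antisymmetric\<close>
  define A where "A = {q. sublinear_on C q \<and> (\<forall>f\<in>C. q f \<le> p f) \<and> (\<forall>f. f \<notin> C \<longrightarrow> q f = 0)}"
  define P where "P q q' \<longleftrightarrow> (\<forall>f. q' f \<le> q f)" for q q' :: "('a \<Rightarrow> real) \<Rightarrow> real"
  define trunc where "trunc q f = (if f \<in> C then q f else 0)" for q :: "('a \<Rightarrow> real) \<Rightarrow> real" and f
  note clo = function_space_closed[OF C]
  have trunc: "sublinear_on C (trunc q)" if "sublinear_on C q" for q
    using that clo(1,5) by (auto simp: sublinear_on_def trunc_def)
  have po: "partial_order_on A (relation_of P A)"
    by (rule partial_order_on_relation_ofI) (auto simp: P_def fun_eq_iff intro: order_trans antisym)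
  have "\<exists>m\<in>A. \<forall>a\<in>A. P m a \<longrightarrow> a = m"
  proof (rule predicate_Zorn[OF po])
    fix Ch assume Ch: "Ch \<in> Chains (relation_of P A)"
    then have ChA: "Ch \<subseteq> A" and tot: "\<And>q q'. q \<in> Ch \<Longrightarrow> q' \<in> Ch \<Longrightarrow> P q q' \<or> P q' q"
      unfolding Chains_def relation_of_def by auto
    show "\<exists>u\<in>A. \<forall>a\<in>Ch. P a u"
    proof (cases "Ch = {}")
      case True
      have "trunc p \<in> A" using trunc[OF p] by (auto simp: A_def trunc_def)
      then show ?thesis using True by blast
    next
      case False
      define u where "u f = (INF q\<in>Ch. q f)" for f
      have bdd: "bdd_below ((\<lambda>q. q f) ` Ch)" for f
      proof (rule bdd_belowI2)
        fix q assume q: "q \<in> Ch"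
        show "min 0 (- p (\<lambda>x. - f x)) \<le> q f"
        proof (cases "f \<in> C")
          case True
          then have "- p (\<lambda>x. - f x) \<le> - q (\<lambda>x. - f x)"
            using q ChA clo(2)[OF True] by (auto simp: A_def)
          also have "\<dots> \<le> q f" using q ChA sublinear_on_properties(2)[OF C _ True] by (auto simp: A_def)
          finally show ?thesis by simp
        next
          case False
          then show ?thesis using q ChA by (auto simp: A_def)
        qed
      qed
      have le: "u f \<le> q f" if "q \<in> Ch" for q f
        unfolding u_def using that bdd by (intro cINF_lower)
      have ge: "z \<le> u f" if "\<And>q. q \<in> Ch \<Longrightarrow> z \<le> q f" for z f
        unfolding u_def using that False by (intro cINF_greatest)
      have "sublinear_on C u"
        unfolding sublinear_on_def
      proof (intro conjI ballI allI impI)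
        fix f g assume f: "f \<in> C" and g: "g \<in> C"
        have *: "u (\<lambda>x. f x + g x) \<le> q f + q' g" if qq: "q \<in> Ch" "q' \<in> Ch" for q q'
        proof -
          obtain r where r: "r \<in> Ch" "r f \<le> q f" "r g \<le> q' g"
            using tot[OF qq] qq by (auto simp: P_def)
          have "u (\<lambda>x. f x + g x) \<le> r (\<lambda>x. f x + g x)" by (rule le[OF r(1)])
          also have "\<dots> \<le> r f + r g" using r(1) ChA f g by (auto simp: A_def sublinear_on_def)
          finally show ?thesis using r by simp
        qed
        have "u (\<lambda>x. f x + g x) - q' g \<le> u f" if "q' \<in> Ch" for q'
          by (rule ge) (use *[OF _ that] in \<open>simp add: algebra_simps\<close>)
        then have "u (\<lambda>x. f x + g x) - u f \<le> u g"
          by (intro ge) (simp add: algebra_simps)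
        then show "u (\<lambda>x. f x + g x) \<le> u f + u g" by simp
      next
        fix f and c :: real assume f: "f \<in> C" and c: "0 < c"
        have "(1 / c) * u (\<lambda>x. c * f x) \<le> u f"
        proof (rule ge)
          fix q assume q: "q \<in> Ch"
          have "u (\<lambda>x. c * f x) \<le> q (\<lambda>x. c * f x)" by (rule le[OF q])
          also have "\<dots> \<le> c * q f" using q ChA f c by (auto simp: A_def sublinear_on_def)
          finally show "(1 / c) * u (\<lambda>x. c * f x) \<le> q f" using c by (simp add: field_simps)
        qed
        then show "u (\<lambda>x. c * f x) \<le> c * u f" using c by (simp add: field_simps)
      qed
      moreover obtain q where q: "q \<in> Ch" using False by blast
      have "\<forall>f\<in>C. u f \<le> p f"
        using le[OF q] q ChA unfolding A_def by (blast intro: order_trans)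
      moreover have "u f = 0" if "f \<notin> C" for f
      proof -
        have "(\<lambda>q. q f) ` Ch = {0}" using that ChA q by (force simp: A_def)
        then show ?thesis by (simp add: u_def)
      qed
      ultimately have "u \<in> A" by (simp add: A_def)
      then show ?thesis using le by (auto simp: P_def)
    qed
  qed
  then obtain m where m: "m \<in> A" "\<And>a. a \<in> A \<Longrightarrow> P m a \<Longrightarrow> a = m" by blast
  show ?thesis
  proof
    show "sublinear_on C m" "\<And>f. f \<in> C \<Longrightarrow> m f \<le> p f" using m(1) by (auto simp: A_def)
    fix q f assume q: "sublinear_on C q" "\<And>f. f \<in> C \<Longrightarrow> q f \<le> m f" and f: "f \<in> C"
    have mp: "\<And>f. f \<in> C \<Longrightarrow> m f \<le> p f" "\<And>f. f \<notin> C \<Longrightarrow> m f = 0" using m(1) by (auto simp: A_def)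
    have "trunc q \<in> A"
      using trunc[OF q(1)] q(2) mp(1) unfolding A_def trunc_def by (auto intro: order_trans)
    moreover have "P m (trunc q)" using q(2) mp(2) by (auto simp: P_def trunc_def)
    ultimately have "trunc q = m" by (rule m(2))
    then show "q f = m f" using f by (auto simp: trunc_def)
  qed
qed

text \<open>A minimal sublinear function \<open>l\<close> cannot be lowered along any \<open>g\<close>, so \<open>l(-g) = -l(g)\<close>, and this
  together with subadditivity is linearity. Lowering \<open>p\<close> along \<open>b\<close> before passing to a minimal function
  forces \<open>l(-b) \<le> -p(b)\<close>, that is, \<open>l(b) \<ge> p(b)\<close>.\<close>

theorem Hahn_Banach_touching:
  assumes C: "function_space C" and p: "sublinear_on C p" and b: "b \<in> C"
  obtains l where "\<And>f g. f \<in> C \<Longrightarrow> g \<in> C \<Longrightarrow> l (\<lambda>x. f x + g x) = l f + l g"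
    "\<And>c f. f \<in> C \<Longrightarrow> l (\<lambda>x. c * f x) = c * l f"
    "\<And>f. f \<in> C \<Longrightarrow> l f \<le> p f" "l b = p b"
proof -
  note clo = function_space_closed[OF C]
  obtain p' where p': "sublinear_on C p'" "\<And>f. f \<in> C \<Longrightarrow> p' f \<le> p f" "p' (\<lambda>x. - b x) \<le> - p b"
    using sublinear_lower_along[OF C p b] by blast
  obtain l where l: "sublinear_on C l" "\<And>f. f \<in> C \<Longrightarrow> l f \<le> p' f"
    "\<And>q f. sublinear_on C q \<Longrightarrow> (\<And>f. f \<in> C \<Longrightarrow> q f \<le> l f) \<Longrightarrow> f \<in> C \<Longrightarrow> q f = l f"
    using minimal_sublinear_exists[OF C p'(1)] by blast
  note sub = sublinear_on_properties[OF C l(1)]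
  have add: "l (\<lambda>x. f x + h x) \<le> l f + l h" if "f \<in> C" "h \<in> C" for f h
    using l(1) that by (simp add: sublinear_on_def)
  have neg: "l (\<lambda>x. - g x) = - l g" if g: "g \<in> C" for g
  proof -
    obtain q where q: "sublinear_on C q" "\<And>f. f \<in> C \<Longrightarrow> q f \<le> l f" "q (\<lambda>x. - g x) \<le> - l g"
      using sublinear_lower_along[OF C l(1) g] by blast
    have "q (\<lambda>x. - g x) = l (\<lambda>x. - g x)" using l(3)[OF q(1,2) clo(2)[OF g]] by blast
    then show ?thesis using q(3) sub(2)[OF g] by simp
  qed
  show ?thesis
  proof
    show "l (\<lambda>x. f x + g x) = l f + l g" if f: "f \<in> C" and g: "g \<in> C" for f g
    proof (rule antisym)
      show "l (\<lambda>x. f x + g x) \<le> l f + l g" by (rule add[OF f g])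
      show "l f + l g \<le> l (\<lambda>x. f x + g x)"
        using add[OF clo(5)[OF f g] clo(2)[OF g]] neg[OF g] by simp
    qed
    show "l (\<lambda>x. c * f x) = c * l f" if f: "f \<in> C" for c f
    proof (cases "0 \<le> c")
      case True then show ?thesis by (rule sub(1)[OF f])
    next
      case False
      then have "l (\<lambda>x. (- c) * f x) = (- c) * l f" by (intro sub(1)[OF f]) simp
      then show ?thesis using neg[OF clo(1)[OF f, of c]] by simp
    qed
    show lp: "l f \<le> p f" if "f \<in> C" for f using l(2) p'(2) that by (meson order_trans)
    show "l b = p b"
      using lp[OF b] neg[OF b] l(2)[OF clo(2)[OF b]] p'(3) by simp
  qed
qed

section \<open>Positive semidefinite kernels\<close>

lemma psd_kernels_zero: "(\<lambda>p. 0) \<in> psd_kernels X"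
  by (simp add: psd_kernels_def sym_kernels_def)

lemma psd_kernels_add:
  assumes "K \<in> psd_kernels X" "K' \<in> psd_kernels X"
  shows "(\<lambda>p. K p + K' p) \<in> psd_kernels X"
proof -
  have "0 \<le> (\<Sum>i<m. \<Sum>j<m. c i * c j * (K (x i, x j) + K' (x i, x j)))"
    if x: "\<forall>i<m. x i \<in> topspace X" for m :: nat and x :: "nat \<Rightarrow> 'a" and c :: "nat \<Rightarrow> real"
  proof -
    have "0 \<le> (\<Sum>i<m. \<Sum>j<m. c i * c j * K (x i, x j))" "0 \<le> (\<Sum>i<m. \<Sum>j<m. c i * c j * K' (x i, x j))"
      using assms x by (auto simp: psd_kernels_def)
    then show ?thesis by (simp add: distrib_left sum.distrib)
  qed
  then show ?thesis using assms by (auto simp: psd_kernels_def sym_kernels_def continuous_map_add)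
qed

lemma psd_kernels_scale:
  assumes "K \<in> psd_kernels X" "0 \<le> a"
  shows "(\<lambda>p. a * K p) \<in> psd_kernels X"
proof -
  have "0 \<le> (\<Sum>i<m. \<Sum>j<m. c i * c j * (a * K (x i, x j)))"
    if x: "\<forall>i<m. x i \<in> topspace X" for m :: nat and x :: "nat \<Rightarrow> 'a" and c :: "nat \<Rightarrow> real"
  proof -
    have "0 \<le> a * (\<Sum>i<m. \<Sum>j<m. c i * c j * K (x i, x j))"
      using assms x by (auto simp: psd_kernels_def)
    then show ?thesis by (simp add: sum_distrib_left mult.left_commute)
  qed
  then show ?thesis using assms by (auto simp: psd_kernels_def sym_kernels_def continuous_map_real_mult_left)
qed

lemma psd_kernels_diagonal:
  assumes "K \<in> psd_kernels X" "x \<in> topspace X" shows "0 \<le> K (x, x)"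
proof -
  have "\<forall>(m :: nat) (y :: nat \<Rightarrow> 'a) (c :: nat \<Rightarrow> real). (\<forall>i<m. y i \<in> topspace X) \<longrightarrow>
      0 \<le> (\<Sum>i<m. \<Sum>j<m. c i * c j * K (y i, y j))"
    using assms(1) by (simp add: psd_kernels_def)
  from this[rule_format, of 1 "\<lambda>_. x" "\<lambda>_. 1"] assms(2) show ?thesis by simp
qed

lemma psd_kernels_rank_one:
  assumes \<phi>: "continuous_map X euclideanreal \<phi>"
  shows "(\<lambda>(x, y). \<phi> x * \<phi> y) \<in> psd_kernels X"
proof -
  have "continuous_map (prod_topology X X) euclideanreal (\<lambda>p. \<phi> (fst p) * \<phi> (snd p))"
    using continuous_map_compose[OF continuous_map_fst \<phi>] continuous_map_compose[OF continuous_map_snd \<phi>]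
    by (intro continuous_map_real_mult) (auto simp: o_def)
  moreover have "(\<Sum>i<m. \<Sum>j<m. c i * c j * (\<phi> (x i) * \<phi> (x j))) = (\<Sum>i<m. c i * \<phi> (x i))\<^sup>2"
    for m :: nat and x :: "nat \<Rightarrow> 'a" and c :: "nat \<Rightarrow> real"
    by (simp add: power2_eq_square sum_product mult_ac)
  ultimately show ?thesis by (simp add: psd_kernels_def sym_kernels_def case_prod_unfold mult.commute)
qed

lemma bump_function:
  assumes X: "compact_space X" "Hausdorff_space X" and W: "openin X W" and x: "x \<in> W"
  obtains f where "continuous_map X euclideanreal f" "\<And>y. y \<in> topspace X \<Longrightarrow> 0 \<le> f y \<and> f y \<le> 1"
    "f x = (1::real)" "\<And>y. y \<in> topspace X \<Longrightarrow> y \<notin> W \<Longrightarrow> f y = 0"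
proof -
  have xX: "x \<in> topspace X" using openin_subset[OF W] x by blast
  have "closedin X {x}" using X(2) xX by (simp add: closedin_Hausdorff_sing_eq)
  moreover have "closedin X (topspace X - W)" using W by blast
  moreover have "disjnt (topspace X - W) {x}" using x by simp
  moreover have "normal_space X" using X compact_Hausdorff_or_regular_imp_normal_space by blast
  ultimately obtain f where f: "continuous_map X (top_of_set {0..1::real}) f"
      "f ` (topspace X - W) \<subseteq> {0}" "f ` {x} \<subseteq> {1}"
    using Urysohn_lemma[of X "topspace X - W" "{x}" 0 1] by auto
  show ?thesis
    using f by (intro that[of f]) (auto simp: continuous_map_in_subtopology)
qed

section \<open>A strictly feasible kernel for the dual problem\<close>

context compact_packing_graph
begin

lemma A_op_add:
  "S \<in> indep_upto V E n \<Longrightarrow> A_op V E t (\<lambda>p. K p + K' p) S = A_op V E t K S + A_op V E t K' S"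
  by (simp add: A_op_covers sum.distrib)

lemma A_op_scale:
  "S \<in> indep_upto V E n \<Longrightarrow> A_op V E t (\<lambda>p. c * K p) S = c * A_op V E t K S"
  by (simp add: A_op_covers sum_distrib_left)

lemma A_op_swap:
  assumes "S \<in> indep_upto V E n" shows "A_op V E t (\<lambda>p. K (prod.swap p)) S = A_op V E t K S"
  unfolding A_op_covers[OF assms]
  by (rule sum.reindex_bij_witness[where i = prod.swap and j = prod.swap])
     (auto simp: covers_def Un_commute)

lemma covers_empty: "covers t {} = {({}, {})}"
  by (auto simp: covers_def)

lemma A_op_empty: "A_op V E t K {} = K ({}, {})"
  by (simp add: A_op_covers[OF empty_in_indep_upto[of 0]] covers_empty)

lemma covers_indep_upto:
  assumes "S \<in> indep_upto V E n" "(J, J') \<in> covers t S"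
  shows "J \<in> indep_upto V E t" "J' \<in> indep_upto V E t" "J \<union> J' = S" "independent_set V E (J \<union> J')"
  using assms by (auto simp: covers_def indep_upto_iff intro: finite_subset independent_subset)

lemma singleton_empty_eq_card: "{{}} = {S \<in> indep_upto V E n. card S = 0}"
  using empty_in_indep_upto[of n] by (auto simp: indep_upto_iff)

text \<open>Take a bump \<open>f\<close> with \<open>f(S0) = 1\<close> on a box around \<open>S0\<close>, the indicator \<open>g\<close> of \<open>{\<emptyset>}\<close>, and the
  rank-one kernel of \<open>2g - f\<close>. A pair \<open>(J, J')\<close> of different nonempty sets contributes nothing, so for
  nonempty \<open>S\<close> with at most \<open>t\<close> elements only \<open>(S, S)\<close>, \<open>(S, \<emptyset>)\<close> and \<open>(\<emptyset>, S)\<close> remain, with total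
  \<open>f(S)\<^sup>2 - 4 f(S) \<le> 0\<close>; this is \<open>-3\<close> at \<open>S0\<close>.\<close>

lemma kernel_near_small_set:
  assumes t: "t \<ge> 1" and S0: "S0 \<in> indep_upto V E t" "S0 \<noteq> {}"
  obtains K where "K \<in> psd_kernels (indep_space V E t)" "A_op V E t K S0 \<le> - 2"
    "\<And>S. S \<in> indep_upto V E n - {{}} \<Longrightarrow> A_op V E t K S \<le> 0"
proof -
  let ?I = "indep_space V E t"
  note I = compact_indep_space[OF t] Hausdorff_indep_space[of t]
  obtain U where U: "clique_box S0 U" using clique_box_exists[OF S0(1)] by blast
  have fin: "finite S0" using S0 by (simp add: indep_upto_iff)
  obtain f where f: "continuous_map ?I euclideanreal f"
      "\<And>S. S \<in> indep_upto V E t \<Longrightarrow> 0 \<le> f S \<and> f S \<le> 1" "f S0 = 1"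
      "\<And>S. S \<in> indep_upto V E t \<Longrightarrow> S \<notin> box t S0 U \<Longrightarrow> f S = 0"
    using bump_function[OF I openin_box[OF fin U] centre_in_box[OF U S0(1)]] by auto
  have e: "openin ?I {{}}"
    unfolding singleton_empty_eq_card[of t] by (rule openin_indep_space_card)
  obtain g where g: "continuous_map ?I euclideanreal g"
      "\<And>S. S \<in> indep_upto V E t \<Longrightarrow> 0 \<le> g S \<and> g S \<le> 1" "g {} = 1"
      "\<And>S. S \<in> indep_upto V E t \<Longrightarrow> S \<noteq> {} \<Longrightarrow> g S = 0"
    using bump_function[OF I e, of "{}"] by auto
  have f_empty: "f {} = 0"
    by (rule f(4)) (use S0 in \<open>auto simp: box_def\<close>)
  define \<phi> where "\<phi> S = 2 * g S - f S" for S
  have \<phi>: "continuous_map ?I euclideanreal \<phi>"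
    unfolding \<phi>_def by (intro continuous_map_diff continuous_map_real_mult_left f g)
  define K where "K = (\<lambda>(J, J'). \<phi> J * \<phi> J')"
  have K: "K \<in> psd_kernels ?I" unfolding K_def by (rule psd_kernels_rank_one[OF \<phi>])
  have \<phi>_empty: "\<phi> {} = 2" using g(3) f_empty by (simp add: \<phi>_def)
  have \<phi>_ne: "\<phi> J = - f J" if "J \<in> indep_upto V E t" "J \<noteq> {}" for J
    using g(4)[OF that] by (simp add: \<phi>_def)
  have other: "K (J, J') = 0"
    if S: "S \<in> indep_upto V E n" and c: "(J, J') \<in> covers t S" and ne: "J \<noteq> {}" "J' \<noteq> {}" "J \<noteq> J'" for S J J' n
  proof -
    note J = covers_indep_upto[OF S c]
    have "\<not> (J \<in> box t S0 U \<and> J' \<in> box t S0 U)" using box_eqI[OF U] J(4) ne(3) by blast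
    then have "f J = 0 \<or> f J' = 0" using f(4) J(1,2) by blast
    then show ?thesis using \<phi>_ne[OF J(1) ne(1)] \<phi>_ne[OF J(2) ne(2)] by (auto simp: K_def)
  qed
  have val: "A_op V E t K S = (if card S \<le> t then (f S)\<^sup>2 - 4 * f S else 0)"
    if S: "S \<in> indep_upto V E n" "S \<noteq> {}" for S n
  proof (cases "card S \<le> t")
    case True
    have finS: "finite S" using S by (simp add: indep_upto_iff)
    have St: "S \<in> indep_upto V E t" using S True by (simp add: indep_upto_iff)
    have "(\<Sum>p\<in>covers t S. K p) = (\<Sum>p\<in>{(S, S), (S, {}), ({}, S)}. K p)"
    proof (rule sum.mono_neutral_right[OF finite_covers[OF finS]])
      show "{(S, S), (S, {}), ({}, S)} \<subseteq> covers t S" using True by (auto simp: covers_def)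
      show "\<forall>p\<in>covers t S - {(S, S), (S, {}), ({}, S)}. K p = 0"
      proof
        fix p assume p: "p \<in> covers t S - {(S, S), (S, {}), ({}, S)}"
        obtain J J' where J: "p = (J, J')" by (cases p)
        then have "(J, J') \<in> covers t S" using p by simp
        moreover have "J \<noteq> {}" "J' \<noteq> {}" "J \<noteq> J'" using p J by (auto simp: covers_def)
        ultimately show "K p = 0" unfolding J by (rule other[OF S(1)])
      qed
    qed
    also have "\<dots> = (f S)\<^sup>2 - 4 * f S"
      using S(2) by (simp add: K_def \<phi>_empty \<phi>_ne[OF St S(2)] power2_eq_square)
    finally show ?thesis using True by (simp add: A_op_covers[OF S(1)])
  next
    case False
    have "K p = 0" if p: "p \<in> covers t S" for p
    proof -
      obtain J J' where J: "p = (J, J')" by (cases p)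
      have "J \<noteq> {}" "J' \<noteq> {}" "J \<noteq> J'" using p J False by (auto simp: covers_def)
      then show ?thesis using other[OF S(1)] p J by simp
    qed
    then show ?thesis using False by (simp add: A_op_covers[OF S(1)])
  qed
  show ?thesis
  proof (rule that[OF K])
    show "A_op V E t K S0 \<le> - 2"
      using val[OF S0] S0(1) f(3) by (simp add: indep_upto_iff)
    fix S assume S: "S \<in> indep_upto V E n - {{}}"
    show "A_op V E t K S \<le> 0"
    proof (cases "card S \<le> t")
      case True
      then have "S \<in> indep_upto V E t" using S by (simp add: indep_upto_iff)
      then have "0 \<le> f S" "f S \<le> 1" using f(2) by auto
      then have "f S * f S \<le> 1 * f S" by (intro mult_right_mono)
      then show ?thesis using val[of S n] S True \<open>0 \<le> f S\<close> by (simp add: power2_eq_square)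
    qed (use val[of S n] S in simp)
  qed
qed

text \<open>Write \<open>S0 = J1 \<union> J2\<close> with \<open>J1\<close>, \<open>J2\<close> of size at most \<open>t\<close>, and take bumps \<open>f\<close> and \<open>g\<close> on boxes around \<open>J1\<close>
  and \<open>J2\<close>. For sets \<open>S\<close> with more than \<open>t\<close> elements a cover \<open>(J, J')\<close> has \<open>J \<noteq> J'\<close>, which kills
  the products \<open>f(J) f(J')\<close> and \<open>g(J) g(J')\<close>. Only the mixed terms of the rank-one kernel of \<open>2g - f\<close> are left,
  and they are nonpositive. On smaller sets the kernel may have a positive image.\<close>

lemma kernel_near_large_set:
  assumes t: "t \<ge> 1" and S0: "S0 \<in> indep_upto V E (2 * t)" "t < card S0"
  obtains K where "K \<in> psd_kernels (indep_space V E t)" "A_op V E t K S0 \<le> - 2"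
    "\<And>S. S \<in> indep_upto V E n \<Longrightarrow> t < card S \<Longrightarrow> A_op V E t K S \<le> 0"
proof -
  let ?I = "indep_space V E t"
  note I = compact_indep_space[OF t] Hausdorff_indep_space[of t]
  have fin: "finite S0" using S0 by (simp add: indep_upto_iff)
  obtain J1 where J1: "J1 \<subseteq> S0" "card J1 = t" using obtain_subset_with_card_n[of t S0] S0(2) by auto
  define J2 where "J2 = S0 - J1"
  have J2: "J2 \<subseteq> S0" "J1 \<union> J2 = S0" using J1 by (auto simp: J2_def)
  have card2: "card J2 \<le> t"
    using S0 J1 fin by (auto simp: J2_def card_Diff_subset finite_subset indep_upto_iff)
  obtain U where U: "clique_box S0 U" using clique_box_exists[OF S0(1)] by blast
  note U1 = clique_box_subset[OF U J1(1)] and U2 = clique_box_subset[OF U J2(1)]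
  have fin12: "finite J1" "finite J2" using fin J1 J2 finite_subset by auto
  have I12: "J1 \<in> indep_upto V E t" "J2 \<in> indep_upto V E t"
    using S0(1) J1 J2 card2 fin12 by (auto simp: indep_upto_iff intro: independent_subset)
  obtain f where f: "continuous_map ?I euclideanreal f"
      "\<And>S. S \<in> indep_upto V E t \<Longrightarrow> 0 \<le> f S \<and> f S \<le> 1" "f J1 = 1"
      "\<And>S. S \<in> indep_upto V E t \<Longrightarrow> S \<notin> box t J1 U \<Longrightarrow> f S = 0"
    using bump_function[OF I openin_box[OF fin12(1) U1] centre_in_box[OF U1 I12(1)]] by auto
  obtain g where g: "continuous_map ?I euclideanreal g"
      "\<And>S. S \<in> indep_upto V E t \<Longrightarrow> 0 \<le> g S \<and> g S \<le> 1" "g J2 = 1"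
      "\<And>S. S \<in> indep_upto V E t \<Longrightarrow> S \<notin> box t J2 U \<Longrightarrow> g S = 0"
    using bump_function[OF I openin_box[OF fin12(2) U2] centre_in_box[OF U2 I12(2)]] by auto
  define \<phi> where "\<phi> S = 2 * g S - f S" for S
  have \<phi>: "continuous_map ?I euclideanreal \<phi>"
    unfolding \<phi>_def by (intro continuous_map_diff continuous_map_real_mult_left f g)
  define K where "K = (\<lambda>(J, J'). \<phi> J * \<phi> J')"
  have K: "K \<in> psd_kernels ?I" unfolding K_def by (rule psd_kernels_rank_one[OF \<phi>])
  have cross: "K (J, J') = - 2 * (g J * f J') - 2 * (f J * g J')" "0 \<le> g J * f J'" "0 \<le> f J * g J'"
    if S: "S \<in> indep_upto V E n" "t < card S" and c: "(J, J') \<in> covers t S" for S J J' n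
  proof -
    note J = covers_indep_upto[OF S(1) c]
    have ne: "J \<noteq> J'" using c S(2) by (auto simp: covers_def)
    have "f J * f J' = 0" using box_eqI[OF U1 _ _ J(4)] ne f(4) J(1,2) by force
    moreover have "g J * g J' = 0" using box_eqI[OF U2 _ _ J(4)] ne g(4) J(1,2) by force
    moreover have "K (J, J') = f J * f J' + 4 * (g J * g J') - 2 * (g J * f J') - 2 * (f J * g J')"
      by (simp add: K_def \<phi>_def algebra_simps)
    ultimately show "K (J, J') = - 2 * (g J * f J') - 2 * (f J * g J')" by linarith
    show "0 \<le> g J * f J'" "0 \<le> f J * g J'" using f(2) g(2) J(1,2) by auto
  qed
  have le0: "K p \<le> 0" if "S \<in> indep_upto V E n" "t < card S" "p \<in> covers t S" for S p n
  proof -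
    obtain J J' where J: "p = (J, J')" by (cases p)
    then have "(J, J') \<in> covers t S" using that(3) by simp
    note cross[OF that(1,2) this]
    then have "K (J, J') \<le> 0" by linarith
    then show ?thesis by (simp only: J)
  qed
  show ?thesis
  proof (rule that[OF K])
    show "A_op V E t K S \<le> 0" if "S \<in> indep_upto V E n" "t < card S" for S
      unfolding A_op_covers[OF that(1)] using le0[OF that] by (intro sum_nonpos)
    have mem: "(J1, J2) \<in> covers t S0" using J1 J2 card2 by (auto simp: covers_def)
    have "A_op V E t K S0 = K (J1, J2) + (\<Sum>p\<in>covers t S0 - {(J1, J2)}. K p)"
      unfolding A_op_covers[OF S0(1)] using mem finite_covers[OF fin] by (simp add: sum.remove)
    also have "\<dots> \<le> K (J1, J2) + 0"
      using le0[OF S0] by (intro add_left_mono sum_nonpos) auto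
    also have "K (J1, J2) \<le> - 2"
      using cross[OF S0 mem] f(3) g(3) by simp
    finally show "A_op V E t K S0 \<le> - 2" by simp
  qed
qed

text \<open>The image of a kernel is continuous, so the bound \<open>-2\<close> at a point gives \<open>-1\<close> on a neighbourhood.
  Finitely many neighbourhoods cover \<open>Q\<close>, and adding their kernels does no damage as all images are
  nonpositive on \<open>R\<close>.\<close>

lemma kernel_on_compact_set:
  assumes t: "t \<ge> 1" and Q: "closedin (indep_space V E n) Q" "n \<ge> 1" and QR: "Q \<subseteq> R" "R \<subseteq> indep_upto V E n"
    and loc: "\<And>S0. S0 \<in> Q \<Longrightarrow> \<exists>K\<in>psd_kernels (indep_space V E t). A_op V E t K S0 \<le> - 2 \<and> (\<forall>S\<in>R. A_op V E t K S \<le> 0)"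
  obtains K where "K \<in> psd_kernels (indep_space V E t)" "\<And>S. S \<in> Q \<Longrightarrow> A_op V E t K S \<le> - 1"
    "\<And>S. S \<in> R \<Longrightarrow> A_op V E t K S \<le> 0"
proof -
  let ?X = "indep_space V E n"
  let ?P = "psd_kernels (indep_space V E t)"
  obtain \<kappa> where \<kappa>: "\<And>S0. S0 \<in> Q \<Longrightarrow> \<kappa> S0 \<in> ?P \<and> A_op V E t (\<kappa> S0) S0 \<le> - 2 \<and> (\<forall>S\<in>R. A_op V E t (\<kappa> S0) S \<le> 0)"
    using loc by metis
  define N where "N S0 = {S \<in> topspace ?X. A_op V E t (\<kappa> S0) S \<in> {..< -1}}" for S0
  have N: "openin ?X (N S0)" if "S0 \<in> Q" for S0
    unfolding N_def
    by (intro openin_continuous_map_preimage[OF continuous_map_A_op[OF t]])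
       (use \<kappa>[OF that] in \<open>auto simp: psd_kernels_def sym_kernels_def\<close>)
  have "compactin ?X Q" using Q compact_indep_space closedin_compact_space by blast
  moreover have "Q \<subseteq> \<Union>(N ` Q)"
  proof
    fix S assume S: "S \<in> Q"
    then have "S \<in> N S" using \<kappa>[OF S] QR by (auto simp: N_def)
    then show "S \<in> \<Union>(N ` Q)" using S by blast
  qed
  moreover have "\<forall>U\<in>N ` Q. openin ?X U" using N by blast
  ultimately have "\<exists>\<F>. finite \<F> \<and> \<F> \<subseteq> N ` Q \<and> Q \<subseteq> \<Union>\<F>"
    unfolding compactin_def by blast
  then obtain F where F: "finite F" "F \<subseteq> Q" "Q \<subseteq> \<Union>(N ` F)"
    by (metis (no_types, lifting) finite_subset_image)
  have "\<exists>K\<in>?P. (\<forall>S\<in>\<Union>(N ` F) \<inter> R. A_op V E t K S \<le> - 1) \<and> (\<forall>S\<in>R. A_op V E t K S \<le> 0)"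
    using F(1,2)
  proof (induction F rule: finite_induct)
    case empty
    have "A_op V E t (\<lambda>p. 0) S = 0" for S by (simp add: A_op_def)
    then show ?case using psd_kernels_zero by (intro bexI[of _ "\<lambda>p. 0"]) auto
  next
    case (insert S0 F)
    then obtain K where K: "K \<in> ?P" "\<forall>S\<in>\<Union>(N ` F) \<inter> R. A_op V E t K S \<le> - 1" "\<forall>S\<in>R. A_op V E t K S \<le> 0"
      by auto
    have S0: "S0 \<in> Q" using insert by simp
    let ?K = "\<lambda>p. K p + \<kappa> S0 p"
    have sum: "A_op V E t ?K S = A_op V E t K S + A_op V E t (\<kappa> S0) S" if "S \<in> R" for S
      using that QR(2) by (intro A_op_add[of _ n]) auto
    have \<kappa>0: "\<forall>S\<in>R. A_op V E t (\<kappa> S0) S \<le> 0" using \<kappa>[OF S0] by blast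
    have "A_op V E t ?K S \<le> - 1" if S: "S \<in> \<Union>(N ` insert S0 F) \<inter> R" for S
    proof (cases "S \<in> N S0")
      case True
      then have "A_op V E t (\<kappa> S0) S < - 1" by (simp add: N_def)
      moreover have "A_op V E t K S \<le> 0" using K(3) S by blast
      ultimately show ?thesis using S sum by simp
    next
      case False
      then have "A_op V E t K S \<le> - 1" using K(2) S by blast
      moreover have "A_op V E t (\<kappa> S0) S \<le> 0" using \<kappa>0 S by blast
      ultimately show ?thesis using S sum by simp
    qed
    moreover have "A_op V E t ?K S \<le> 0" if S: "S \<in> R" for S
      using sum[OF S] K(3) \<kappa>0 S by (simp add: add_nonpos_nonpos)
    moreover have "?K \<in> ?P" using K(1) \<kappa>[OF S0] by (intro psd_kernels_add) auto
    ultimately show ?case by blast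
  qed
  then show ?thesis using that F(3) QR(1) by blast
qed

text \<open>The kernel \<open>K2\<close> handles the sets with more than \<open>t\<close> elements, but its image may be as large as
  some \<open>c\<close> on smaller ones. There the image of \<open>(c + 1) K1\<close> is at most \<open>-(c + 1)\<close>, and it is nonpositive on
  the larger sets.\<close>

lemma strictly_feasible_kernel:
  assumes t: "t \<ge> 1"
  obtains K where "K \<in> psd_kernels (indep_space V E t)"
    "\<And>S. S \<in> indep_upto V E (2 * t) - {{}} \<Longrightarrow> A_op V E t K S \<le> - 1"
proof -
  let ?X = "indep_space V E (2 * t)"
  let ?P = "psd_kernels (indep_space V E t)"
  have t2: "2 * t \<ge> 1" using t by simp
  have clo: "closedin ?X {S \<in> indep_upto V E (2 * t). P (card S)}" for P
  proof -
    have "topspace ?X - {S \<in> indep_upto V E (2 * t). P (card S)} = {S \<in> indep_upto V E (2 * t). \<not> P (card S)}"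
      by auto
    then show ?thesis unfolding closedin_def using openin_indep_space_card[of "2 * t" "\<lambda>k. \<not> P k"] by auto
  qed
  define Q1 where "Q1 = {S \<in> indep_upto V E (2 * t). card S \<noteq> 0 \<and> card S \<le> t}"
  define Q2 where "Q2 = {S \<in> indep_upto V E (2 * t). t < card S}"
  obtain K1 where K1: "K1 \<in> ?P" "\<And>S. S \<in> Q1 \<Longrightarrow> A_op V E t K1 S \<le> - 1"
      "\<And>S. S \<in> indep_upto V E (2 * t) - {{}} \<Longrightarrow> A_op V E t K1 S \<le> 0"
  proof (rule kernel_on_compact_set[OF t _ t2, of Q1 "indep_upto V E (2 * t) - {{}}"])
    show "closedin ?X Q1" unfolding Q1_def by (rule clo)
    show "Q1 \<subseteq> indep_upto V E (2 * t) - {{}}" by (auto simp: Q1_def)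
    fix S0 assume "S0 \<in> Q1"
    then have S0: "S0 \<in> indep_upto V E t" "S0 \<noteq> {}" by (auto simp: Q1_def indep_upto_iff)
    show "\<exists>K\<in>?P. A_op V E t K S0 \<le> - 2 \<and> (\<forall>S\<in>indep_upto V E (2 * t) - {{}}. A_op V E t K S \<le> 0)"
      using kernel_near_small_set[OF t S0, of "2 * t"] by metis
  qed auto
  obtain K2 where K2: "K2 \<in> ?P" "\<And>S. S \<in> Q2 \<Longrightarrow> A_op V E t K2 S \<le> - 1"
  proof (rule kernel_on_compact_set[OF t _ t2, of Q2 Q2])
    show "closedin ?X Q2" unfolding Q2_def by (rule clo)
    show "Q2 \<subseteq> indep_upto V E (2 * t)" by (auto simp: Q2_def)
    fix S0 assume "S0 \<in> Q2"
    then have S0: "S0 \<in> indep_upto V E (2 * t)" "t < card S0" by (auto simp: Q2_def)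
    obtain K where "K \<in> ?P" "A_op V E t K S0 \<le> - 2"
      "\<And>S. S \<in> indep_upto V E (2 * t) \<Longrightarrow> t < card S \<Longrightarrow> A_op V E t K S \<le> 0"
      using kernel_near_large_set[OF t S0, of "2 * t"] by metis
    then show "\<exists>K\<in>?P. A_op V E t K S0 \<le> - 2 \<and> (\<forall>S\<in>Q2. A_op V E t K S \<le> 0)"
      unfolding Q2_def by blast
  qed auto
  have "continuous_map ?X euclideanreal (A_op V E t K2)"
    using K2(1) by (intro continuous_map_A_op[OF t]) (auto simp: psd_kernels_def sym_kernels_def)
  then obtain c where c: "0 \<le> c" "\<And>S. S \<in> indep_upto V E (2 * t) \<Longrightarrow> \<bar>A_op V E t K2 S\<bar> \<le> c"
    using continuous_map_compact_bounded[OF compact_indep_space[OF t2]] by (metis topspace_indep_space)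
  let ?K = "\<lambda>p. K2 p + (c + 1) * K1 p"
  show ?thesis
  proof
    show "?K \<in> ?P" using K1(1) K2(1) c(1) by (intro psd_kernels_add psd_kernels_scale) auto
    fix S assume S: "S \<in> indep_upto V E (2 * t) - {{}}"
    then have SI: "S \<in> indep_upto V E (2 * t)" by simp
    have val: "A_op V E t ?K S = A_op V E t K2 S + (c + 1) * A_op V E t K1 S"
      by (simp only: A_op_add[OF SI] A_op_scale[OF SI])
    show "A_op V E t ?K S \<le> - 1"
    proof (cases "card S \<le> t")
      case True
      then have "S \<in> Q1" using S by (auto simp: Q1_def indep_upto_iff)
      then have "(c + 1) * A_op V E t K1 S \<le> (c + 1) * (- 1)"
        using K1(2) c(1) by (intro mult_left_mono) auto
      then show ?thesis using val c(2)[OF SI] by simp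
    next
      case False
      then have "A_op V E t K2 S \<le> - 1" using K2(2) SI by (simp add: Q2_def)
      moreover have "(c + 1) * A_op V E t K1 S \<le> 0"
        using K1(3)[OF S] c(1) by (simp add: mult_nonneg_nonpos)
      ultimately show ?thesis using val by simp
    qed
  qed
qed

section \<open>The adjoint and the feasible measures\<close>

lemma continuous_map_psd:
  "K \<in> psd_kernels X \<Longrightarrow> continuous_map (prod_topology X X) euclideanreal K"
  by (simp add: psd_kernels_def sym_kernels_def)

text \<open>The definite description in \<open>A_adj\<close> denotes: \<open>K \<mapsto> \<integral> A\<^sub>tK d\<lambda>\<close> is positive on all
  continuous kernels, and it is invariant under swapping the variables because the index set of the
  sum in \<open>A\<^sub>t\<close> is.\<close>

lemma A_adj_represents:
  assumes t: "t \<ge> 1" and M: "finite_radon_measure (indep_space V E (2 * t)) M"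
  shows "A_adj V E t (measure M) \<in> sym_measures (indep_space V E t)"
    and "K \<in> sym_kernels (indep_space V E t) \<Longrightarrow>
      signed_integral (prod_topology (indep_space V E t) (indep_space V E t)) (A_adj V E t (measure M)) K
        = (\<integral>S. A_op V E t K S \<partial>M)"
proof -
  let ?I = "indep_space V E t" and ?X = "indep_space V E (2 * t)"
  note D = finite_radon_measureD[OF M]
  have t2: "2 * t \<ge> 1" using t by simp
  note I = compact_indep_space[OF t] Hausdorff_indep_space[of t]
  define L where "L K = (\<integral>S. A_op V E t K S \<partial>M)" for K
  have int: "integrable M (A_op V E t K)" if "continuous_map (prod_topology ?I ?I) euclideanreal K" for K
    by (rule integrable_continuous_map[OF compact_indep_space[OF t2] D(1,2) continuous_map_A_op[OF t that]])
  have sp: "space M = indep_upto V E (2 * t)" using D(3) by simp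
  have L: "positive_functional (prod_topology ?I ?I) L"
  proof
    show "compact_space (prod_topology ?I ?I)" "Hausdorff_space (prod_topology ?I ?I)"
      using I by (auto simp: compact_space_prod_topology Hausdorff_space_prod_topology)
  next
    fix K K' assume K: "continuous_map (prod_topology ?I ?I) euclideanreal K"
      and K': "continuous_map (prod_topology ?I ?I) euclideanreal K'"
    have "L (\<lambda>p. K p + K' p) = (\<integral>S. A_op V E t K S + A_op V E t K' S \<partial>M)"
      unfolding L_def by (intro Bochner_Integration.integral_cong refl A_op_add) (simp add: sp)
    then show "L (\<lambda>p. K p + K' p) = L K + L K'" using int[OF K] int[OF K'] by (simp add: L_def)
  next
    fix K and c :: real assume K: "continuous_map (prod_topology ?I ?I) euclideanreal K"
    have "L (\<lambda>p. c * K p) = (\<integral>S. c * A_op V E t K S \<partial>M)"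
      unfolding L_def by (intro Bochner_Integration.integral_cong refl A_op_scale) (simp add: sp)
    then show "L (\<lambda>p. c * K p) = c * L K" by (simp add: L_def)
  next
    fix K :: "'a set \<times> 'a set \<Rightarrow> real"
    assume K: "\<And>p. p \<in> topspace (prod_topology ?I ?I) \<Longrightarrow> 0 \<le> K p"
    show "0 \<le> L K"
      unfolding L_def
    proof (rule Bochner_Integration.integral_nonneg)
      fix S assume "S \<in> space M"
      then have S: "S \<in> indep_upto V E (2 * t)" using sp by simp
      show "0 \<le> A_op V E t K S"
        unfolding A_op_covers[OF S]
        by (intro sum_nonneg K) (auto dest: covers_indep_upto[OF S])
    qed
  qed
  have "L (\<lambda>p. K (prod.swap p)) = L K" for K
    unfolding L_def by (intro Bochner_Integration.integral_cong refl A_op_swap) (simp add: sp)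
  then have "\<exists>!\<mu>. \<mu> \<in> sym_measures ?I \<and> (\<forall>K\<in>sym_kernels ?I. signed_integral (prod_topology ?I ?I) \<mu> K = L K)"
    using unique_symmetric_representation[OF I L] by blast
  then have "A_adj V E t (measure M) \<in> sym_measures ?I \<and>
      (\<forall>K\<in>sym_kernels ?I. signed_integral (prod_topology ?I ?I) (A_adj V E t (measure M)) K = L K)"
    unfolding A_adj_def signed_integral_measure[OF M] L_def by (rule theI')
  then show "A_adj V E t (measure M) \<in> sym_measures ?I"
    and "K \<in> sym_kernels ?I \<Longrightarrow> signed_integral (prod_topology ?I ?I) (A_adj V E t (measure M)) K
        = (\<integral>S. A_op V E t K S \<partial>M)"
    by (auto simp: L_def)
qed

lemma measure_in_las_feasible_iff:
  assumes t: "t \<ge> 1" and M: "finite_radon_measure (indep_space V E (2 * t)) M"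
  shows "measure M \<in> las_feasible V E t \<longleftrightarrow>
    measure M {{}} = 1 \<and> (\<forall>K\<in>psd_kernels (indep_space V E t). 0 \<le> (\<integral>S. A_op V E t K S \<partial>M))"
  using A_adj_represents[OF t M] measure_in_nonneg_radon_measures[OF M]
  by (auto simp: las_feasible_def psd_measures_def psd_kernels_def)

lemma continuous_map_indicator_card:
  "continuous_map (indep_space V E n) euclideanreal (indicator {S \<in> indep_upto V E n. P (card S)})"
  unfolding continuous_map_def
proof (intro conjI allI impI)
  fix U :: "real set"
  have "{S \<in> topspace (indep_space V E n). indicator {S \<in> indep_upto V E n. P (card S)} S \<in> U}
      = {S \<in> indep_upto V E n. (if P (card S) then 1 else 0) \<in> U}"
    by (auto simp: indicator_def)
  then show "openin (indep_space V E n) {S \<in> topspace (indep_space V E n). indicator {S \<in> indep_upto V E n. P (card S)} S \<in> U}"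
    using openin_indep_space_card[of n "\<lambda>k. (if P k then 1 else 0) \<in> U"] by simp
qed auto

lemma indep_eq_1_eq_card: "n \<ge> 1 \<Longrightarrow> indep_eq V E 1 = {S \<in> indep_upto V E n. card S = 1}"
  by (auto simp: indep_upto_iff indep_eq_def)

section \<open>Strong duality\<close>

text \<open>Integrate the dual constraint, in the form
  \<open>1\<^bsub>I=1\<^esub> \<le> K(\<emptyset>, \<emptyset>) 1\<^bsub>{\<emptyset>}\<^esub> - A\<^sub>tK\<close> valid on all of \<open>I\<^bsub>2t\<^esub>\<close>.\<close>

lemma weak_duality:
  assumes t: "t \<ge> 1" and \<nu>: "\<nu> \<in> las_feasible V E t" and K: "K \<in> las_dual_feasible V E t"
  shows "\<nu> (indep_eq V E 1) \<le> K ({}, {})"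
proof -
  let ?I = "indep_space V E t" and ?X = "indep_space V E (2 * t)"
  have t2: "2 * t \<ge> 1" using t by simp
  obtain M where M: "finite_radon_measure ?X M" "\<nu> = measure M"
    using \<nu> nonneg_radon_measuresE unfolding las_feasible_def by blast
  note D = finite_radon_measureD[OF M(1)]
  interpret finite_measure M by (rule D)
  have feas: "measure M {{}} = 1" "0 \<le> (\<integral>S. A_op V E t K S \<partial>M)"
    using \<nu> K measure_in_las_feasible_iff[OF t M(1)] M(2) by (auto simp: las_dual_feasible_def)
  note int = integrable_continuous_map[OF compact_indep_space[OF t2] D(1,2)]
  have Kc: "continuous_map (prod_topology ?I ?I) euclideanreal K"
    using K by (auto simp: las_dual_feasible_def intro: continuous_map_psd)
  have i1: "integrable M (indicator (indep_eq V E 1) :: 'a set \<Rightarrow> real)"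
    using int[OF continuous_map_indicator_card[of "2 * t" "\<lambda>k. k = 1"]] indep_eq_1_eq_card[OF t2] by simp
  have i0: "integrable M (indicator {{}} :: 'a set \<Rightarrow> real)"
    using int[OF continuous_map_indicator_card[of "2 * t" "\<lambda>k. k = 0"]] singleton_empty_eq_card[of "2 * t"] by simp
  have iA: "integrable M (A_op V E t K)" by (rule int[OF continuous_map_A_op[OF t Kc]])
  have sub: "indep_eq V E 1 \<subseteq> space M" "{{}} \<subseteq> space M"
    using indep_eq_1_eq_card[OF t2] D(3) by auto
  have "measure M (indep_eq V E 1) = (\<integral>S. indicator (indep_eq V E 1) S \<partial>M)"
    using sub by (simp add: Int_absorb2)
  also have "\<dots> \<le> (\<integral>S. K ({}, {}) * indicator {{}} S - A_op V E t K S \<partial>M)"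
  proof (rule integral_mono)
    fix S assume "S \<in> space M"
    then have S: "S \<in> indep_upto V E (2 * t)" using D(3) by simp
    show "indicator (indep_eq V E 1) S \<le> K ({}, {}) * indicator {{}} S - A_op V E t K S"
    proof (cases "S = {}")
      case True
      then show ?thesis by (simp add: A_op_empty indep_eq_def)
    next
      case False
      then have "A_op V E t K S \<le> - indicator (indep_eq V E 1) S"
        using K S by (auto simp: las_dual_feasible_def)
      then show ?thesis using False by simp
    qed
  qed (use i1 i0 iA in auto)
  also have "\<dots> = K ({}, {}) * (\<integral>S. indicator {{}} S \<partial>M) - (\<integral>S. A_op V E t K S \<partial>M)"
    using i0 iA by simp
  also have "(\<integral>S. indicator {{}} S \<partial>M) = measure M {{}}" using sub by (simp add: Int_absorb2)
  finally show ?thesis using feas M(2) by simp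
qed

text \<open>The sublinear function \<open>p\<close> measures how large a multiple of \<open>e\<close> is needed to dominate \<open>f\<close> modulo the
  images of positive semidefinite kernels. It is finite since \<open>f(\<emptyset>)\<close> is a lower bound
  for the admissible multiples and since the strictly feasible kernel, scaled by a bound of \<open>f\<close>,
  provides an admissible one. A linear functional below \<open>p\<close> that touches \<open>p\<close> at \<open>b\<close> is the optimal
  measure.\<close>

lemma dual_value_attained:
  assumes t: "t \<ge> 1"
  obtains \<nu> where "\<nu> \<in> las_feasible V E t" "las_dual V E t \<le> ereal (\<nu> (indep_eq V E 1))"
proof -
  let ?I = "indep_space V E t" and ?X = "indep_space V E (2 * t)"
  have t2: "2 * t \<ge> 1" using t by simp
  define C where "C = {f. continuous_map ?X euclideanreal f}"
  define e where "e = (indicator {{}} :: 'a set \<Rightarrow> real)"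
  define b where "b = (indicator (indep_eq V E 1) :: 'a set \<Rightarrow> real)"
  define D where "D f = {s. \<exists>K\<in>psd_kernels ?I. \<forall>S\<in>indep_upto V E (2 * t). f S + A_op V E t K S \<le> s * e S}" for f
  define p where "p f = Inf (D f)" for f
  have C: "function_space C"
    by (auto simp: function_space_def C_def intro: continuous_map_add continuous_map_real_mult_left)
  have eC: "e \<in> C" and bC: "b \<in> C"
    using continuous_map_indicator_card[of "2 * t" "\<lambda>k. k = 0"] singleton_empty_eq_card[of "2 * t"]
      continuous_map_indicator_card[of "2 * t" "\<lambda>k. k = 1"] indep_eq_1_eq_card[OF t2]
    by (simp_all add: C_def e_def b_def)
  have b_empty: "b {} = 0" by (simp add: b_def indep_eq_def)
  have e_simps: "e {} = 1" "\<And>S. S \<noteq> {} \<Longrightarrow> e S = 0" by (auto simp: e_def)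
  have zero: "s \<in> D f" if "\<And>S. S \<in> indep_upto V E (2 * t) \<Longrightarrow> f S \<le> s * e S" for s f
  proof -
    have "A_op V E t (\<lambda>p. 0) S = 0" for S by (simp add: A_op_def)
    then show ?thesis
      unfolding D_def using that psd_kernels_zero by (intro CollectI bexI[of _ "\<lambda>p. 0"]) auto
  qed
  have D_ge: "f {} \<le> s" if s: "s \<in> D f" for f s
  proof -
    obtain K where K: "K \<in> psd_kernels ?I" "f {} + A_op V E t K {} \<le> s * e {}"
      using s empty_in_indep_upto unfolding D_def by blast
    then show ?thesis using psd_kernels_diagonal[OF K(1), of "{}"] by (simp add: A_op_empty e_simps)
  qed
  then have bdd: "bdd_below (D f)" for f by (meson bdd_belowI)
  have nonempty: "D f \<noteq> {}" if f: "f \<in> C" for f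
  proof -
    obtain B where B: "0 \<le> B" "\<And>S. S \<in> indep_upto V E (2 * t) \<Longrightarrow> \<bar>f S\<bar> \<le> B"
      using f continuous_map_compact_bounded[OF compact_indep_space[OF t2]]
      unfolding C_def by (metis mem_Collect_eq topspace_indep_space)
    obtain K where K: "K \<in> psd_kernels ?I"
        "\<And>S. S \<in> indep_upto V E (2 * t) - {{}} \<Longrightarrow> A_op V E t K S \<le> - 1"
      using strictly_feasible_kernel[OF t] by blast
    \<comment> \<open>at the empty set, \<open>B\<close> pays for \<open>f\<close> and \<open>B * K ({}, {})\<close> for the kernel\<close>
    have "f S + A_op V E t (\<lambda>p. B * K p) S \<le> (B + B * K ({}, {})) * e S"
      if S: "S \<in> indep_upto V E (2 * t)" for S
    proof (cases "S = {}")
      case True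
      then show ?thesis using B(2)[OF S] by (simp add: A_op_empty e_simps)
    next
      case False
      then have "B * A_op V E t K S \<le> B * (- 1)" using K(2) S B(1) by (intro mult_left_mono) auto
      then show ?thesis using B(2)[OF S] False by (simp add: A_op_scale[OF S] e_simps)
    qed
    then have "B + B * K ({}, {}) \<in> D f"
      unfolding D_def using psd_kernels_scale[OF K(1) B(1)] by blast
    then show ?thesis by blast
  qed
  have p_le: "p f \<le> s" if "s \<in> D f" for f s
    unfolding p_def using that bdd by (rule cInf_lower)
  have p_ge: "z \<le> p f" if "f \<in> C" "\<And>s. s \<in> D f \<Longrightarrow> z \<le> s" for f z
    unfolding p_def using nonempty that by (intro cInf_greatest) auto
  have "sublinear_on C p"
    unfolding sublinear_on_def
  proof (intro conjI ballI allI impI)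
    fix f g assume f: "f \<in> C" and g: "g \<in> C"
    have *: "p (\<lambda>S. f S + g S) \<le> r + s" if r: "r \<in> D f" and s: "s \<in> D g" for r s
    proof (rule p_le)
      obtain K where K: "K \<in> psd_kernels ?I" "\<And>S. S \<in> indep_upto V E (2 * t) \<Longrightarrow> f S + A_op V E t K S \<le> r * e S"
        using r unfolding D_def by blast
      obtain K' where K': "K' \<in> psd_kernels ?I" "\<And>S. S \<in> indep_upto V E (2 * t) \<Longrightarrow> g S + A_op V E t K' S \<le> s * e S"
        using s unfolding D_def by blast
      have "f S + g S + A_op V E t (\<lambda>p. K p + K' p) S \<le> (r + s) * e S" if S: "S \<in> indep_upto V E (2 * t)" for S
        using K(2)[OF S] K'(2)[OF S] by (simp add: A_op_add[OF S] algebra_simps)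
      then show "r + s \<in> D (\<lambda>S. f S + g S)"
        unfolding D_def using psd_kernels_add[OF K(1) K'(1)] by blast
    qed
    have "p (\<lambda>S. f S + g S) - s \<le> p f" if "s \<in> D g" for s
      using f by (rule p_ge) (use *[OF _ that] in \<open>simp add: algebra_simps\<close>)
    then have "p (\<lambda>S. f S + g S) - p f \<le> p g"
      by (intro p_ge[OF g]) (simp add: algebra_simps)
    then show "p (\<lambda>S. f S + g S) \<le> p f + p g" by simp
  next
    fix f and c :: real assume f: "f \<in> C" and c: "0 < c"
    have "(1 / c) * p (\<lambda>S. c * f S) \<le> p f"
    proof (rule p_ge[OF f])
      fix s assume "s \<in> D f"
      then obtain K where K: "K \<in> psd_kernels ?I" "\<And>S. S \<in> indep_upto V E (2 * t) \<Longrightarrow> f S + A_op V E t K S \<le> s * e S"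
        unfolding D_def by blast
      have "c * f S + A_op V E t (\<lambda>p. c * K p) S \<le> (c * s) * e S" if S: "S \<in> indep_upto V E (2 * t)" for S
        using mult_left_mono[OF K(2)[OF S], of c] c by (simp add: A_op_scale[OF S] algebra_simps)
      then have "c * s \<in> D (\<lambda>S. c * f S)"
        unfolding D_def using psd_kernels_scale[OF K(1), of c] c by auto
      then have "p (\<lambda>S. c * f S) \<le> c * s" by (rule p_le)
      then show "(1 / c) * p (\<lambda>S. c * f S) \<le> s" using c by (simp add: field_simps)
    qed
    then show "p (\<lambda>S. c * f S) \<le> c * p f" using c by (simp add: field_simps)
  qed
  then obtain l where l_add: "\<And>f g. f \<in> C \<Longrightarrow> g \<in> C \<Longrightarrow> l (\<lambda>x. f x + g x) = l f + l g"
    and l_scale: "\<And>c f. f \<in> C \<Longrightarrow> l (\<lambda>x. c * f x) = c * l f"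
    and l_le: "\<And>f. f \<in> C \<Longrightarrow> l f \<le> p f" and l_b: "l b = p b"
    using Hahn_Banach_touching[OF C _ bC, of p] by blast
  \<comment> \<open>lower bounds for \<open>l\<close>, obtained from the upper bound \<open>p\<close> at \<open>-f\<close>\<close>
  have l_ge: "s \<le> l f" if f: "f \<in> C" and s: "- s \<in> D (\<lambda>S. (- 1) * f S)" for f s
  proof -
    have "(\<lambda>S. (- 1) * f S) \<in> C" using f C unfolding function_space_def by blast
    then have "l (\<lambda>S. (- 1) * f S) \<le> - s" using l_le p_le[OF s] by (meson order_trans)
    then show ?thesis using l_scale[OF f, of "-1"] by simp
  qed
  have "positive_functional ?X l"
  proof
    show "compact_space ?X" by (rule compact_indep_space[OF t2])
    show "Hausdorff_space ?X" by (rule Hausdorff_indep_space)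
    show "0 \<le> l f" if "continuous_map ?X euclideanreal f" "\<And>S. S \<in> topspace ?X \<Longrightarrow> 0 \<le> f S" for f
      using that by (intro l_ge) (auto simp: C_def intro!: zero)
  qed (use l_add l_scale in \<open>auto simp: C_def\<close>)
  then interpret l: positive_functional ?X l .
  define M where "M = l.representing_measure"
  have M: "finite_radon_measure ?X M" and M_int: "\<And>f. f \<in> C \<Longrightarrow> (\<integral>S. f S \<partial>M) = l f"
    using l.Riesz_representation by (auto simp: M_def C_def)
  note MD = finite_radon_measureD[OF M]
  have sub: "indep_eq V E 1 \<subseteq> space M" "{{}} \<subseteq> space M"
    using indep_eq_1_eq_card[OF t2] MD(3) by auto
  have "l e = 1"
  proof (rule antisym)
    have "l e \<le> p e" by (rule l_le[OF eC])
    also have "\<dots> \<le> 1" by (rule p_le, rule zero) simp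
    finally show "l e \<le> 1" .
    show "1 \<le> l e" by (rule l_ge[OF eC], rule zero) simp
  qed
  moreover have "measure M {{}} = (\<integral>S. e S \<partial>M)" using sub by (simp add: e_def Int_absorb2)
  ultimately have M_empty: "measure M {{}} = 1" using M_int[OF eC] by simp
  have "0 \<le> (\<integral>S. A_op V E t K S \<partial>M)" if K: "K \<in> psd_kernels ?I" for K
  proof -
    have AC: "A_op V E t K \<in> C"
      unfolding C_def using continuous_map_A_op[OF t continuous_map_psd[OF K]] by simp
    have "- 0 \<in> D (\<lambda>S. (- 1) * A_op V E t K S)"
      unfolding D_def using K by (intro CollectI bexI[of _ K]) auto
    then show ?thesis using l_ge[OF AC, of 0] M_int[OF AC] by simp
  qed
  then have feas: "measure M \<in> las_feasible V E t"
    using measure_in_las_feasible_iff[OF t M] M_empty by blast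
  have val: "measure M (indep_eq V E 1) = p b"
    using sub M_int[OF bC] l_b by (simp add: b_def Int_absorb2)
  have le_s: "las_dual V E t \<le> ereal s" if s: "s \<in> D b" for s
  proof -
    obtain K where K: "K \<in> psd_kernels ?I" "\<And>S. S \<in> indep_upto V E (2 * t) \<Longrightarrow> b S + A_op V E t K S \<le> s * e S"
      using s unfolding D_def by blast
    have "A_op V E t K S \<le> - indicator (indep_eq V E 1) S" if "S \<in> indep_upto V E (2 * t) - {{}}" for S
      using K(2)[of S] that e_simps(2)[of S] by (simp add: b_def)
    then have "K \<in> las_dual_feasible V E t" using K(1) by (simp add: las_dual_feasible_def)
    then have "las_dual V E t \<le> ereal (K ({}, {}))" unfolding las_dual_def by (rule INF_lower)
    also have "K ({}, {}) \<le> s" using K(2)[of "{}"] by (simp add: b_empty e_simps A_op_empty)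
    finally show ?thesis by simp
  qed
  have "las_dual V E t \<le> ereal (p b)"
  proof (rule ccontr)
    assume "\<not> ?thesis"
    then obtain r where r: "ereal (p b) < ereal r" "ereal r < las_dual V E t"
      using ereal_dense2 by (meson not_le)
    then obtain s where "s \<in> D b" "s < r"
      using cInf_lessD[of "D b" r] nonempty[OF bC] by (auto simp: p_def)
    then have "las_dual V E t < ereal r" using le_s by (meson ereal_less(2) le_less_trans less_ereal.simps(1))
    with r(2) show False by simp
  qed
  then show ?thesis using that[OF feas] val by simp
qed

text \<open>The measure of the previous lemma closes the gap that weak duality leaves open.\<close>

theorem strong_duality:
  assumes t: "t \<ge> 1"
  shows "las V E t = las_dual V E t" "\<exists>\<nu>\<in>las_feasible V E t. ereal (\<nu> (indep_eq V E 1)) = las V E t"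
proof -
  have weak: "las V E t \<le> las_dual V E t"
    unfolding las_def las_dual_def
    by (intro SUP_least INF_greatest) (use weak_duality[OF t] in simp)
  obtain \<nu> where \<nu>: "\<nu> \<in> las_feasible V E t" "las_dual V E t \<le> ereal (\<nu> (indep_eq V E 1))"
    using dual_value_attained[OF t] by blast
  have "ereal (\<nu> (indep_eq V E 1)) \<le> las V E t"
    unfolding las_def using \<nu>(1) by (rule SUP_upper)
  with weak \<nu> show "las V E t = las_dual V E t"
    "\<exists>\<nu>\<in>las_feasible V E t. ereal (\<nu> (indep_eq V E 1)) = las V E t"
    by (auto intro!: bexI[of _ \<nu>])
qed

end

theorem theorem1:
  fixes V :: "'a topology" and E :: "'a set set" and t :: nat
  assumes "compact_topological_packing_graph V E"
    and "t \<ge> 1"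
  shows "las V E t = las_dual V E t \<and>
         (\<bar>las V E t\<bar> \<noteq> \<infinity> \<longrightarrow>
            (\<exists>\<nu>\<in>las_feasible V E t. ereal (\<nu> (indep_eq V E 1)) = las V E t))"
proof -
  interpret compact_packing_graph V E
    using assms(1) by unfold_locales (auto simp: compact_topological_packing_graph_def)
  show ?thesis using strong_duality[OF assms(2)] by blast
qed

end
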